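(* Let $(M,g)$ be a semi-Riemannian manifold and $\gamma:[a,b]\to M$ a geodesic. Let $t_0\in\left]a,b\right]$ be the first conjugate instant along $\gamma$, and assume that it is nondegenerate and that $\mathrm{mul}(t_0)>n_-(g)+n_-(g,t_0)$. Then for every $a'<a$ such that $\gamma$ extends to a geodesic on $[a',b]$ (still denoted $\gamma$), there exists an instant $t'\in[a,t_0]$ such that $\gamma(t')$ is conjugate to $\gamma(a')$ along $\gamma$.
   Context: Jacobi fields along $\gamma$ are solutions of $\frac{\mathrm D^2}{\mathrm dt^2}J-R(\dot\gamma,J)\dot\gamma=0$, with $R(X,Y)=[\nabla_X,\nabla_Y]-\nabla_{[X,Y]}$. For $t\in\left]a,b\right]$ set $A_0[t]=\{\frac{\mathrm D}{\mathrm dt}J(t): J \text{ Jacobi field along }\gamma,\ J(a)=0,\ J(t)=0\}\subset T_{\gamma(t)}M$ and $\mathrm{mul}(t)=\dim A_0[t]$. An instant $t\in\left]a,b\right]$ is conjugate if $A_0[t]\ne\{0\}$; it is nondegenerate if the restriction of $g$ to $A_0[t]$ is nondegenerate. $n_-(g,t)$ is the index (maximal dimension of a negative definite subspace) of the restriction of $g$ to $A_0[t]\times A_0[t]$, and $n_-(g)$ is the index of $g$. For $a'<a\le t'$, $\gamma(t')$ is conjugate to $\gamma(a')$ along $\gamma$ if there is a nonzero Jacobi field along $\gamma$ vanishing at $a'$ and at $t'$. *)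

theory Defs
  imports "HOL-Analysis.Analysis"
begin

section \<open>Smooth maps\<close>

text \<open>
  The derivatives are taken within \<open>S\<close>. The notion is used for open \<open>S\<close>, and for relatively open
  subsets \<open>S\<close> of a nondegenerate real interval (one-sided derivatives at the end points); in both
  cases derivatives within \<open>S\<close> are unique. The function may have arbitrary values outside \<open>S\<close>.
\<close>

primrec Ck_on ::
  "nat \<Rightarrow> 'a::euclidean_space set \<Rightarrow> ('a \<Rightarrow> 'b::euclidean_space) \<Rightarrow> bool" where
  "Ck_on 0 S f \<longleftrightarrow> continuous_on S f"
| "Ck_on (Suc k) S f \<longleftrightarrow> f differentiable_on S \<and>
     (\<forall>v. Ck_on k S (\<lambda>x. frechet_derivative f (at x within S) v))"

definition smooth_on :: "'a::euclidean_space set \<Rightarrow> ('a \<Rightarrow> 'b::euclidean_space) \<Rightarrow> bool" where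
  "smooth_on S f \<longleftrightarrow> (\<forall>k. Ck_on k S f)"


section \<open>Symmetric bilinear forms on a subspace\<close>

definition nondegenerate_on :: "'e::euclidean_space set \<Rightarrow> ('e \<Rightarrow> 'e \<Rightarrow> real) \<Rightarrow> bool" where
  "nondegenerate_on W B \<longleftrightarrow> (\<forall>v\<in>W. (\<forall>w\<in>W. B v w = 0) \<longrightarrow> v = 0)"

definition neg_index :: "'e::euclidean_space set \<Rightarrow> ('e \<Rightarrow> 'e \<Rightarrow> real) \<Rightarrow> nat" where
  "neg_index W B =
     Max {dim V | V. subspace V \<and> V \<subseteq> W \<and> (\<forall>v\<in>V. v \<noteq> 0 \<longrightarrow> B v v < 0)}"


section \<open>Smooth manifolds\<close>

text \<open>
  The manifold is the whole (Hausdorff, second countable) type \<open>'m\<close>, modelled on \<open>'e\<close>.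
  A chart is a pair of its domain and its coordinate map.
\<close>

type_synonym ('m, 'e) chart = "'m set \<times> ('m \<Rightarrow> 'e)"

abbreviation chart_dom :: "('m, 'e) chart \<Rightarrow> 'm set" where
  "chart_dom c \<equiv> fst c"

abbreviation chart_map :: "('m, 'e) chart \<Rightarrow> 'm \<Rightarrow> 'e" where
  "chart_map c \<equiv> snd c"

abbreviation chart_inv :: "('m, 'e) chart \<Rightarrow> 'e \<Rightarrow> 'm" where
  "chart_inv c \<equiv> inv_into (chart_dom c) (chart_map c)"

abbreviation chart_img :: "('m, 'e) chart \<Rightarrow> 'e set" where
  "chart_img c \<equiv> chart_map c ` chart_dom c"

definition is_chart :: "('m::topological_space, 'e::euclidean_space) chart \<Rightarrow> bool" where
  "is_chart c \<longleftrightarrow> open (chart_dom c) \<and> open (chart_img c) \<and>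
     homeomorphism (chart_dom c) (chart_img c) (chart_map c) (chart_inv c)"

definition smooth_atlas ::
  "('m::{t2_space,second_countable_topology}, 'e::euclidean_space) chart set \<Rightarrow> bool" where
  "smooth_atlas A \<longleftrightarrow>
     (\<forall>c\<in>A. is_chart c) \<and> (\<Union>c\<in>A. chart_dom c) = UNIV \<and>
     (\<forall>c\<in>A. \<forall>d\<in>A. smooth_on (chart_map c ` (chart_dom c \<inter> chart_dom d))
                            (chart_map d \<circ> chart_inv c))"

text \<open>
  Tangent vectors at \<open>p\<close> are represented by elements of \<open>'e\<close>, namely by their components in one
  chart of the atlas around \<open>p\<close>, chosen once and for all for each point. This identifies the tangent
  space at \<open>p\<close> linearly with \<open>'e\<close>. Components in other charts are obtained by applying the
  differential of the transition map; in particular vector fields are \<^emph>\<open>not\<close> smooth or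
  differentiable as \<open>'e\<close>-valued functions, but only after this conversion to a fixed chart.
\<close>

definition tchart :: "('m, 'e) chart set \<Rightarrow> 'm \<Rightarrow> ('m, 'e) chart" where
  "tchart A p = (SOME c. c \<in> A \<and> p \<in> chart_dom c)"

definition change_comp ::
  "'m \<Rightarrow> ('m, 'e::euclidean_space) chart \<Rightarrow> ('m, 'e) chart \<Rightarrow> 'e \<Rightarrow> 'e" where
  "change_comp p c d v =
     frechet_derivative (chart_map d \<circ> chart_inv c) (at (chart_map c p)) v"


section \<open>Semi-Riemannian metrics\<close>

text \<open>\<open>g p\<close> is the scalar product on the tangent space at \<open>p\<close>, identified with \<open>'e\<close> as above.\<close>

type_synonym ('m, 'e) metric_field = "'m \<Rightarrow> 'e \<Rightarrow> 'e \<Rightarrow> real"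

text \<open>The components of \<open>g\<close> in the chart \<open>c\<close>, as a function of the coordinates \<open>x\<close>.\<close>

definition loc_metric ::
  "('m, 'e::euclidean_space) chart set \<Rightarrow> ('m, 'e) metric_field \<Rightarrow> ('m, 'e) chart \<Rightarrow>
     'e \<Rightarrow> 'e \<Rightarrow> 'e \<Rightarrow> real" where
  "loc_metric A g c x v w =
     (let p = chart_inv c x
      in g p (change_comp p c (tchart A p) v) (change_comp p c (tchart A p) w))"

definition semi_riemannian ::
  "('m::{t2_space,second_countable_topology}, 'e::euclidean_space) chart set \<Rightarrow>
     ('m, 'e) metric_field \<Rightarrow> bool" where
  "semi_riemannian A g \<longleftrightarrow>
     smooth_atlas A \<and>
     (\<forall>p. bilinear (g p) \<and> (\<forall>v w. g p v w = g p w v) \<and> nondegenerate_on UNIV (g p)) \<and>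
     (\<forall>c\<in>A. \<forall>v w. smooth_on (chart_img c) (\<lambda>x. loc_metric A g c x v w)) \<and>
     (\<forall>p q. neg_index UNIV (g p) = neg_index UNIV (g q))"

text \<open>The common index of all \<open>g p\<close>; the index is constant by definition of \<open>semi_riemannian\<close>.\<close>

definition metric_index :: "('m, 'e::euclidean_space) metric_field \<Rightarrow> nat" where
  "metric_index g = (THE k. \<forall>p. neg_index UNIV (g p) = k)"


section \<open>Levi-Civita connection and curvature\<close>

text \<open>
  In a chart the Levi-Civita connection is \<open>\<nabla>\<^sub>X Z = DZ(X) + \<Gamma>(X, Z)\<close>. The Christoffel map \<open>\<Gamma>\<close> at
  \<open>x\<close> is the unique bilinear map for which the connection is torsion free (\<open>\<Gamma>\<close> is symmetric) and
  compatible with the metric.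
\<close>

definition christoffel ::
  "('m, 'e::euclidean_space) chart set \<Rightarrow> ('m, 'e) metric_field \<Rightarrow> ('m, 'e) chart \<Rightarrow>
     'e \<Rightarrow> 'e \<Rightarrow> 'e \<Rightarrow> 'e" where
  "christoffel A g c x = (THE \<Gamma>. bilinear \<Gamma> \<and> (\<forall>u v. \<Gamma> u v = \<Gamma> v u) \<and>
     (\<forall>u v w. frechet_derivative (\<lambda>y. loc_metric A g c y v w) (at x) u =
        loc_metric A g c x (\<Gamma> u v) w + loc_metric A g c x v (\<Gamma> u w)))"

definition loc_nabla ::
  "('m, 'e::euclidean_space) chart set \<Rightarrow> ('m, 'e) metric_field \<Rightarrow> ('m, 'e) chart \<Rightarrow>
     ('e \<Rightarrow> 'e) \<Rightarrow> ('e \<Rightarrow> 'e) \<Rightarrow> 'e \<Rightarrow> 'e" where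
  "loc_nabla A g c X Z x =
     frechet_derivative Z (at x) (X x) + christoffel A g c x (X x) (Z x)"

definition lie_bracket :: "('e::euclidean_space \<Rightarrow> 'e) \<Rightarrow> ('e \<Rightarrow> 'e) \<Rightarrow> 'e \<Rightarrow> 'e" where
  "lie_bracket X Y x = frechet_derivative Y (at x) (X x) - frechet_derivative X (at x) (Y x)"

definition loc_curvature ::
  "('m, 'e::euclidean_space) chart set \<Rightarrow> ('m, 'e) metric_field \<Rightarrow> ('m, 'e) chart \<Rightarrow>
     ('e \<Rightarrow> 'e) \<Rightarrow> ('e \<Rightarrow> 'e) \<Rightarrow> ('e \<Rightarrow> 'e) \<Rightarrow> 'e \<Rightarrow> 'e" where
  "loc_curvature A g c X Y Z x =
     loc_nabla A g c X (loc_nabla A g c Y Z) x - loc_nabla A g c Y (loc_nabla A g c X Z) x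
     - loc_nabla A g c (lie_bracket X Y) Z x"

text \<open>
  \<open>curvature A g p u v w\<close> is \<open>R(u, v) w\<close>. Since the curvature is a tensor, its value at \<open>p\<close> can be
  computed from any extensions of \<open>u, v, w\<close> to vector fields near \<open>p\<close>; we extend them with
  constant components.
\<close>

definition curvature ::
  "('m, 'e::euclidean_space) chart set \<Rightarrow> ('m, 'e) metric_field \<Rightarrow> 'm \<Rightarrow>
     'e \<Rightarrow> 'e \<Rightarrow> 'e \<Rightarrow> 'e" where
  "curvature A g p u v w =
     loc_curvature A g (tchart A p) (\<lambda>_. u) (\<lambda>_. v) (\<lambda>_. w) (chart_map (tchart A p) p)"


section \<open>Curves, vector fields along curves, geodesics\<close>

text \<open>
  Curves \<open>\<gamma>\<close> and vector fields \<open>J\<close> along them are considered on an interval \<open>I\<close>; their values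
  outside \<open>I\<close> are irrelevant. \<open>J t\<close> is a tangent vector at \<open>\<gamma> t\<close>.
\<close>

definition smooth_curve ::
  "('m::topological_space, 'e::euclidean_space) chart set \<Rightarrow> (real \<Rightarrow> 'm) \<Rightarrow> real set \<Rightarrow> bool"
  where
  "smooth_curve A \<gamma> I \<longleftrightarrow> continuous_on I \<gamma> \<and>
     (\<forall>c\<in>A. smooth_on {t\<in>I. \<gamma> t \<in> chart_dom c} (\<lambda>t. chart_map c (\<gamma> t)))"

definition velocity ::
  "('m, 'e::euclidean_space) chart set \<Rightarrow> (real \<Rightarrow> 'm) \<Rightarrow> real set \<Rightarrow> real \<Rightarrow> 'e" where
  "velocity A \<gamma> I t =
     vector_derivative (\<lambda>s. chart_map (tchart A (\<gamma> t)) (\<gamma> s)) (at t within I)"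

definition loc_field ::
  "('m, 'e::euclidean_space) chart set \<Rightarrow> (real \<Rightarrow> 'm) \<Rightarrow> ('m, 'e) chart \<Rightarrow> (real \<Rightarrow> 'e) \<Rightarrow>
     real \<Rightarrow> 'e" where
  "loc_field A \<gamma> c J s = change_comp (\<gamma> s) (tchart A (\<gamma> s)) c (J s)"

definition smooth_field ::
  "('m, 'e::euclidean_space) chart set \<Rightarrow> (real \<Rightarrow> 'm) \<Rightarrow> real set \<Rightarrow> (real \<Rightarrow> 'e) \<Rightarrow> bool"
  where
  "smooth_field A \<gamma> I J \<longleftrightarrow>
     (\<forall>c\<in>A. smooth_on {t\<in>I. \<gamma> t \<in> chart_dom c} (loc_field A \<gamma> c J))"

text \<open>The covariant derivative \<open>D/dt\<close> of \<open>J\<close> along \<open>\<gamma>\<close>, in the chart that represents \<open>T\<^bsub>\<gamma>(t)\<^esub>M\<close>.\<close>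

definition cov_deriv ::
  "('m, 'e::euclidean_space) chart set \<Rightarrow> ('m, 'e) metric_field \<Rightarrow> (real \<Rightarrow> 'm) \<Rightarrow> real set \<Rightarrow>
     (real \<Rightarrow> 'e) \<Rightarrow> real \<Rightarrow> 'e" where
  "cov_deriv A g \<gamma> I J t =
     (let c = tchart A (\<gamma> t)
      in vector_derivative (loc_field A \<gamma> c J) (at t within I)
         + christoffel A g c (chart_map c (\<gamma> t)) (velocity A \<gamma> I t) (J t))"

definition geodesic ::
  "('m::topological_space, 'e::euclidean_space) chart set \<Rightarrow> ('m, 'e) metric_field \<Rightarrow>
     (real \<Rightarrow> 'm) \<Rightarrow> real set \<Rightarrow> bool" where
  "geodesic A g \<gamma> I \<longleftrightarrow>
     smooth_curve A \<gamma> I \<and> (\<forall>t\<in>I. cov_deriv A g \<gamma> I (velocity A \<gamma> I) t = 0)"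


section \<open>Jacobi fields and conjugate instants\<close>

definition jacobi_field ::
  "('m, 'e::euclidean_space) chart set \<Rightarrow> ('m, 'e) metric_field \<Rightarrow> (real \<Rightarrow> 'm) \<Rightarrow> real set \<Rightarrow>
     (real \<Rightarrow> 'e) \<Rightarrow> bool" where
  "jacobi_field A g \<gamma> I J \<longleftrightarrow>
     smooth_field A \<gamma> I J \<and>
     (\<forall>t\<in>I. cov_deriv A g \<gamma> I (cov_deriv A g \<gamma> I J) t
             - curvature A g (\<gamma> t) (velocity A \<gamma> I t) (J t) (velocity A \<gamma> I t) = 0)"

definition A0 ::
  "('m, 'e::euclidean_space) chart set \<Rightarrow> ('m, 'e) metric_field \<Rightarrow> (real \<Rightarrow> 'm) \<Rightarrow>
     real \<Rightarrow> real \<Rightarrow> real \<Rightarrow> 'e set" where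
  "A0 A g \<gamma> a b t =
     {cov_deriv A g \<gamma> {a..b} J t | J. jacobi_field A g \<gamma> {a..b} J \<and> J a = 0 \<and> J t = 0}"

definition mul ::
  "('m, 'e::euclidean_space) chart set \<Rightarrow> ('m, 'e) metric_field \<Rightarrow> (real \<Rightarrow> 'm) \<Rightarrow>
     real \<Rightarrow> real \<Rightarrow> real \<Rightarrow> nat" where
  "mul A g \<gamma> a b t = dim (A0 A g \<gamma> a b t)"

definition conjugate_instant ::
  "('m, 'e::euclidean_space) chart set \<Rightarrow> ('m, 'e) metric_field \<Rightarrow> (real \<Rightarrow> 'm) \<Rightarrow>
     real \<Rightarrow> real \<Rightarrow> real \<Rightarrow> bool" where
  "conjugate_instant A g \<gamma> a b t \<longleftrightarrow> t \<in> {a<..b} \<and> A0 A g \<gamma> a b t \<noteq> {0}"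

definition first_conjugate_instant ::
  "('m, 'e::euclidean_space) chart set \<Rightarrow> ('m, 'e) metric_field \<Rightarrow> (real \<Rightarrow> 'm) \<Rightarrow>
     real \<Rightarrow> real \<Rightarrow> real \<Rightarrow> bool" where
  "first_conjugate_instant A g \<gamma> a b t \<longleftrightarrow>
     conjugate_instant A g \<gamma> a b t \<and> (\<forall>s. conjugate_instant A g \<gamma> a b s \<longrightarrow> t \<le> s)"

definition nondegenerate_instant ::
  "('m, 'e::euclidean_space) chart set \<Rightarrow> ('m, 'e) metric_field \<Rightarrow> (real \<Rightarrow> 'm) \<Rightarrow>
     real \<Rightarrow> real \<Rightarrow> real \<Rightarrow> bool" where
  "nondegenerate_instant A g \<gamma> a b t \<longleftrightarrow> nondegenerate_on (A0 A g \<gamma> a b t) (g (\<gamma> t))"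

definition conj_index ::
  "('m, 'e::euclidean_space) chart set \<Rightarrow> ('m, 'e) metric_field \<Rightarrow> (real \<Rightarrow> 'm) \<Rightarrow>
     real \<Rightarrow> real \<Rightarrow> real \<Rightarrow> nat" where
  "conj_index A g \<gamma> a b t = neg_index (A0 A g \<gamma> a b t) (g (\<gamma> t))"

text \<open>\<open>\<gamma>(t)\<close> is conjugate to \<open>\<gamma>(s)\<close> along the geodesic \<open>\<gamma>\<close>, which is defined on \<open>I\<close>.\<close>

definition conjugate_along ::
  "('m, 'e::euclidean_space) chart set \<Rightarrow> ('m, 'e) metric_field \<Rightarrow> (real \<Rightarrow> 'm) \<Rightarrow> real set \<Rightarrow>
     real \<Rightarrow> real \<Rightarrow> bool" where
  "conjugate_along A g \<gamma> I s t \<longleftrightarrow>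
     (\<exists>J. jacobi_field A g \<gamma> I J \<and> (\<exists>r\<in>I. J r \<noteq> 0) \<and> J s = 0 \<and> J t = 0)"

end

theory Submission
  imports Defs
begin

text \<open>
  Suppose no \<open>t' \<in> [a, t0]\<close> is conjugate to \<open>a'\<close>. In a parallel frame along the extended geodesic the
  Jacobi equation reads \<open>j'' = R j\<close>, with \<open>R\<close> self-adjoint for a constant form \<open>h\<close> of index \<open>n\<^sub>-(g)\<close>.
  Let \<open>X\<close> be the matrix solution with \<open>X a' = 0\<close>, \<open>X a = 1\<close>, and \<open>Y\<close> the one with \<open>Y a = 0\<close>,
  \<open>Y' a = 1\<close>. By constancy of the Wronskians \<open>r = Y X\<^sup>*\<close> is a path of \<open>h\<close>-symmetric operators
  on \<open>[a, t0]\<close>. It is invertible on \<open>]a, t0[\<close>, so the index of \<open>h(r\<cdot>,\<cdot>)\<close> is constant there. Since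
  \<open>r a = 0\<close> and \<open>r' a = 1\<close>, this index is at most \<open>n\<^sub>-(g)\<close>. At \<open>t0\<close> the space \<open>A\<^sub>0[t0]\<close> lies in the
  kernel of \<open>r\<close>, and \<open>h(r'\<cdot>,\<cdot>) = h\<close> on it, so just before \<open>t0\<close> the form is negative definite on
  any subspace of \<open>A\<^sub>0[t0]\<close> where \<open>h\<close> is positive definite; nondegeneracy provides one of
  dimension \<open>mul(t0) - n\<^sub>-(g,t0) > n\<^sub>-(g)\<close>.
\<close>

section \<open>Symmetric bilinear forms\<close>

text \<open>Fields vanishing at \<open>a'\<close> and fields vanishing at \<open>a\<close> are two
  Lagrangian families for the Wronskian. Absence of instants conjugate to \<open>a'\<close> keeps
  the first family transversal to the condition \<open>J t = 0\<close> on all of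
  \<open>[a, t0]\<close>, which is what allows a single path of symmetric forms to describe the
  second family there. A Morse index count is no substitute: for indefinite \<open>g\<close> the
  index form has infinite index. Only inequalities are needed at the two ends, since definiteness on
  a subspace is an open condition; the degenerate forms \<open>r a\<close> and \<open>r t0\<close>
  never need an index of their own. The bulk of the work has another cause. Components of a tangent
  vector refer to a chart chosen separately at every point, so a field along the curve need not even
  be continuous as an \<open>'e\<close>-valued function. Analytic statements are therefore made
  either in one fixed chart, with a transformation law to pass between charts, or about scalar
  products with parallel fields, which do not depend on charts and lead back to ordinary functions
  into \<open>'e\<close>.\<close>

lemma representation_on:
  fixes B :: "'e::euclidean_space \<Rightarrow> 'e \<Rightarrow> real"
  assumes V: "subspace V" and B: "bilinear B" and nd: "nondegenerate_on V (\<lambda>v w. B w v)"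
    and l: "linear l"
  obtains v where "v \<in> V" "\<And>w. w \<in> V \<Longrightarrow> B w v = l w"
proof -
  obtain Bs where Bs: "Bs \<subseteq> V" "pairwise orthogonal Bs" "\<And>x. x \<in> Bs \<Longrightarrow> norm x = 1"
      "independent Bs" "card Bs = dim V" "span Bs = V"
    using orthonormal_basis_subspace[OF V] by metis
  have fin: "finite Bs" using Bs(4) independent_imp_finite by blast
  \<comment> \<open>\<open>T\<close> records the functional \<open>B _ v\<close> through its values
    on an orthonormal basis of \<open>V\<close>. Nondegeneracy makes it injective on
    \<open>V\<close>, a dimension count makes it onto \<open>V\<close>, and a preimage of the vector
    that records \<open>l\<close> represents \<open>l\<close>.\<close>
  define T where "T v = (\<Sum>b\<in>Bs. B b v *\<^sub>R b)" for v
  have linBr: "linear (B b)" for b using B by (auto simp: bilinear_def)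
  have linBl: "linear (\<lambda>b. B b v)" for v using B by (auto simp: bilinear_def)
  have linT: "linear T" unfolding T_def
    using linBr by (intro linear_compose_sum ballI linear_compose_scale_right)
      (auto simp: linear_iff scaleR_add_left)
  have TV: "T ` V \<subseteq> V" unfolding T_def
    using V Bs(1) by (auto intro!: subspace_sum subspace_scale)
  have coord: "(\<Sum>b\<in>Bs. f b *\<^sub>R b) \<bullet> c = f c" if c: "c \<in> Bs" for f c
  proof -
    have "(\<Sum>b\<in>Bs. f b *\<^sub>R b) \<bullet> c = (\<Sum>b\<in>Bs. if b = c then f c else 0)"
      unfolding inner_sum_left
      by (rule sum.cong) (use Bs(2,3) c in \<open>auto simp: pairwise_def orthogonal_def dot_square_norm\<close>)
    also have "\<dots> = f c" using fin c by simp
    finally show ?thesis .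
  qed
  have ext: "B w v = k w" if "\<And>b. b \<in> Bs \<Longrightarrow> B b v = k b" "linear k" "w \<in> V" for k v w
    using linear_eq_on_span[OF linBl that(2,1)] that(3) Bs(6) by metis
  have inj: "inj_on T V"
  proof (rule linear_inj_on_iff_eq_0[THEN iffD2, OF linT V], intro ballI impI)
    fix v assume v: "v \<in> V" "T v = 0"
    have "B b v = 0" if "b \<in> Bs" for b
      using coord[OF that, of "\<lambda>b. B b v"] v(2) by (simp add: T_def)
    then have "B w v = 0" if "w \<in> V" for w
      using ext[of v "\<lambda>_. 0" w] that by (simp add: linear_zero module_hom_zero)
    then show "v = 0" using nd v(1) by (auto simp: nondegenerate_on_def)
  qed
  have "dim (T ` V) = dim V" using linT inj V
    by (intro dim_image_eq) (auto simp: span_eq_iff[THEN iffD2, OF V])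
  then have surj: "T ` V = V"
    using subspace_dim_equal[of "T ` V" V] TV V linear_subspace_image[OF linT V] by simp
  have "(\<Sum>b\<in>Bs. l b *\<^sub>R b) \<in> V" using V Bs(1) by (auto intro!: subspace_sum subspace_scale)
  then obtain v where v: "v \<in> V" "T v = (\<Sum>b\<in>Bs. l b *\<^sub>R b)" using surj by (metis imageE)
  have "B b v = l b" if "b \<in> Bs" for b
    using coord[OF that, of "\<lambda>b. B b v"] coord[OF that, of l] v(2) by (simp add: T_def)
  then have "B w v = l w" if "w \<in> V" for w using ext[of v l w] that l by auto
  with v(1) show ?thesis using that by blast
qed

lemma finite_index_dims:
  fixes B :: "'e::euclidean_space \<Rightarrow> 'e \<Rightarrow> real"
  shows "finite {dim V | V. subspace V \<and> V \<subseteq> W \<and> (\<forall>v\<in>V. v \<noteq> 0 \<longrightarrow> B v v < 0)}"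
proof (rule finite_subset)
  show "{dim V | V. subspace V \<and> V \<subseteq> W \<and> (\<forall>v\<in>V. v \<noteq> 0 \<longrightarrow> B v v < 0)} \<subseteq> {..DIM('e)}"
    using dim_subset_UNIV by auto
qed simp

lemma dim_le_neg_index:
  assumes "subspace V" "V \<subseteq> W" "\<And>v. v \<in> V \<Longrightarrow> v \<noteq> 0 \<Longrightarrow> B v v < 0"
  shows "dim V \<le> neg_index W B"
  unfolding neg_index_def using assms by (intro Max_ge finite_index_dims) blast

lemma neg_index_attained:
  fixes B :: "'e::euclidean_space \<Rightarrow> 'e \<Rightarrow> real"
  assumes W: "subspace W"
  obtains V where "subspace V" "V \<subseteq> W" "\<And>v. v \<in> V \<Longrightarrow> v \<noteq> 0 \<Longrightarrow> B v v < 0"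
    "dim V = neg_index W B"
proof -
  have "dim {0::'e} \<in> {dim V | V. subspace V \<and> V \<subseteq> W \<and> (\<forall>v\<in>V. v \<noteq> 0 \<longrightarrow> B v v < 0)}"
    using subspace_0[OF W] by (intro CollectI exI[of _ "{0::'e}"]) (auto simp: subspace_single_0)
  then have "neg_index W B \<in> {dim V | V. subspace V \<and> V \<subseteq> W \<and> (\<forall>v\<in>V. v \<noteq> 0 \<longrightarrow> B v v < 0)}"
    unfolding neg_index_def by (intro Max_in finite_index_dims) blast
  then show ?thesis using that by auto
qed

text \<open>Definite subspaces of opposite sign meet only in 0. In this way a positive definite
  subspace bounds the index from above, without diagonalizing the form.\<close>

lemma neg_pos_def_dim_le:
  fixes B :: "'e::euclidean_space \<Rightarrow> 'e \<Rightarrow> real"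
  assumes "subspace V" "subspace P"
    and "\<And>v. v \<in> V \<Longrightarrow> v \<noteq> 0 \<Longrightarrow> B v v < 0" "\<And>v. v \<in> P \<Longrightarrow> v \<noteq> 0 \<Longrightarrow> B v v > 0"
  shows "dim V + dim P \<le> DIM('e)"
proof -
  have "V \<inter> P \<subseteq> {0}" using assms(3,4) by force
  then have "dim (V \<inter> P) = 0" by simp
  then show ?thesis
    using dim_sums_Int[OF assms(1,2)] dim_subset_UNIV[of "{x + y |x y. x \<in> V \<and> y \<in> P}"] by linarith
qed

text \<open>A negative definite \<open>V\<close> of maximal dimension is split off, and
  \<open>P\<close> is its orthogonal complement in \<open>W\<close>. Maximality leaves no negative
  vector in \<open>P\<close>, and nondegeneracy then excludes isotropic ones.\<close>

lemma neg_pos_split: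
  fixes B :: "'e::euclidean_space \<Rightarrow> 'e \<Rightarrow> real"
  assumes W: "subspace W" and B: "bilinear B" and sym: "\<And>v w. B v w = B w v"
    and nd: "nondegenerate_on W B"
  obtains P where "subspace P" "P \<subseteq> W" "\<And>v. v \<in> P \<Longrightarrow> v \<noteq> 0 \<Longrightarrow> B v v > 0"
    "neg_index W B + dim P = dim W"
proof -
  obtain V where V: "subspace V" "V \<subseteq> W" "\<And>v. v \<in> V \<Longrightarrow> v \<noteq> 0 \<Longrightarrow> B v v < 0"
    "dim V = neg_index W B" using neg_index_attained[OF W] by blast
  note bs = bilinear_ladd[OF B] bilinear_radd[OF B] bilinear_lmul[OF B] bilinear_rmul[OF B]
    bilinear_lsub[OF B] bilinear_rsub[OF B] bilinear_lzero[OF B] bilinear_rzero[OF B]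
  define P where "P = {w \<in> W. \<forall>v\<in>V. B v w = 0}"
  have P: "subspace P" unfolding P_def subspace_def
    using W by (auto simp: bs subspace_0 subspace_add subspace_scale)
  have VP: "V \<inter> P \<subseteq> {0}" using V(3) unfolding P_def by force
  have dec: "\<exists>v\<in>V. z - v \<in> P" if z: "z \<in> W" for z
  proof -
    have "nondegenerate_on V (\<lambda>v w. B w v)"
      unfolding nondegenerate_on_def using V(3) by force
    moreover have "linear (\<lambda>w. B w z)" using B by (auto simp: bilinear_def)
    ultimately obtain v where "v \<in> V" "\<And>w. w \<in> V \<Longrightarrow> B w v = B w z"
      using representation_on[OF V(1) B] by blast
    then show ?thesis using V(2) W z
      by (intro bexI[of _ v]) (auto simp: P_def bs subspace_diff)
  qed
  have semi: "B w w \<ge> 0" if w: "w \<in> P" for w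
  proof (rule ccontr)
    assume neg: "\<not> B w w \<ge> 0"
    let ?U = "{x + y |x y. x \<in> V \<and> y \<in> span {w}}"
    have wW: "w \<in> W" and orth: "\<And>v. v \<in> V \<Longrightarrow> B v w = 0" using w by (auto simp: P_def)
    have w0: "w \<noteq> 0" "w \<notin> V" using neg orth[of w] by (auto simp: bs)
    have U: "subspace ?U" using subspace_sums[OF V(1) subspace_span] .
    have "V \<inter> span {w} \<subseteq> {0}"
    proof
      fix x assume x: "x \<in> V \<inter> span {w}"
      then obtain k where k: "x = k *\<^sub>R w" by (auto simp: span_singleton)
      show "x \<in> {0}"
      proof (cases "k = 0")
        case False
        have "(1/k) *\<^sub>R x \<in> V" using x V(1) by (simp add: subspace_scale)
        then show ?thesis using k False w0 by simp
      qed (use k in auto)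
    qed
    then have "dim (V \<inter> span {w}) = 0" by simp
    moreover have "dim (span {w}) = 1" using w0 by simp
    ultimately have dU: "dim ?U = dim V + 1"
      using dim_sums_Int[OF V(1) subspace_span, of "{w}"] by linarith
    have "B u u < 0" if u: "u \<in> ?U" "u \<noteq> 0" for u
    proof -
      obtain v k where vk: "u = v + k *\<^sub>R w" "v \<in> V" using u by (auto simp: span_singleton)
      have e: "B u u = B v v + k\<^sup>2 * B w w"
        using orth[OF vk(2)] sym[of w v] by (simp add: vk(1) bs power2_eq_square)
      show ?thesis
      proof (cases "v = 0")
        case True
        then have "k \<noteq> 0" using u(2) vk by auto
        then show ?thesis using e neg True by (simp add: bs mult_pos_neg)
      next
        case False
        then have "B v v < 0" using V(3) vk by auto
        moreover have "k\<^sup>2 * B w w \<le> 0" using neg by (simp add: mult_nonneg_nonpos)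
        ultimately show ?thesis using e by simp
      qed
    qed
    moreover have "?U \<subseteq> W"
      using V(2) W wW by (auto simp: span_singleton intro!: subspace_add subspace_scale)
    ultimately have "dim ?U \<le> neg_index W B" using U by (intro dim_le_neg_index) auto
    then show False using dU V(4) by simp
  qed
  have pos: "B w w > 0" if w: "w \<in> P" "w \<noteq> 0" for w
  proof (rule ccontr)
    assume "\<not> B w w > 0"
    then have Bw: "B w w = 0" using semi[OF w(1)] by simp
    have wW: "w \<in> W" and orth: "\<And>v. v \<in> V \<Longrightarrow> B v w = 0" using w by (auto simp: P_def)
    obtain z where z: "z \<in> W" "B w z \<noteq> 0" using nd wW w(2) by (auto simp: nondegenerate_on_def)
    obtain v where v: "v \<in> V" "z - v \<in> P" using dec[OF z(1)] by blast
    define p where "p = z - v"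
    have wp: "B w p \<noteq> 0" using z(2) orth[OF v(1)] sym[of w v] by (simp add: p_def bs)
    \<comment> \<open>Since \<open>B w w = 0\<close>, the form at \<open>p + s *\<^sub>R w\<close>
      is affine in \<open>s\<close>; this choice makes its value -1.\<close>
    define s where "s = - (B p p + 1) / (2 * B w p)"
    have "p + s *\<^sub>R w \<in> P" using P v(2) w(1) by (simp add: p_def subspace_add subspace_scale)
    then have "0 \<le> B (p + s *\<^sub>R w) (p + s *\<^sub>R w)" using semi by blast
    also have "\<dots> = B p p + s * (2 * B w p)" using Bw sym[of p w] by (simp add: bs)
    also have "s * (2 * B w p) = - (B p p + 1)" using wp by (simp add: s_def)
    finally show False by simp
  qed
  have WVP: "{x + y |x y. x \<in> V \<and> y \<in> P} = W"
  proof
    show "{x + y |x y. x \<in> V \<and> y \<in> P} \<subseteq> W" using V(2) W by (auto simp: P_def subspace_add)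
    show "W \<subseteq> {x + y |x y. x \<in> V \<and> y \<in> P}"
    proof
      fix z assume "z \<in> W"
      then obtain v where "v \<in> V" "z - v \<in> P" using dec by blast
      then show "z \<in> {x + y |x y. x \<in> V \<and> y \<in> P}" by (intro CollectI exI[of _ v] exI[of _ "z - v"]) auto
    qed
  qed
  have "dim (V \<inter> P) = 0" using VP by simp
  then have "dim W = dim V + dim P" using dim_sums_Int[OF V(1) P] unfolding WVP by linarith
  then show ?thesis using that[of P] P pos V(4) by (auto simp: P_def)
qed

lemma bilinear_expand:
  fixes B :: "'e::euclidean_space \<Rightarrow> 'f::euclidean_space \<Rightarrow> 'c::real_vector"
  assumes "bilinear B"
  shows "B u v = (\<Sum>b\<in>Basis. \<Sum>b'\<in>Basis. ((u \<bullet> b) * (v \<bullet> b')) *\<^sub>R B b b')"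
proof -
  have "B u v = B (\<Sum>b\<in>Basis. (u \<bullet> b) *\<^sub>R b) (\<Sum>b\<in>Basis. (v \<bullet> b) *\<^sub>R b)"
    by (simp add: euclidean_representation)
  also have "\<dots> = (\<Sum>(i,j)\<in>Basis \<times> Basis. B ((u \<bullet> i) *\<^sub>R i) ((v \<bullet> j) *\<^sub>R j))"
    by (rule bilinear_sum[OF assms])
  also have "\<dots> = (\<Sum>b\<in>Basis. \<Sum>b'\<in>Basis. B ((u \<bullet> b) *\<^sub>R b) ((v \<bullet> b') *\<^sub>R b'))"
    by (rule sum.cartesian_product[symmetric])
  finally show ?thesis by (simp add: bilinear_lmul[OF assms] bilinear_rmul[OF assms] mult.commute)
qed

text \<open>A positive definite form has a positive minimum on the compact unit sphere of
  \<open>P\<close>, and convergence of the finitely many entries on a basis is uniform there. The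
  filter is left general: two-sided limits serve the constancy of the index, one-sided limits the
  difference quotients at the two ends.\<close>

lemma eventually_pos_def:
  fixes B :: "'t \<Rightarrow> 'e::euclidean_space \<Rightarrow> 'e \<Rightarrow> real"
  assumes P: "subspace P" and B0: "bilinear B0"
    and bil: "\<forall>\<^sub>F t in F. bilinear (B t)"
    and lim: "\<And>u v. ((\<lambda>t. B t u v) \<longlongrightarrow> B0 u v) F"
    and pos: "\<And>u. u \<in> P \<Longrightarrow> u \<noteq> 0 \<Longrightarrow> B0 u u > 0"
  shows "\<forall>\<^sub>F t in F. \<forall>u\<in>P. u \<noteq> 0 \<longrightarrow> B t u u > 0"
proof (cases "P \<subseteq> {0}")
  case True
  then have "\<forall>u\<in>P. u \<noteq> 0 \<longrightarrow> B t u u > 0" for t by blast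
  then show ?thesis by simp
next
  case False
  then obtain p where p: "p \<in> P" "p \<noteq> 0" by blast
  define K where "K = P \<inter> sphere 0 1"
  have cK: "compact K" unfolding K_def using P by (intro closed_Int_compact closed_subspace) auto
  have "(1 / norm p) *\<^sub>R p \<in> K" using p P by (auto simp: K_def subspace_scale)
  then have neK: "K \<noteq> {}" by blast
  have "continuous_on K (\<lambda>u. B0 u u)"
    by (subst bilinear_expand[OF B0]) (intro continuous_intros)
  then obtain u0 where u0: "u0 \<in> K" "\<And>u. u \<in> K \<Longrightarrow> B0 u0 u0 \<le> B0 u u"
    using continuous_attains_inf[OF cK neK] by blast
  define m where "m = B0 u0 u0"
  have m: "m > 0" using u0(1) pos unfolding m_def K_def by force
  define e where "e t = (\<Sum>b\<in>Basis. \<Sum>b'\<in>Basis. \<bar>B t b b' - B0 b b'\<bar>)" for t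
  have "(e \<longlongrightarrow> (\<Sum>b\<in>(Basis::'e set). \<Sum>b'\<in>(Basis::'e set). \<bar>B0 b b' - B0 b b'\<bar>)) F"
    unfolding e_def by (intro tendsto_intros lim)
  then have "\<forall>\<^sub>F t in F. e t < m" using m by (auto simp: order_tendsto_iff)
  with bil show ?thesis
  proof eventually_elim
    case (elim t)
    show ?case
    proof (intro ballI impI)
      fix u assume u: "u \<in> P" "u \<noteq> 0"
      define v where "v = (1 / norm u) *\<^sub>R u"
      have v: "v \<in> K" "norm v = 1" using u P by (auto simp: v_def K_def subspace_scale)
      have "\<bar>B t v v - B0 v v\<bar> = \<bar>\<Sum>b\<in>Basis. \<Sum>b'\<in>Basis. ((v \<bullet> b) * (v \<bullet> b')) * (B t b b' - B0 b b')\<bar>"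
        by (subst bilinear_expand[OF elim(1)], subst bilinear_expand[OF B0])
          (simp add: sum_subtractf right_diff_distrib)
      also have "\<dots> \<le> (\<Sum>b\<in>Basis. \<Sum>b'\<in>Basis. \<bar>((v \<bullet> b) * (v \<bullet> b')) * (B t b b' - B0 b b')\<bar>)"
        by (intro order_trans[OF sum_abs] sum_mono sum_abs)
      also have "\<dots> \<le> e t" unfolding e_def
      proof (intro sum_mono)
        fix b b' :: 'e assume b: "b \<in> Basis" "b' \<in> Basis"
        have "\<bar>v \<bullet> b\<bar> * \<bar>v \<bullet> b'\<bar> \<le> 1 * 1"
          using Basis_le_norm[OF b(1), of v] Basis_le_norm[OF b(2), of v] v(2) by (intro mult_mono) auto
        then show "\<bar>((v \<bullet> b) * (v \<bullet> b')) * (B t b b' - B0 b b')\<bar> \<le> \<bar>B t b b' - B0 b b'\<bar>"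
          by (simp add: abs_mult mult_left_le_one_le)
      qed
      finally have "B t v v > 0" using u0(2)[OF v(1)] elim(2) unfolding m_def by linarith
      moreover have "B t v v = (1 / norm u)\<^sup>2 * B t u u"
        by (simp add: v_def bilinear_lmul[OF elim(1)] bilinear_rmul[OF elim(1)] power2_eq_square)
      moreover have "(1 / norm u)\<^sup>2 > 0" using u(2) by simp
      ultimately show "B t u u > 0" by (metis zero_less_mult_pos)
    qed
  qed
qed

lemma dual_basis:
  fixes h :: "'e::euclidean_space \<Rightarrow> 'e \<Rightarrow> real"
  assumes h: "bilinear h" and nd: "nondegenerate_on UNIV (\<lambda>v w. h w v)"
  obtains d where "\<And>b w. b \<in> Basis \<Longrightarrow> h w (d b) = w \<bullet> b"
proof -
  have "\<exists>v. \<forall>w. h w v = w \<bullet> b" for b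
  proof -
    have "linear (\<lambda>w. w \<bullet> b)" by (simp add: bounded_linear.linear bounded_linear_inner_left)
    then show ?thesis using representation_on[OF subspace_UNIV h nd] by (metis UNIV_I)
  qed
  then have "\<forall>b. \<exists>v. \<forall>w. h w v = w \<bullet> b" by blast
  from choice[OF this] show ?thesis using that by blast
qed

text \<open>Near each \<open>t\<close> a maximal negative definite subspace stays negative and a
  positive definite subspace of complementary dimension stays positive; the first bounds the index
  from below, the second from above. Being locally constant with finitely many values, the index is
  constant on the interval.\<close>

lemma index_constant:
  fixes B :: "real \<Rightarrow> 'e::euclidean_space \<Rightarrow> 'e \<Rightarrow> real"
  assumes bil: "\<And>t. t \<in> {a<..<b} \<Longrightarrow> bilinear (B t)"
    and sym: "\<And>t u v. t \<in> {a<..<b} \<Longrightarrow> B t u v = B t v u"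
    and nd: "\<And>t. t \<in> {a<..<b} \<Longrightarrow> nondegenerate_on UNIV (B t)"
    and cont: "\<And>u v. continuous_on {a<..<b} (\<lambda>t. B t u v)"
    and st: "s \<in> {a<..<b}" "t \<in> {a<..<b}"
  shows "neg_index UNIV (B s) = neg_index UNIV (B t)"
proof -
  have half: "\<forall>\<^sub>F t' in at t. neg_index UNIV (B t') = neg_index UNIV (B t)" if t: "t \<in> {a<..<b}" for t
  proof -
    obtain V where V: "subspace V" "\<And>v. v \<in> V \<Longrightarrow> v \<noteq> 0 \<Longrightarrow> B t v v < 0" "dim V = neg_index UNIV (B t)"
      using neg_index_attained[OF subspace_UNIV, of "B t"] by metis
    obtain P where P: "subspace P" "\<And>v. v \<in> P \<Longrightarrow> v \<noteq> 0 \<Longrightarrow> B t v v > 0"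
      "neg_index UNIV (B t) + dim P = DIM('e)"
      using neg_pos_split[OF subspace_UNIV bil[OF t] sym[OF t] nd[OF t]]
      by (metis dim_UNIV)
    have ev: "\<forall>\<^sub>F t' in at t. t' \<in> {a<..<b}" using t by (intro eventually_at_in_open') auto
    have lim: "((\<lambda>t'. B t' u v) \<longlongrightarrow> B t u v) (at t)" for u v
      using cont[of u v] t by (simp add: continuous_on_eq_continuous_at isCont_def)
    have evb: "\<forall>\<^sub>F t' in at t. bilinear (B t')" using ev by eventually_elim (rule bil)
    have 1: "\<forall>\<^sub>F t' in at t. \<forall>u\<in>P. u \<noteq> 0 \<longrightarrow> B t' u u > 0"
      by (rule eventually_pos_def[OF P(1) bil[OF t] evb lim P(2)])
    have bm: "bilinear (\<lambda>u v. - B s u v)" if "bilinear (B s)" for s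
      using that unfolding bilinear_def by (auto intro: linear_compose_neg)
    have 2: "\<forall>\<^sub>F t' in at t. \<forall>u\<in>V. u \<noteq> 0 \<longrightarrow> - B t' u u > 0"
    proof (rule eventually_pos_def[where B = "\<lambda>t u v. - B t u v" and ?B0.0 = "\<lambda>u v. - B t u v", OF V(1) bm[OF bil[OF t]]])
      show "\<forall>\<^sub>F t' in at t. bilinear (\<lambda>u v. - B t' u v)" using evb by eventually_elim (rule bm)
    qed (use V(2) in \<open>auto intro!: tendsto_intros lim\<close>)
    from 1 2 show ?thesis
    proof eventually_elim
      case (elim s)
      have "dim V \<le> neg_index UNIV (B s)" using V(1) elim by (intro dim_le_neg_index) auto
      moreover obtain V' where V': "subspace V'" "\<And>v. v \<in> V' \<Longrightarrow> v \<noteq> 0 \<Longrightarrow> B s v v < 0" "dim V' = neg_index UNIV (B s)"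
        using neg_index_attained[OF subspace_UNIV, of "B s"] by metis
      moreover have "dim V' + dim P \<le> DIM('e)"
        using elim(1) by (intro neg_pos_def_dim_le[where B = "B s"] V' P(1)) auto
      ultimately show ?case using P(3) V(3) by simp
    qed
  qed
  define f where "f t = real (neg_index UNIV (B t))" for t
  have "isCont f t" if "t \<in> {a<..<b}" for t
    unfolding isCont_def f_def by (rule tendsto_eventually, rule eventually_mono[OF half[OF that]]) simp
  then have "continuous_on {a<..<b} f" by (simp add: continuous_at_imp_continuous_on)
  moreover have "finite (f ` {a<..<b})"
  proof (rule finite_subset)
    show "f ` {a<..<b} \<subseteq> real ` {..DIM('e)}"
      using neg_index_attained[OF subspace_UNIV] unfolding f_def
      by (metis (no_types, lifting) atMost_iff dim_subset_UNIV image_subsetI imageI)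
  qed simp
  ultimately have "f constant_on {a<..<b}"
    using continuous_finite_range_constant[OF connected_Ioo] by blast
  then show ?thesis using st unfolding constant_on_def f_def by (metis of_nat_eq_iff)
qed

section \<open>Two Lagrangian families of solutions\<close>

text \<open>All that the index argument needs about the two families, separated from the geometry.
  The Jacobi equation enters only through the constant Wronskians: \<open>XX\<close> and
  \<open>YY\<close> make each family Lagrangian, \<open>XY\<close> fixes their pairing.
  \<open>injX\<close> expresses the absence of instants conjugate to \<open>a'\<close>,
  \<open>injY\<close> the minimality of \<open>t0\<close>.\<close>

locale jacobi_pair =
  fixes h :: "'e::euclidean_space \<Rightarrow> 'e \<Rightarrow> real"
    and X X' Y Y' :: "real \<Rightarrow> 'e \<Rightarrow> 'e"
    and a t0 :: real
  assumes at0: "a < t0"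
    and h: "bilinear h" and hsym: "h u v = h v u" and hnd: "nondegenerate_on UNIV h"
    and lin: "linear (X t)" "linear (X' t)" "linear (Y t)" "linear (Y' t)"
    and dX: "t \<in> {a..t0} \<Longrightarrow> ((\<lambda>t. X t v) has_vector_derivative X' t v) (at t within {a..t0})"
    and dY: "t \<in> {a..t0} \<Longrightarrow> ((\<lambda>t. Y t v) has_vector_derivative Y' t v) (at t within {a..t0})"
    and XY: "t \<in> {a..t0} \<Longrightarrow> h (X t v) (Y' t u) - h (X' t v) (Y t u) = h v u"
    and XX: "t \<in> {a..t0} \<Longrightarrow> h (X t v) (X' t u) = h (X' t v) (X t u)"
    and YY: "t \<in> {a..t0} \<Longrightarrow> h (Y t v) (Y' t u) = h (Y' t v) (Y t u)"
    and Xa: "X a v = v" and Ya: "Y a v = 0" and Y'a: "Y' a v = v"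
    and injX: "t \<in> {a..t0} \<Longrightarrow> X t v = 0 \<Longrightarrow> v = 0"
    and injY: "t \<in> {a<..<t0} \<Longrightarrow> Y t v = 0 \<Longrightarrow> v = 0"
begin

lemmas h_simps = bilinear_ladd[OF h] bilinear_radd[OF h] bilinear_lmul[OF h] bilinear_rmul[OF h]
    bilinear_lsub[OF h] bilinear_rsub[OF h] bilinear_lzero[OF h] bilinear_rzero[OF h]

lemma h_zero: "(\<And>w. h v w = 0) \<Longrightarrow> v = 0"
  using hnd by (auto simp: nondegenerate_on_def)

definition dual :: "'e \<Rightarrow> 'e" where
  "dual = (SOME d. \<forall>b\<in>Basis. \<forall>w. h w (d b) = w \<bullet> b)"

lemma dual: "b \<in> Basis \<Longrightarrow> h w (dual b) = w \<bullet> b"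
proof -
  have "nondegenerate_on UNIV (\<lambda>v w. h w v)" using hnd hsym by (simp add: nondegenerate_on_def)
  then obtain d where "\<And>b w. b \<in> Basis \<Longrightarrow> h w (d b) = w \<bullet> b" using dual_basis[OF h] by blast
  then have "\<exists>d. \<forall>b\<in>Basis. \<forall>w. h w (d b) = w \<bullet> b" by blast
  from someI_ex[OF this] show "b \<in> Basis \<Longrightarrow> h w (dual b) = w \<bullet> b" unfolding dual_def by blast
qed

text \<open>The adjoint of \<open>X t\<close> with respect to \<open>h\<close>.\<close>

definition Xadj :: "real \<Rightarrow> 'e \<Rightarrow> 'e" where
  "Xadj t y = (\<Sum>b\<in>Basis. h y (X t b) *\<^sub>R dual b)"

lemma h_sum_dual:
  assumes "linear f"
  shows "h w (\<Sum>b\<in>Basis. f b *\<^sub>R dual b) = f w"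
proof -
  have lh: "linear (h w)" using h by (simp add: bilinear_def)
  have "h w (\<Sum>b\<in>Basis. f b *\<^sub>R dual b) = (\<Sum>b\<in>Basis. (w \<bullet> b) *\<^sub>R f b)"
    unfolding linear_sum[OF lh] by (intro sum.cong) (auto simp: h_simps dual)
  also have "\<dots> = f (\<Sum>b\<in>Basis. (w \<bullet> b) *\<^sub>R b)"
    unfolding linear_sum[OF assms] by (simp add: linear_cmul[OF assms])
  finally show ?thesis by (simp add: euclidean_representation)
qed

lemma lin_hX: "linear (\<lambda>w. h y (X t w))" "linear (\<lambda>w. h y (X' t w))"
  using lin by (auto simp: linear_iff h_simps)

lemma h_Xadj: "h w (Xadj t y) = h y (X t w)"
  unfolding Xadj_def by (rule h_sum_dual[OF lin_hX(1)])

lemma Xadj_simps: "Xadj t (u + v) = Xadj t u + Xadj t v" "Xadj t (c *\<^sub>R v) = c *\<^sub>R Xadj t v"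
  by (simp_all add: Xadj_def h_simps scaleR_add_left sum.distrib scaleR_sum_right)

text \<open>In operator notation \<open>r t = Y X\<^sup>*\<close>; it is \<open>X (X\<inverse> Y) X\<^sup>*\<close>, where \<open>X\<inverse> Y\<close> is
  the symmetric operator whose graph describes one Lagrangian subspace relative to the other. The
  congruence by \<open>X\<close> removes the inverse.\<close>

definition r :: "real \<Rightarrow> 'e \<Rightarrow> 'e \<Rightarrow> real" where
  "r t y z = h z (Y t (Xadj t y))"

text \<open>Product rule for \<open>r\<close>: the inner sum is the \<open>h\<close>-adjoint of
  \<open>X' t\<close> applied to \<open>y\<close>, written out as in \<open>Xadj\<close>.\<close>

definition r' :: "real \<Rightarrow> 'e \<Rightarrow> 'e \<Rightarrow> real" where
  "r' t y z = h z (Y' t (Xadj t y)) + h z (Y t (\<Sum>b\<in>Basis. h y (X' t b) *\<^sub>R dual b))"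

lemma r_bilinear: "bilinear (r t)"
  using lin unfolding bilinear_def linear_iff r_def by (simp add: Xadj_simps h_simps)

lemma X_surj: assumes "t \<in> {a..t0}" shows "\<exists>v. X t v = w"
proof -
  have "inj (X t)" using injX[OF assms] lin(1)[of t] by (simp add: linear_injective_0)
  then show ?thesis using linear_injective_imp_surjective[OF lin(1)] by (metis surjD)
qed

text \<open>Solving \<open>X t p = Y t u\<close> and \<open>X t q = Y t v\<close> gives
  \<open>r t y z = h p v\<close> and \<open>r t z y = h q u\<close>. \<open>XY\<close> expresses
  both through values and derivatives of the families, and \<open>XX\<close> and \<open>YY\<close>
  identify the two expressions.\<close>

lemma r_sym: assumes t: "t \<in> {a..t0}" shows "r t y z = r t z y"
proof -
  define u v where uv: "u = Xadj t y" "v = Xadj t z"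
  obtain p where p: "X t p = Y t u" using X_surj[OF t] by blast
  obtain q where q: "X t q = Y t v" using X_surj[OF t] by blast
  have 1: "r t y z = h p v" by (simp add: r_def uv h_Xadj p)
  have 2: "r t z y = h q u" by (simp add: r_def uv h_Xadj q)
  show ?thesis
    using XY[OF t, of p v] XY[OF t, of q u] XX[OF t, of p q] YY[OF t, of u v]
      hsym[of "X' t p" "X t q"] hsym[of "X' t q" "X t p"] hsym[of "Y' t u" "Y t v"] unfolding 1 2 p q by simp
qed

text \<open>\<open>Xadj t\<close> is injective because \<open>X t\<close> is onto, and
  \<open>Y t\<close> is injective strictly between \<open>a\<close> and \<open>t0\<close>.\<close>

lemma r_nondegenerate: assumes t: "t \<in> {a<..<t0}" shows "nondegenerate_on UNIV (r t)"
  unfolding nondegenerate_on_def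
proof (intro ballI impI)
  fix y assume "\<forall>w\<in>UNIV. r t y w = 0"
  then have "h (Y t (Xadj t y)) w = 0" for w by (simp add: r_def hsym)
  then have "Xadj t y = 0" using h_zero injY[OF t] by blast
  then have "h y (X t w) = 0" for w using h_Xadj[of w t y] by (simp add: h_simps)
  then have "h y w = 0" for w using X_surj[of t w] t by force
  then show "y = 0" by (rule h_zero)
qed

text \<open>Written this way, \<open>r\<close> is a finite sum of products of scalar functions, to
  which the ordinary product rule applies.\<close>

lemma r_expand: "r t y z = (\<Sum>b\<in>Basis. h y (X t b) * h z (Y t (dual b)))"
proof -
  have 1: "linear (\<lambda>v. h z (Y t v))" using lin(3)[of t] by (simp add: linear_iff h_simps)
  show ?thesis by (simp add: r_def Xadj_def linear_sum[OF 1] linear_cmul[OF 1])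
qed

lemma r'_expand: "r' t y z = (\<Sum>b\<in>Basis. h y (X t b) * h z (Y' t (dual b)) + h y (X' t b) * h z (Y t (dual b)))"
proof -
  have 1: "linear (\<lambda>v. h z (Y t v))" using lin(3)[of t] by (simp add: linear_iff h_simps)
  have 2: "linear (\<lambda>v. h z (Y' t v))" using lin(4)[of t] by (simp add: linear_iff h_simps)
  show ?thesis
    by (simp add: r'_def Xadj_def sum.distrib linear_sum[OF 1] linear_cmul[OF 1] linear_sum[OF 2] linear_cmul[OF 2])
qed

lemma r_derivative:
  assumes t: "t \<in> {a..t0}"
  shows "((\<lambda>t. r t y z) has_vector_derivative r' t y z) (at t within {a..t0})"
proof -
  have bl: "bounded_linear (h y)" for y using h by (simp add: bilinear_def linear_conv_bounded_linear)
  have dhX: "((\<lambda>t. h y (X t b)) has_vector_derivative h y (X' t b)) (at t within {a..t0})" for b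
    by (rule bounded_linear.has_vector_derivative[OF bl dX[OF t]])
  have dhY: "((\<lambda>t. h z (Y t b)) has_vector_derivative h z (Y' t b)) (at t within {a..t0})" for b
    by (rule bounded_linear.has_vector_derivative[OF bl dY[OF t]])
  show ?thesis unfolding r_expand r'_expand
    by (intro has_vector_derivative_sum has_vector_derivative_mult dhX dhY)
qed

lemma r_a: "r a y z = 0" by (simp add: r_def Ya h_simps)

lemma r'_a: "r' a y z = h y z"
  by (simp add: r'_def Ya Y'a h_simps h_Xadj Xa)

text \<open>On velocities at \<open>t0\<close> of fields vanishing at both ends, \<open>Xadj\<close> inverts \<open>Y'\<close>.\<close>

lemma r_t0:
  assumes y: "y = Y' t0 u" "Y t0 u = 0"
  shows "r t0 y z = 0" "r' t0 y y = h y y"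
proof -
  have t: "t0 \<in> {a..t0}" using at0 by simp
  have "h (Xadj t0 y) w = h u w" for w
    using XY[OF t, of w u] y hsym[of "Xadj t0 y" w] hsym[of u w] hsym[of y]
    by (simp add: h_Xadj h_simps)
  then have "h (Xadj t0 y - u) w = 0" for w by (simp add: h_simps)
  then have xu: "Xadj t0 y = u" using h_zero[of "Xadj t0 y - u"] by simp
  then show "r t0 y z = 0" by (simp add: r_def y h_simps)
  \<comment> \<open>Isotropy of the \<open>Y\<close> family: velocities at \<open>t0\<close> of its
    members vanishing there are orthogonal to the range of \<open>Y t0\<close>. This removes the
    summand of \<open>r'\<close> that contains \<open>X'\<close>.\<close>
  have "h y (Y t0 w) = 0" for w
    using YY[OF t, of u w] y by (simp add: h_simps)
  then show "r' t0 y y = h y y" by (simp add: r'_def xu y(1)[symmetric])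
qed

text \<open>For \<open>s\<close> just after \<open>a\<close> and \<open>s'\<close> just before
  \<open>t0\<close>, \<open>dim P\<close> is at most the index of \<open>r s'\<close>, which equals
  that of \<open>r s\<close>, which is at most \<open>DIM('e) - dim Q\<close>, the index of
  \<open>h\<close>.\<close>

lemma pos_def_dim_le:
  assumes P: "subspace P" "\<And>y. y \<in> P \<Longrightarrow> \<exists>u. y = Y' t0 u \<and> Y t0 u = 0"
    "\<And>y. y \<in> P \<Longrightarrow> y \<noteq> 0 \<Longrightarrow> h y y > 0"
  shows "dim P \<le> neg_index UNIV h"
proof -
  obtain Q where Q: "subspace Q" "\<And>v. v \<in> Q \<Longrightarrow> v \<noteq> 0 \<Longrightarrow> h v v > 0"
    "neg_index UNIV h + dim Q = DIM('e)"
    using neg_pos_split[OF subspace_UNIV h hsym hnd] by (metis dim_UNIV)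
  have bil: "bilinear (\<lambda>u v. c * r t u v)" for c t
    using r_bilinear[of t] by (simp add: bilinear_def linear_iff algebra_simps)
  have a: "a \<in> {a..t0}" and t0: "t0 \<in> {a..t0}" using at0 by auto
  have ata: "at a within {a..t0} = at_right a" using at0 by (rule at_within_Icc_at_right)
  have att0: "at t0 within {a..t0} = at_left t0" using at0 by (rule at_within_Icc_at_left)
  \<comment> \<open>Since \<open>r a = 0\<close> and \<open>r' a = h\<close>, division by
    \<open>t - a > 0\<close> produces forms that converge to \<open>h\<close>; positivity on
    \<open>Q\<close> passes back to \<open>r t\<close>.\<close>
  have "\<forall>\<^sub>F t in at_right a. \<forall>u\<in>Q. u \<noteq> 0 \<longrightarrow> inverse (t - a) * r t u u > 0"
  proof (rule eventually_pos_def[where B = "\<lambda>t u v. inverse (t - a) * r t u v", OF Q(1) h _ _ Q(2)])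
    show "((\<lambda>t. inverse (t - a) * r t u v) \<longlongrightarrow> h u v) (at_right a)" for u v
      using r_derivative[OF a, of u v]
      by (simp add: r_a r'_a ata has_field_derivative_iff divide_inverse mult.commute
          flip: has_real_derivative_iff_has_vector_derivative)
  qed (use bil in auto)
  moreover have "\<forall>\<^sub>F t in at_right a. t \<in> {a<..<t0}"
    using at0 by (intro eventually_at_right_real)
  ultimately have "\<forall>\<^sub>F t in at_right a. t \<in> {a<..<t0} \<and> (\<forall>u\<in>Q. u \<noteq> 0 \<longrightarrow> r t u u > 0)"
    by eventually_elim (auto simp: zero_less_mult_iff)
  then obtain s where s: "s \<in> {a<..<t0}" "\<And>u. u\<in>Q \<Longrightarrow> u \<noteq> 0 \<Longrightarrow> r s u u > 0"
    using eventually_happens' trivial_limit_at_right_real by fastforce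
  \<comment> \<open>Here \<open>t - t0 < 0\<close>, so a positive quotient will mean that
    \<open>r t\<close> is negative on \<open>P\<close>. The value at \<open>t0\<close> is subtracted
    because convergence is required on all pairs of vectors, while \<open>r_t0\<close> gives
    \<open>r t0 y z = 0\<close> only for \<open>y\<close> that are velocities of fields vanishing at
    both ends.\<close>
  have "\<forall>\<^sub>F t in at_left t0. \<forall>u\<in>P. u \<noteq> 0 \<longrightarrow> inverse (t - t0) * (r t u u - r t0 u u) > 0"
  proof (rule eventually_pos_def[where B = "\<lambda>t u v. inverse (t - t0) * (r t u v - r t0 u v)" and ?B0.0 = "r' t0", OF P(1)])
    show "((\<lambda>t. inverse (t - t0) * (r t u v - r t0 u v)) \<longlongrightarrow> r' t0 u v) (at_left t0)" for u v
      using r_derivative[OF t0, of u v]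
      by (simp add: att0 has_field_derivative_iff divide_inverse mult.commute
          flip: has_real_derivative_iff_has_vector_derivative)
    show "\<forall>\<^sub>F t in at_left t0. bilinear (\<lambda>u v. inverse (t - t0) * (r t u v - r t0 u v))"
      using r_bilinear by (intro always_eventually allI) (simp add: bilinear_def linear_iff algebra_simps)
    show "bilinear (r' t0)" unfolding bilinear_def linear_iff r'_expand
      by (simp add: h_simps algebra_simps sum.distrib sum_distrib_left)
    show "r' t0 u u > 0" if u: "u \<in> P" "u \<noteq> 0" for u
    proof -
      obtain v where "u = Y' t0 v" "Y t0 v = 0" using P(2)[OF u(1)] by blast
      from r_t0(2)[OF this] show ?thesis using P(3)[OF u] by simp
    qed
  qed
  moreover have "\<forall>\<^sub>F t in at_left t0. t \<in> {a<..<t0}"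
    using at0 by (intro eventually_at_left_real)
  ultimately have "\<forall>\<^sub>F t in at_left t0. t \<in> {a<..<t0} \<and> (\<forall>u\<in>P. u \<noteq> 0 \<longrightarrow> r t u u < 0)"
  proof eventually_elim
    case (elim t)
    have "r t u u < 0" if u: "u \<in> P" "u \<noteq> 0" for u
    proof -
      obtain v where "u = Y' t0 v" "Y t0 v = 0" using P(2)[OF u(1)] by blast
      from r_t0(1)[OF this] have "r t0 u u = 0" .
      then have "inverse (t - t0) * r t u u > 0" using elim u by force
      then show ?thesis using elim(2) by (auto simp: zero_less_mult_iff)
    qed
    then show ?case using elim(2) by blast
  qed
  then obtain s' where s': "s' \<in> {a<..<t0}" "\<And>u. u\<in>P \<Longrightarrow> u \<noteq> 0 \<Longrightarrow> r s' u u < 0"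
    using eventually_happens' trivial_limit_at_left_real by fastforce
  have "continuous_on {a<..<t0} (\<lambda>t. r t u v)" for u v
  proof -
    have "continuous_on {a..t0} (\<lambda>t. r t u v)"
      using r_derivative has_vector_derivative_continuous continuous_on_eq_continuous_within by blast
    then show ?thesis by (rule continuous_on_subset) auto
  qed
  then have "neg_index UNIV (r s) = neg_index UNIV (r s')"
    using s(1) s'(1) r_sym r_bilinear r_nondegenerate
    by (intro index_constant[where B = r and a = a and b = t0]) auto
  moreover have "dim P \<le> neg_index UNIV (r s')" using P(1) s'(2) by (intro dim_le_neg_index) auto
  moreover obtain V where V: "subspace V" "\<And>v. v \<in> V \<Longrightarrow> v \<noteq> 0 \<Longrightarrow> r s v v < 0" "dim V = neg_index UNIV (r s)"
    using neg_index_attained[OF subspace_UNIV, of "r s"] by metis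
  moreover have "dim V + dim Q \<le> DIM('e)"
    using s(2) by (intro neg_pos_def_dim_le[where B = "r s"] V Q(1)) auto
  ultimately show ?thesis using Q(3) by linarith
qed

end

section \<open>Calculus of \<open>C\<^sup>k\<close> maps\<close>

text \<open>The condition under which Frechet derivatives within \<open>S\<close> are unique: points
  of \<open>S\<close> can be approached inside \<open>S\<close> along every coordinate axis. It
  covers both uses of \<open>Ck_on\<close>, on open sets and on relatively open parts of an
  interval.\<close>

definition unique_deriv_set :: "'a::euclidean_space set \<Rightarrow> bool" where
  "unique_deriv_set S \<longleftrightarrow> (\<forall>x\<in>S. \<forall>i\<in>Basis. \<forall>e>0. \<exists>d. 0 < \<bar>d\<bar> \<and> \<bar>d\<bar> < e \<and> x + d *\<^sub>R i \<in> S)"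

lemma frechet_derivative_within_eq:
  assumes "unique_deriv_set S" "x \<in> S" "(f has_derivative f') (at x within S)"
  shows "frechet_derivative f (at x within S) = f'"
proof (rule frechet_derivative_unique_within)
  show "(f has_derivative frechet_derivative f (at x within S)) (at x within S)"
    using assms(3) frechet_derivative_works differentiableI by blast
qed (use assms in \<open>auto simp: unique_deriv_set_def\<close>)

lemma unique_deriv_set_open:
  assumes "open S" shows "unique_deriv_set S"
  unfolding unique_deriv_set_def
proof (intro ballI allI impI)
  fix x i :: 'a and e :: real assume x: "x \<in> S" "i \<in> Basis" "e > 0"
  obtain r where r: "r > 0" "ball x r \<subseteq> S" using assms x(1) open_contains_ball by blast
  let ?d = "min e r / 2"
  have "x + ?d *\<^sub>R i \<in> ball x r" using r(1) x by (auto simp: dist_norm)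
  then show "\<exists>d. 0 < \<bar>d\<bar> \<and> \<bar>d\<bar> < e \<and> x + d *\<^sub>R i \<in> S"
    using r x by (intro exI[of _ ?d]) auto
qed

lemma unique_deriv_set_interval:
  fixes a b :: real
  assumes "a < b" "open T" shows "unique_deriv_set ({a..b} \<inter> T)"
  unfolding unique_deriv_set_def
proof (intro ballI allI impI)
  fix x i e :: real assume x: "x \<in> {a..b} \<inter> T" "i \<in> Basis" "e > 0"
  obtain r where r: "r > 0" "ball x r \<subseteq> T" using assms x(1) open_contains_ball by blast
  \<comment> \<open>At most half the length of the interval, so that at least one of
    \<open>x + m\<close> and \<open>x - m\<close> stays in it, also when \<open>x\<close> is an end
    point.\<close>
  define m where "m = min (min e r) (b - a) / 2"
  have m: "m > 0" "m < e" "m < r" "m \<le> (b - a) / 2" using r x assms by (auto simp: m_def)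
  have 1: "x + m \<in> T" "x - m \<in> T" using r(2) m by (auto simp: subset_iff dist_real_def)
  have "x + m \<in> {a..b} \<or> x - m \<in> {a..b}" using x(1) m by (simp add: field_simps) linarith
  then show "\<exists>d. 0 < \<bar>d\<bar> \<and> \<bar>d\<bar> < e \<and> x + d *\<^sub>R i \<in> {a..b} \<inter> T"
    using 1 m x by (elim disjE) (auto intro: exI[of _ m] exI[of _ "-m"])
qed

lemma Ck_on_cong:
  assumes "\<And>x. x \<in> S \<Longrightarrow> f x = g x"
  shows "Ck_on k S f \<longleftrightarrow> Ck_on k S g"
  using assms
proof (induction k arbitrary: f g)
  case 0
  then show ?case by (simp cong: continuous_on_cong)
next
  case (Suc k)
  have d: "(f has_derivative D) (at x within S) \<longleftrightarrow> (g has_derivative D) (at x within S)" if "x \<in> S" for x D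
    using Suc.prems that by (auto elim!: has_derivative_transform[rotated 2])
  have "Ck_on k S (\<lambda>x. frechet_derivative f (at x within S) v)
      \<longleftrightarrow> Ck_on k S (\<lambda>x. frechet_derivative g (at x within S) v)" for v
    by (rule Suc.IH) (simp add: frechet_derivative_def d)
  then show ?case using d by (auto simp: differentiable_on_def differentiable_def)
qed

lemma Ck_on_SucI:
  assumes "unique_deriv_set S"
    and "\<And>x. x \<in> S \<Longrightarrow> (f has_derivative f' x) (at x within S)"
    and "\<And>v. Ck_on k S (\<lambda>x. f' x v)"
  shows "Ck_on (Suc k) S f"
proof -
  have "Ck_on k S (\<lambda>x. frechet_derivative f (at x within S) v)" for v
    using assms(3)[of v] frechet_derivative_within_eq[OF assms(1) _ assms(2)]
    by (simp cong: Ck_on_cong)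
  then show ?thesis using assms(2) by (auto simp: differentiable_on_def differentiable_def)
qed

lemma Ck_on_SucD:
  assumes "Ck_on (Suc k) S f"
  shows "x \<in> S \<Longrightarrow> (f has_derivative frechet_derivative f (at x within S)) (at x within S)"
    "Ck_on k S (\<lambda>x. frechet_derivative f (at x within S) v)"
  using assms by (auto simp: differentiable_on_def frechet_derivative_works)

lemma Ck_on_Suc_imp: "Ck_on (Suc k) S f \<Longrightarrow> Ck_on k S f"
proof (induction k arbitrary: f)
  case 0
  then show ?case by (simp add: differentiable_imp_continuous_on)
next
  case (Suc k)
  show ?case unfolding Ck_on.simps(2)[of k]
    using Suc.prems Suc.IH unfolding Ck_on.simps(2)[of "Suc k"] by blast
qed

lemma Ck_on_continuous: "Ck_on k S f \<Longrightarrow> continuous_on S f"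
  by (cases k) (auto simp: differentiable_imp_continuous_on)

lemma Ck_on_const: "unique_deriv_set S \<Longrightarrow> Ck_on k S (\<lambda>_. c)"
proof (induction k arbitrary: c)
  case (Suc k)
  show ?case by (rule Ck_on_SucI[OF Suc.prems has_derivative_const Suc.IH[OF Suc.prems]])
qed simp

lemma Ck_on_linear:
  fixes L :: "'b::euclidean_space \<Rightarrow> 'c::euclidean_space"
  assumes "linear L" "unique_deriv_set S"
  shows "Ck_on k S f \<Longrightarrow> Ck_on k S (\<lambda>x. L (f x))"
proof (induction k arbitrary: f)
  case 0
  then show ?case using assms(1) by (simp add: linear_continuous_on_compose)
next
  case (Suc k)
  have "bounded_linear L" using assms(1) by (simp add: linear_conv_bounded_linear)
  from Ck_on_SucI[OF assms(2) bounded_linear.has_derivative[OF this Ck_on_SucD(1)[OF Suc.prems]]]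
  show ?case using Suc.IH[OF Ck_on_SucD(2)[OF Suc.prems]] by blast
qed

lemma Ck_on_add:
  assumes "unique_deriv_set S"
  shows "Ck_on k S f \<Longrightarrow> Ck_on k S g \<Longrightarrow> Ck_on k S (\<lambda>x. f x + g x)"
proof (induction k arbitrary: f g)
  case 0
  then show ?case by (simp add: continuous_on_add)
next
  case (Suc k)
  show ?case
    by (rule Ck_on_SucI[OF assms])
      (rule has_derivative_add Ck_on_SucD(1)[OF Suc.prems(1)] Ck_on_SucD(1)[OF Suc.prems(2)]
        Suc.IH Ck_on_SucD(2)[OF Suc.prems(1)] Ck_on_SucD(2)[OF Suc.prems(2)] | assumption)+
qed

lemma Ck_on_uminus: "unique_deriv_set S \<Longrightarrow> Ck_on k S f \<Longrightarrow> Ck_on k S (\<lambda>x. - f x)"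
  by (rule Ck_on_linear) (auto simp: linear_iff)

lemma Ck_on_diff:
  "unique_deriv_set S \<Longrightarrow> Ck_on k S f \<Longrightarrow> Ck_on k S g \<Longrightarrow> Ck_on k S (\<lambda>x. f x - g x)"
  using Ck_on_add[of S k f "\<lambda>x. - g x"] Ck_on_uminus[of S k g] by simp

lemma Ck_on_sum:
  assumes "unique_deriv_set S" "finite I"
  shows "(\<And>i. i \<in> I \<Longrightarrow> Ck_on k S (f i)) \<Longrightarrow> Ck_on k S (\<lambda>x. \<Sum>i\<in>I. f i x)"
  using assms(2) by (induction I rule: finite_induct) (auto intro: Ck_on_const Ck_on_add assms(1))

lemma Ck_on_scaleR:
  assumes "unique_deriv_set S"
  shows "Ck_on k S c \<Longrightarrow> Ck_on k S f \<Longrightarrow> Ck_on k S (\<lambda>x. c x *\<^sub>R f x)"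
proof (induction k arbitrary: c f)
  case 0
  then show ?case by (simp add: continuous_on_scaleR)
next
  case (Suc k)
  show ?case
    by (rule Ck_on_SucI[OF assms])
      (rule has_derivative_scaleR Ck_on_SucD(1)[OF Suc.prems(1)] Ck_on_SucD(1)[OF Suc.prems(2)]
        Ck_on_add[OF assms] Suc.IH Ck_on_SucD(2)[OF Suc.prems(1)] Ck_on_SucD(2)[OF Suc.prems(2)]
        Suc.prems[THEN Ck_on_Suc_imp] | assumption)+
qed

lemma Ck_on_inner_const:
  "unique_deriv_set S \<Longrightarrow> Ck_on k S f \<Longrightarrow> Ck_on k S (\<lambda>x. f x \<bullet> b)"
  by (rule Ck_on_linear) (auto simp: linear_iff inner_add_left)

lemma linear_basis_expand:
  assumes "linear L" shows "L u = (\<Sum>b\<in>Basis. (u \<bullet> b) *\<^sub>R L b)"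
proof -
  have "L u = L (\<Sum>b\<in>Basis. (u \<bullet> b) *\<^sub>R b)" by (simp only: euclidean_representation)
  also have "\<dots> = (\<Sum>b\<in>Basis. (u \<bullet> b) *\<^sub>R L b)"
    by (simp add: linear_sum[OF assms] linear_cmul[OF assms])
  finally show ?thesis .
qed

text \<open>A linear map depending on the point is handled through its values on basis vectors; no
  structure on a space of operators is needed.\<close>

lemma Ck_on_apply:
  fixes L :: "'a::euclidean_space \<Rightarrow> 'b::euclidean_space \<Rightarrow> 'c::euclidean_space"
  assumes S: "unique_deriv_set S" and "\<And>x. x \<in> S \<Longrightarrow> linear (L x)"
    and "\<And>b. b \<in> Basis \<Longrightarrow> Ck_on k S (\<lambda>x. L x b)" "Ck_on k S U"
  shows "Ck_on k S (\<lambda>x. L x (U x))"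
proof -
  have "Ck_on k S (\<lambda>x. \<Sum>b\<in>Basis. (U x \<bullet> b) *\<^sub>R L x b)"
    by (intro Ck_on_sum[OF S] Ck_on_scaleR[OF S] Ck_on_inner_const[OF S] assms) auto
  then show ?thesis by (subst Ck_on_cong[OF linear_basis_expand]) (auto intro: assms(2))
qed

text \<open>By the chain rule the differential is a point-dependent linear map, \<open>Dg\<close> at
  \<open>f x\<close>, applied to \<open>Df x v\<close>. The induction hypothesis treats the values
  of \<open>Dg\<close> on basis vectors, and \<open>Ck_on_apply\<close> combines them with
  \<open>Df\<close>.\<close>

lemma Ck_on_compose:
  assumes S: "unique_deriv_set S" and fS: "f ` S \<subseteq> T"
  shows "Ck_on k T g \<Longrightarrow> Ck_on k S f \<Longrightarrow> Ck_on k S (\<lambda>x. g (f x))"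
proof (induction k arbitrary: g)
  case 0
  then show ?case using fS by (auto intro: continuous_on_compose2)
next
  case (Suc k)
  let ?Df = "\<lambda>x. frechet_derivative f (at x within S)"
  let ?Dg = "\<lambda>y. frechet_derivative g (at y within T)"
  have der: "((\<lambda>x. g (f x)) has_derivative (\<lambda>v. ?Dg (f x) (?Df x v))) (at x within S)" if "x \<in> S" for x
    by (rule has_derivative_in_compose2[OF Ck_on_SucD(1)[OF Suc.prems(1)] fS that Ck_on_SucD(1)[OF Suc.prems(2) that]])
  have lin: "linear (?Dg (f x))" if "x \<in> S" for x
    using has_derivative_linear[OF Ck_on_SucD(1)[OF Suc.prems(1)]] that fS by blast
  have "Ck_on k S (\<lambda>x. ?Dg (f x) (?Df x v))" for v
    by (rule Ck_on_apply[OF S lin Suc.IH[OF Ck_on_SucD(2)[OF Suc.prems(1)] Ck_on_Suc_imp[OF Suc.prems(2)]]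
          Ck_on_SucD(2)[OF Suc.prems(2)]])
  with der show ?case by (intro Ck_on_SucI[OF S])
qed

lemma has_derivative_apply:
  fixes L :: "'a::real_normed_vector \<Rightarrow> 'b::euclidean_space \<Rightarrow> 'c::real_normed_vector"
  assumes lin: "\<And>y. y \<in> S \<Longrightarrow> linear (L y)" and x: "x \<in> S"
    and L: "\<And>b. ((\<lambda>y. L y b) has_derivative L' b) (at x within S)"
    and L': "\<And>d. linear (\<lambda>b. L' b d)"
    and U: "(U has_derivative U') (at x within S)"
  shows "((\<lambda>y. L y (U y)) has_derivative (\<lambda>d. L x (U' d) + L' (U x) d)) (at x within S)"
proof -
  have "((\<lambda>y. \<Sum>b\<in>Basis. (U y \<bullet> b) *\<^sub>R L y b) has_derivative
      (\<lambda>d. \<Sum>b\<in>Basis. (U x \<bullet> b) *\<^sub>R L' b d + (U' d \<bullet> b) *\<^sub>R L x b)) (at x within S)"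
    by (intro has_derivative_sum has_derivative_scaleR has_derivative_inner_left U L)
  moreover have "(\<lambda>d. \<Sum>b\<in>Basis. (U x \<bullet> b) *\<^sub>R L' b d + (U' d \<bullet> b) *\<^sub>R L x b)
      = (\<lambda>d. L x (U' d) + L' (U x) d)"
    by (simp add: sum.distrib add.commute fun_eq_iff
        linear_basis_expand[OF lin[OF x], symmetric] linear_basis_expand[OF L', symmetric])
  ultimately have "((\<lambda>y. \<Sum>b\<in>Basis. (U y \<bullet> b) *\<^sub>R L y b) has_derivative
      (\<lambda>d. L x (U' d) + L' (U x) d)) (at x within S)" by simp
  then show ?thesis by (rule has_derivative_transform[OF x, rotated]) (rule linear_basis_expand[OF lin])
qed

lemma has_vector_derivative_apply:
  fixes L :: "real \<Rightarrow> 'b::euclidean_space \<Rightarrow> 'c::real_normed_vector"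
  assumes lin: "\<And>y. y \<in> S \<Longrightarrow> linear (L y)" and x: "x \<in> S"
    and L: "\<And>b. ((\<lambda>y. L y b) has_vector_derivative L' b) (at x within S)"
    and L': "linear L'"
    and U: "(U has_vector_derivative U') (at x within S)"
  shows "((\<lambda>y. L y (U y)) has_vector_derivative L x U' + L' (U x)) (at x within S)"
proof -
  have "((\<lambda>y. L y (U y)) has_derivative (\<lambda>d. L x (d *\<^sub>R U') + d *\<^sub>R L' (U x))) (at x within S)"
    using L' by (intro has_derivative_apply[OF lin x L[unfolded has_vector_derivative_def] _
          U[unfolded has_vector_derivative_def]]) (auto intro: linear_compose_scale_right)
  moreover have "(\<lambda>d. L x (d *\<^sub>R U') + d *\<^sub>R L' (U x)) = (\<lambda>d. d *\<^sub>R (L x U' + L' (U x)))"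
    by (simp only: linear_cmul[OF lin[OF x]] scaleR_add_right)
  ultimately show ?thesis by (simp only: has_vector_derivative_def)
qed

text \<open>Where \<open>m\<close> vanishes, continuity of \<open>c\<close> suffices:
  \<open>m y\<close> is of order \<open>norm (y - x)\<close>, so replacing \<open>c y\<close> by
  \<open>c0\<close> costs an error of smaller order. This permits an unknown factor to be handled
  before its differentiability is known.\<close>

lemma has_derivative_zero_times:
  fixes m :: "'a::real_normed_vector \<Rightarrow> 'b::real_normed_vector"
  assumes c: "(c \<longlongrightarrow> c0) (at x within S)" and m: "(m has_derivative m') (at x within S)" "m x = 0"
    and "c x = c0"
  shows "((\<lambda>y. c y *\<^sub>R m y) has_derivative (\<lambda>d. c0 *\<^sub>R m' d)) (at x within S)"
proof -
  obtain K where K: "K > 0" "\<And>d. norm (m' d) \<le> norm d * K"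
    using bounded_linear.pos_bounded[OF has_derivative_bounded_linear[OF m(1)]] by blast
  let ?q = "\<lambda>y. norm (m y - m' (y - x)) / norm (y - x)"
  have q: "(?q \<longlongrightarrow> 0) (at x within S)"
    using m(1) unfolding has_derivative_iff_norm m(2) by (auto simp: m(2))
  have bd: "norm (norm ((c y - c0) *\<^sub>R m y) / norm (y - x)) \<le> \<bar>c y - c0\<bar> * (?q y + K)" for y
  proof (cases "y = x")
    case False
    have "norm (m y) \<le> norm (m y - m' (y - x)) + norm (m' (y - x))"
      using norm_triangle_ineq[of "m y - m' (y - x)" "m' (y - x)"] by simp
    also have "\<dots> \<le> norm (m y - m' (y - x)) + norm (y - x) * K" using K by simp
    finally have "norm (m y) / norm (y - x) \<le> ?q y + K" using False by (simp add: field_simps)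
    then have "\<bar>c y - c0\<bar> * (norm (m y) / norm (y - x)) \<le> \<bar>c y - c0\<bar> * (?q y + K)"
      by (rule mult_left_mono) simp
    then show ?thesis by simp
  qed (use K in simp)
  have "((\<lambda>y. \<bar>c y - c0\<bar> * (?q y + K)) \<longlongrightarrow> \<bar>c0 - c0\<bar> * (0 + K)) (at x within S)"
    by (intro tendsto_intros c q)
  then have "((\<lambda>y. \<bar>c y - c0\<bar> * (?q y + K)) \<longlongrightarrow> 0) (at x within S)" by simp
  then have "((\<lambda>y. norm ((c y - c0) *\<^sub>R m y) / norm (y - x)) \<longlongrightarrow> 0) (at x within S)"
    by (rule Lim_null_comparison[OF always_eventually, rotated]) (use bd in blast)
  then have "((\<lambda>y. (c y - c0) *\<^sub>R m y) has_derivative (\<lambda>d. 0)) (at x within S)"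
    by (simp add: has_derivative_iff_norm m(2))
  moreover have "((\<lambda>y. c0 *\<^sub>R m y) has_derivative (\<lambda>d. c0 *\<^sub>R m' d)) (at x within S)"
    by (intro has_derivative_scaleR_right m(1))
  ultimately have "((\<lambda>y. (c y - c0) *\<^sub>R m y + c0 *\<^sub>R m y) has_derivative (\<lambda>d. 0 + c0 *\<^sub>R m' d)) (at x within S)"
    by (rule has_derivative_add)
  then show ?thesis by (simp add: scaleR_left_diff_distrib)
qed

text \<open>This lemma and the next are read off from \<open>L x (z y) = w y - (L y - L x) (z y)\<close>.\<close>

lemma solution_continuous:
  fixes L :: "'a::real_normed_vector \<Rightarrow> 'e::euclidean_space \<Rightarrow> 'e"
  assumes lin: "\<And>y. y \<in> S \<Longrightarrow> linear (L y)" and inj: "\<And>y. y \<in> S \<Longrightarrow> inj (L y)"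
    and sol: "\<And>y. y \<in> S \<Longrightarrow> L y (z y) = w y" and x: "x \<in> S"
    and L: "\<And>b. ((\<lambda>y. L y b) \<longlongrightarrow> L x b) (at x within S)"
    and w: "(w \<longlongrightarrow> w x) (at x within S)"
  shows "(z \<longlongrightarrow> z x) (at x within S)"
proof -
  obtain m where m: "m > 0" "\<And>u. m * norm u \<le> norm (L x u)"
    using linear_inj_bounded_below_pos[OF lin[OF x] inj[OF x]] by blast
  define e where "e y = (\<Sum>b\<in>Basis. norm (L y b - L x b))" for y
  have "(e \<longlongrightarrow> (\<Sum>b\<in>(Basis::'e set). norm (L x b - L x b))) (at x within S)"
    unfolding e_def by (intro tendsto_intros L)
  then have e0: "(e \<longlongrightarrow> 0) (at x within S)" by simp
  have e: "norm (L y u - L x u) \<le> e y * norm u" if y: "y \<in> S" for y u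
  proof -
    have "L y u - L x u = (\<Sum>b\<in>Basis. (u \<bullet> b) *\<^sub>R (L y b - L x b))"
      unfolding linear_basis_expand[OF lin[OF y], of u] linear_basis_expand[OF lin[OF x], of u]
      by (simp add: scaleR_right_diff_distrib sum_subtractf)
    also have "norm \<dots> \<le> (\<Sum>b\<in>Basis. norm u * norm (L y b - L x b))"
      by (intro order_trans[OF norm_sum] sum_mono) (auto intro!: mult_right_mono simp: Basis_le_norm)
    finally show ?thesis by (simp add: e_def sum_distrib_left mult.commute)
  qed
  have "((\<lambda>y. 2 / m * (norm (w y - w x) + e y * norm (z x))) \<longlongrightarrow> 2 / m * (norm (w x - w x) + 0 * norm (z x)))
      (at x within S)" by (intro tendsto_intros w e0)
  then have lim: "((\<lambda>y. 2 / m * (norm (w y - w x) + e y * norm (z x))) \<longlongrightarrow> 0) (at x within S)" by simp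
  \<comment> \<open>With this bound the term containing the unknown \<open>z y - z x\<close> is
    absorbed into the left-hand side, where the factor \<open>m / 2\<close> remains.\<close>
  have "\<forall>\<^sub>F y in at x within S. e y < m / 2" using order_tendstoD(2)[OF e0, of "m / 2"] m(1) by simp
  moreover have "\<forall>\<^sub>F y in at x within S. y \<in> S" by (simp add: eventually_at_filter)
  ultimately have "\<forall>\<^sub>F y in at x within S. norm (z y - z x) \<le> 2 / m * (norm (w y - w x) + e y * norm (z x))"
  proof eventually_elim
    case (elim y)
    have "L x (z y - z x) = (w y - w x) - (L y (z y) - L x (z y))"
      using sol[OF x] sol[OF elim(2)] by (simp add: linear_diff[OF lin[OF x]])
    then have "norm (L x (z y - z x)) \<le> norm (w y - w x) + norm (L y (z y) - L x (z y))"
      using norm_triangle_ineq4[of "w y - w x" "L y (z y) - L x (z y)"] by simp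
    then have "m * norm (z y - z x) \<le> norm (w y - w x) + norm (L y (z y) - L x (z y))"
      using m(2)[of "z y - z x"] by linarith
    also have "\<dots> \<le> norm (w y - w x) + e y * norm (z y)" using e[OF elim(2)] by simp
    also have "\<dots> \<le> norm (w y - w x) + e y * (norm (z y - z x) + norm (z x))"
      using norm_triangle_ineq[of "z y - z x" "z x"]
      by (intro add_left_mono mult_left_mono) (auto simp: e_def intro: sum_nonneg)
    also have "\<dots> \<le> norm (w y - w x) + e y * norm (z x) + m / 2 * norm (z y - z x)"
      using mult_right_mono[OF less_imp_le[OF elim(1)], of "norm (z y - z x)"] by (simp add: algebra_simps)
    finally have "m / 2 * norm (z y - z x) \<le> norm (w y - w x) + e y * norm (z x)" by simp
    then show ?case using m(1) by (simp add: field_simps)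
  qed
  from Lim_null_comparison[OF this lim] show ?thesis by (simp add: LIM_zero_iff)
qed

lemma solution_has_derivative:
  fixes L :: "'a::real_normed_vector \<Rightarrow> 'e::euclidean_space \<Rightarrow> 'e"
  assumes lin: "\<And>y. y \<in> S \<Longrightarrow> linear (L y)" and inj: "\<And>y. y \<in> S \<Longrightarrow> inj (L y)"
    and sol: "\<And>y. y \<in> S \<Longrightarrow> L y (z y) = w y" and x: "x \<in> S"
    and L: "\<And>b. ((\<lambda>y. L y b) has_derivative L' b) (at x within S)"
    and w: "(w has_derivative w') (at x within S)"
  obtains z' where "(z has_derivative z') (at x within S)"
    "\<And>d. L x (z' d) = w' d - (\<Sum>b\<in>Basis. (z x \<bullet> b) *\<^sub>R L' b d)"
proof -
  obtain A where A: "linear A" "A \<circ> L x = id" "L x \<circ> A = id"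
    using linear_injective_isomorphism[OF lin[OF x] inj[OF x]] by (auto simp: fun_eq_iff)
  have A': "A (L x u) = u" "L x (A u) = u" for u using A(2,3) by (auto simp: fun_eq_iff)
  have z: "(z \<longlongrightarrow> z x) (at x within S)"
  proof (rule solution_continuous[OF lin inj sol x])
    show "((\<lambda>y. L y b) \<longlongrightarrow> L x b) (at x within S)" for b
      using has_derivative_continuous[OF L] by (simp add: continuous_within)
    show "(w \<longlongrightarrow> w x) (at x within S)"
      using has_derivative_continuous[OF w] by (simp add: continuous_within)
  qed auto
  \<comment> \<open>The unknown \<open>z y\<close> occurs only as a factor of
    \<open>L y b - L x b\<close>, which vanishes at \<open>x\<close>; its continuity, just shown, is
    enough to differentiate.\<close>
  have D0: "((\<lambda>y. w y - (\<Sum>b\<in>Basis. (z y \<bullet> b) *\<^sub>R (L y b - L x b))) has_derivative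
      (\<lambda>d. w' d - (\<Sum>b\<in>Basis. (z x \<bullet> b) *\<^sub>R (L' b d - 0)))) (at x within S)"
    by (intro has_derivative_diff has_derivative_sum has_derivative_zero_times w L has_derivative_const
        tendsto_inner z tendsto_const) auto
  have eq: "L x (z y) = w y - (\<Sum>b\<in>Basis. (z y \<bullet> b) *\<^sub>R (L y b - L x b))" if y: "y \<in> S" for y
  proof -
    have "w y = (\<Sum>b\<in>Basis. (z y \<bullet> b) *\<^sub>R L y b)"
      using sol[OF y] linear_basis_expand[OF lin[OF y], of "z y"] by simp
    then show ?thesis using linear_basis_expand[OF lin[OF x], of "z y"]
      by (simp add: scaleR_right_diff_distrib sum_subtractf)
  qed
  have D: "((\<lambda>y. L x (z y)) has_derivative
      (\<lambda>d. w' d - (\<Sum>b\<in>Basis. (z x \<bullet> b) *\<^sub>R L' b d))) (at x within S)"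
    using has_derivative_transform[OF x eq D0] by simp
  have "bounded_linear A" using A(1) by (simp add: linear_conv_bounded_linear)
  from bounded_linear.has_derivative[OF this D]
  have "(z has_derivative (\<lambda>d. A (w' d - (\<Sum>b\<in>Basis. (z x \<bullet> b) *\<^sub>R L' b d)))) (at x within S)"
    by (simp only: A'(1))
  then show ?thesis by (rule that) (rule A'(2))
qed

text \<open>Differentiating the system shows that the derivative of \<open>z\<close> solves a system
  with the same \<open>L\<close> and a new right-hand side. Hence the induction applies to the
  derivative, and no formula for the inverse matrix is needed.\<close>

lemma Ck_on_solution:
  fixes L :: "'a::euclidean_space \<Rightarrow> 'e::euclidean_space \<Rightarrow> 'e"
  assumes S: "unique_deriv_set S"
    and lin: "\<And>y. y \<in> S \<Longrightarrow> linear (L y)" and inj: "\<And>y. y \<in> S \<Longrightarrow> inj (L y)"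
  shows "(\<And>b. Ck_on k S (\<lambda>y. L y b)) \<Longrightarrow> Ck_on k S w \<Longrightarrow> (\<And>y. y \<in> S \<Longrightarrow> L y (z y) = w y)
    \<Longrightarrow> Ck_on k S z"
proof (induction k arbitrary: z w)
  case 0
  have "(z \<longlongrightarrow> z x) (at x within S)" if x: "x \<in> S" for x
  proof (rule solution_continuous[where L = L and w = w, OF lin inj 0(3) x])
    show "((\<lambda>y. L y b) \<longlongrightarrow> L x b) (at x within S)" for b
      using 0(1)[of b] x unfolding Ck_on.simps continuous_on_def by (rule bspec)
    show "(w \<longlongrightarrow> w x) (at x within S)"
      using 0(2) x unfolding Ck_on.simps continuous_on_def by (rule bspec)
  qed
  then show ?case by (simp add: continuous_on_def)
next
  case (Suc k)
  let ?L' = "\<lambda>b x. frechet_derivative (\<lambda>y. L y b) (at x within S)"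
  let ?w' = "\<lambda>x. frechet_derivative w (at x within S)"
  have "\<forall>x\<in>S. \<exists>z'. (z has_derivative z') (at x within S) \<and>
      (\<forall>d. L x (z' d) = ?w' x d - (\<Sum>b\<in>Basis. (z x \<bullet> b) *\<^sub>R ?L' b x d))"
  proof
    fix x assume x: "x \<in> S"
    obtain z' where "(z has_derivative z') (at x within S)"
      "\<And>d. L x (z' d) = ?w' x d - (\<Sum>b\<in>Basis. (z x \<bullet> b) *\<^sub>R ?L' b x d)"
      using solution_has_derivative[where L = L and S = S and z = z and w = w,
            OF lin inj Suc.prems(3) x Ck_on_SucD(1)[OF Suc.prems(1) x] Ck_on_SucD(1)[OF Suc.prems(2) x]]
      by blast
    then show "\<exists>z'. (z has_derivative z') (at x within S) \<and>
      (\<forall>d. L x (z' d) = ?w' x d - (\<Sum>b\<in>Basis. (z x \<bullet> b) *\<^sub>R ?L' b x d))" by blast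
  qed
  from bchoice[OF this] obtain z' where z': "\<And>x. x \<in> S \<Longrightarrow> (z has_derivative z' x) (at x within S)"
    "\<And>x d. x \<in> S \<Longrightarrow> L x (z' x d) = ?w' x d - (\<Sum>b\<in>Basis. (z x \<bullet> b) *\<^sub>R ?L' b x d)" by blast
  have z: "Ck_on k S z"
    by (rule Suc.IH[OF Ck_on_Suc_imp[OF Suc.prems(1)] Ck_on_Suc_imp[OF Suc.prems(2)] Suc.prems(3)])
  show ?case
  proof (rule Ck_on_SucI[OF S z'(1)])
    fix v
    show "Ck_on k S (\<lambda>x. z' x v)"
      by (rule Suc.IH[OF Ck_on_Suc_imp[OF Suc.prems(1)] _ z'(2)])
        (intro Ck_on_diff[OF S] Ck_on_sum[OF S] Ck_on_scaleR[OF S] Ck_on_inner_const[OF S] z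
          Ck_on_SucD(2)[OF Suc.prems(1)] Ck_on_SucD(2)[OF Suc.prems(2)] finite_Basis)
  qed
qed

lemma Ck_on_open_SucD:
  assumes S: "open S" and f: "Ck_on (Suc k) S f"
  shows "x \<in> S \<Longrightarrow> (f has_derivative frechet_derivative f (at x)) (at x)"
    "Ck_on k S (\<lambda>x. frechet_derivative f (at x) v)"
proof -
  show "(f has_derivative frechet_derivative f (at x)) (at x)" if "x \<in> S"
    using Ck_on_SucD(1)[OF f that] at_within_open[OF that S] by simp
  have "Ck_on k S (\<lambda>x. frechet_derivative f (at x within S) v) \<longleftrightarrow> Ck_on k S (\<lambda>x. frechet_derivative f (at x) v)"
    by (rule Ck_on_cong) (simp only: at_within_open[OF _ S])
  then show "Ck_on k S (\<lambda>x. frechet_derivative f (at x) v)" using Ck_on_SucD(2)[OF f] by blast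
qed

text \<open>The mean value theorem is used twice, first in direction \<open>u\<close> for a
  difference in direction \<open>v\<close>, then in direction \<open>v\<close> for the derivative
  along \<open>u\<close>. The left-hand side is symmetric in \<open>u\<close> and \<open>v\<close>,
  which is the point of the lemma.\<close>

lemma second_difference:
  fixes f :: "'a::euclidean_space \<Rightarrow> real"
  assumes S: "open S" and f: "Ck_on 2 S f" and s: "s > 0"
    and sub: "\<And>p q. 0 \<le> p \<Longrightarrow> p \<le> s \<Longrightarrow> 0 \<le> q \<Longrightarrow> q \<le> s \<Longrightarrow> x + p *\<^sub>R u + q *\<^sub>R v \<in> S"
  shows "\<exists>p q. 0 < p \<and> p < s \<and> 0 < q \<and> q < s \<and>
     f (x + s *\<^sub>R u + s *\<^sub>R v) - f (x + s *\<^sub>R u) - f (x + s *\<^sub>R v) + f x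
     = s * (s * frechet_derivative (\<lambda>y. frechet_derivative f (at y) u) (at (x + p *\<^sub>R u + q *\<^sub>R v)) v)"
proof -
  let ?g = "\<lambda>y. frechet_derivative f (at y) u"
  have f': "Ck_on (Suc (Suc 0)) S f" using f by (simp add: numeral_2_eq_2)
  note f1 = Ck_on_open_SucD(1)[OF S f'] and f2 = Ck_on_open_SucD(1)[OF S Ck_on_open_SucD(2)[OF S f', of u]]
  define k where "k p = f (x + p *\<^sub>R u + s *\<^sub>R v) - f (x + p *\<^sub>R u)" for p
  have dk: "DERIV k p :> ?g (x + p *\<^sub>R u + s *\<^sub>R v) - ?g (x + p *\<^sub>R u)" if p: "0 \<le> p" "p \<le> s" for p
  proof -
    have 1: "x + p *\<^sub>R u + s *\<^sub>R v \<in> S" "x + p *\<^sub>R u \<in> S" using sub[of p s] sub[of p 0] p s by auto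
    have "((\<lambda>p. f (x + p *\<^sub>R u + s *\<^sub>R v)) has_derivative (\<lambda>d. frechet_derivative f (at (x + p *\<^sub>R u + s *\<^sub>R v)) (d *\<^sub>R u))) (at p)"
      by (rule has_derivative_compose[where f = "\<lambda>p. x + p *\<^sub>R u + s *\<^sub>R v" and g = f, OF _ f1[OF 1(1)]]) (auto intro!: derivative_eq_intros)
    moreover have "((\<lambda>p. f (x + p *\<^sub>R u)) has_derivative (\<lambda>d. frechet_derivative f (at (x + p *\<^sub>R u)) (d *\<^sub>R u))) (at p)"
      by (rule has_derivative_compose[where f = "\<lambda>p. x + p *\<^sub>R u" and g = f, OF _ f1[OF 1(2)]]) (auto intro!: derivative_eq_intros)
    ultimately have "(k has_derivative (\<lambda>d. frechet_derivative f (at (x + p *\<^sub>R u + s *\<^sub>R v)) (d *\<^sub>R u) - frechet_derivative f (at (x + p *\<^sub>R u)) (d *\<^sub>R u))) (at p)"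
      unfolding k_def by (rule has_derivative_diff)
    then show ?thesis
      unfolding has_field_derivative_def
      by (rule has_derivative_eq_rhs) (simp add: fun_eq_iff right_diff_distrib mult.commute
        linear_cmul[OF has_derivative_linear[OF f1[OF 1(1)]]] linear_cmul[OF has_derivative_linear[OF f1[OF 1(2)]]])
  qed
  have "\<exists>p>0. p < s \<and> k s - k 0 = (s - 0) * (?g (x + p *\<^sub>R u + s *\<^sub>R v) - ?g (x + p *\<^sub>R u))"
    by (rule MVT2[OF s dk])
  then obtain p where p: "0 < p" "p < s" "k s - k 0 = s * (?g (x + p *\<^sub>R u + s *\<^sub>R v) - ?g (x + p *\<^sub>R u))"
    by auto
  have dg: "DERIV (\<lambda>q. ?g (x + p *\<^sub>R u + q *\<^sub>R v)) q :> frechet_derivative ?g (at (x + p *\<^sub>R u + q *\<^sub>R v)) v"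
    if q: "0 \<le> q" "q \<le> s" for q
  proof -
    have 1: "x + p *\<^sub>R u + q *\<^sub>R v \<in> S" using sub[of p q] p q by auto
    have "((\<lambda>q. ?g (x + p *\<^sub>R u + q *\<^sub>R v)) has_derivative (\<lambda>d. frechet_derivative ?g (at (x + p *\<^sub>R u + q *\<^sub>R v)) (d *\<^sub>R v))) (at q)"
      by (rule has_derivative_compose[where f = "\<lambda>q. x + p *\<^sub>R u + q *\<^sub>R v" and g = ?g, OF _ f2[OF 1]]) (auto intro!: derivative_eq_intros)
    then show ?thesis
      unfolding has_field_derivative_def
      by (rule has_derivative_eq_rhs)
        (simp add: fun_eq_iff mult.commute linear_cmul[OF has_derivative_linear[OF f2[OF 1]]])
  qed
  have "\<exists>q>0. q < s \<and> ?g (x + p *\<^sub>R u + s *\<^sub>R v) - ?g (x + p *\<^sub>R u + 0 *\<^sub>R v)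
      = (s - 0) * frechet_derivative ?g (at (x + p *\<^sub>R u + q *\<^sub>R v)) v"
    by (rule MVT2[OF s dg])
  then obtain q where q: "0 < q" "q < s"
    "?g (x + p *\<^sub>R u + s *\<^sub>R v) - ?g (x + p *\<^sub>R u + 0 *\<^sub>R v) = s * frechet_derivative ?g (at (x + p *\<^sub>R u + q *\<^sub>R v)) v"
    by auto
  show ?thesis using p q by (intro exI[of _ p] exI[of _ q]) (simp add: k_def)
qed

lemma second_derivative_symmetric_real:
  fixes f :: "'a::euclidean_space \<Rightarrow> real"
  assumes S: "open S" and f: "Ck_on 2 S f" and x: "x \<in> S"
  shows "frechet_derivative (\<lambda>y. frechet_derivative f (at y) u) (at x) v
       = frechet_derivative (\<lambda>y. frechet_derivative f (at y) v) (at x) u"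
proof -
  define F where "F u v y = frechet_derivative (\<lambda>y. frechet_derivative f (at y) u) (at y) v" for u v y
  have f': "Ck_on (Suc (Suc 0)) S f" using f by (simp add: numeral_2_eq_2)
  have cont: "continuous_on S (F u v)" for u v
    using Ck_on_open_SucD(2)[OF S Ck_on_open_SucD(2)[OF S f', of u], of v] by (simp add: F_def)
  have "F u v x = F v u x"
  proof (rule ccontr)
    assume ne: "F u v x \<noteq> F v u x"
    \<comment> \<open>Half the gap: two equal numbers cannot lie within \<open>e\<close> of
      \<open>F u v x\<close> and of \<open>F v u x\<close> respectively.\<close>
    define e where "e = \<bar>F u v x - F v u x\<bar> / 2"
    have e: "e > 0" using ne by (simp add: e_def)
    have near: "\<exists>r>0. \<forall>y. dist y x < r \<longrightarrow> y \<in> S \<and> \<bar>F u v y - F u v x\<bar> < e" for u v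
    proof -
      have "isCont (F u v) x" using cont S x by (simp add: continuous_on_eq_continuous_at)
      then obtain r1 where r1: "r1 > 0" "\<forall>y. dist y x < r1 \<longrightarrow> \<bar>F u v y - F u v x\<bar> < e"
        using e unfolding continuous_at_eps_delta dist_real_def by blast
      obtain r2 where r2: "r2 > 0" "ball x r2 \<subseteq> S" using S x open_contains_ball by blast
      show ?thesis using r1 r2 by (intro exI[of _ "min r1 r2"]) (auto simp: subset_iff dist_commute)
    qed
    obtain r1 where r1: "r1 > 0" "\<And>y. dist y x < r1 \<Longrightarrow> y \<in> S \<and> \<bar>F u v y - F u v x\<bar> < e" using near by blast
    obtain r2 where r2: "r2 > 0" "\<And>y. dist y x < r2 \<Longrightarrow> y \<in> S \<and> \<bar>F v u y - F v u x\<bar> < e" using near by blast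
    define n where "n = norm u + norm v + 1"
    have n: "n > 0" by (simp add: n_def add_nonneg_pos)
    \<comment> \<open>Chosen so that the whole parallelogram with sides \<open>s *\<^sub>R u\<close>
      and \<open>s *\<^sub>R v\<close> at \<open>x\<close> lies in both neighbourhoods.\<close>
    define s where "s = min r1 r2 / (2 * n)"
    have s: "s > 0" using n r1 r2 by (simp add: s_def)
    have "s * n = min r1 r2 / 2" using n by (simp add: s_def)
    then have sn: "s * n < min r1 r2" using r1(1) r2(1) by linarith
    have close: "dist (x + p *\<^sub>R u + q *\<^sub>R v) x < min r1 r2" "dist (x + p *\<^sub>R v + q *\<^sub>R u) x < min r1 r2"
      if "0 \<le> p" "p \<le> s" "0 \<le> q" "q \<le> s" for p q
    proof -
      have *: "norm (p *\<^sub>R u + q *\<^sub>R v) < min r1 r2" if "0 \<le> p" "p \<le> s" "0 \<le> q" "q \<le> s" for p q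
      proof -
        have "norm (p *\<^sub>R u + q *\<^sub>R v) \<le> p * norm u + q * norm v"
          using norm_triangle_ineq[of "p *\<^sub>R u" "q *\<^sub>R v"] that by simp
        also have "\<dots> \<le> s * norm u + s * norm v" using that by (intro add_mono mult_right_mono) auto
        also have "\<dots> \<le> s * n" using s by (simp add: n_def algebra_simps)
        finally show ?thesis using sn by simp
      qed
      show "dist (x + p *\<^sub>R u + q *\<^sub>R v) x < min r1 r2" using *[of p q] that by (simp add: dist_norm add.assoc)
      show "dist (x + p *\<^sub>R v + q *\<^sub>R u) x < min r1 r2"
        using *[of q p] that by (simp add: dist_norm add.assoc add.commute)
    qed
    have sub: "x + p *\<^sub>R u + q *\<^sub>R v \<in> S" "x + p *\<^sub>R v + q *\<^sub>R u \<in> S"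
      if "0 \<le> p" "p \<le> s" "0 \<le> q" "q \<le> s" for p q
      using close[OF that] r1(2) by auto
    obtain p q where pq: "0 < p" "p < s" "0 < q" "q < s"
      "f (x + s *\<^sub>R u + s *\<^sub>R v) - f (x + s *\<^sub>R u) - f (x + s *\<^sub>R v) + f x = s * (s * F u v (x + p *\<^sub>R u + q *\<^sub>R v))"
      using second_difference[OF S f s sub(1)] unfolding F_def by blast
    obtain p' q' where pq': "0 < p'" "p' < s" "0 < q'" "q' < s"
      "f (x + s *\<^sub>R v + s *\<^sub>R u) - f (x + s *\<^sub>R v) - f (x + s *\<^sub>R u) + f x = s * (s * F v u (x + p' *\<^sub>R v + q' *\<^sub>R u))"
      using second_difference[OF S f s sub(2)] unfolding F_def by blast
    have e: "x + s *\<^sub>R v + s *\<^sub>R u = x + s *\<^sub>R u + s *\<^sub>R v" by simp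
    have "s * (s * F u v (x + p *\<^sub>R u + q *\<^sub>R v)) = s * (s * F v u (x + p' *\<^sub>R v + q' *\<^sub>R u))"
      using pq(5) pq'(5)[unfolded e] by linarith
    then have "F u v (x + p *\<^sub>R u + q *\<^sub>R v) = F v u (x + p' *\<^sub>R v + q' *\<^sub>R u)" using s by simp
    moreover have "\<bar>F u v (x + p *\<^sub>R u + q *\<^sub>R v) - F u v x\<bar> < e" using r1(2) close(1)[of p q] pq by simp
    moreover have "\<bar>F v u (x + p' *\<^sub>R v + q' *\<^sub>R u) - F v u x\<bar> < e" using r2(2) close(2)[of p' q'] pq' by simp
    ultimately show False unfolding e_def by (simp add: abs_if split: if_splits)
  qed
  then show ?thesis by (simp add: F_def)
qed

lemma second_derivative_symmetric:
  fixes f :: "'a::euclidean_space \<Rightarrow> 'b::euclidean_space"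
  assumes S: "open S" and f: "Ck_on 2 S f" and x: "x \<in> S"
  shows "frechet_derivative (\<lambda>y. frechet_derivative f (at y) u) (at x) v
       = frechet_derivative (\<lambda>y. frechet_derivative f (at y) v) (at x) u"
proof (rule euclidean_eqI)
  fix b :: 'b assume "b \<in> Basis"
  have f': "Ck_on (Suc (Suc 0)) S f" using f by (simp add: numeral_2_eq_2)
  note f1 = Ck_on_open_SucD(1)[OF S f'] and f2 = Ck_on_open_SucD(1)[OF S Ck_on_open_SucD(2)[OF S f'] x]
  have f1b: "frechet_derivative (\<lambda>y. f y \<bullet> b) (at y) v = frechet_derivative f (at y) v \<bullet> b" if "y \<in> S" for y v
    by (simp only: frechet_derivative_at[OF has_derivative_inner_left[OF f1[OF that], of b], symmetric])
  have f2b: "frechet_derivative (\<lambda>y. frechet_derivative (\<lambda>y. f y \<bullet> b) (at y) u) (at x) v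
      = frechet_derivative (\<lambda>y. frechet_derivative f (at y) u) (at x) v \<bullet> b" for u v
  proof -
    have D: "((\<lambda>y. frechet_derivative (\<lambda>y. f y \<bullet> b) (at y) u) has_derivative
       (\<lambda>d. frechet_derivative (\<lambda>y. frechet_derivative f (at y) u) (at x) d \<bullet> b)) (at x)"
      by (rule has_derivative_transform_within_open[OF has_derivative_inner_left[OF f2] S x]) (simp add: f1b)
    show ?thesis by (simp only: frechet_derivative_at[OF D, symmetric])
  qed
  have "Ck_on 2 S (\<lambda>y. f y \<bullet> b)" by (rule Ck_on_inner_const[OF unique_deriv_set_open[OF S] f])
  note sym = second_derivative_symmetric_real[OF S this x, of u v]
  show "frechet_derivative (\<lambda>y. frechet_derivative f (at y) u) (at x) v \<bullet> b
      = frechet_derivative (\<lambda>y. frechet_derivative f (at y) v) (at x) u \<bullet> b"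
    by (rule trans[OF trans[OF f2b[of u v, symmetric] sym] f2b])
qed

section \<open>Linear differential equations\<close>

lemma continuous_on_apply_linear:
  fixes M :: "'a::topological_space \<Rightarrow> 'e::euclidean_space \<Rightarrow> 'f::real_normed_vector"
  assumes lin: "\<And>t. t \<in> S \<Longrightarrow> linear (M t)" and M: "\<And>b. b \<in> Basis \<Longrightarrow> continuous_on S (\<lambda>t. M t b)"
    and y: "continuous_on S y"
  shows "continuous_on S (\<lambda>t. M t (y t))"
proof -
  have "continuous_on S (\<lambda>t. \<Sum>b\<in>Basis. (y t \<bullet> b) *\<^sub>R M t b)"
    by (intro continuous_intros M y)
  moreover have "continuous_on S (\<lambda>t. M t (y t)) \<longleftrightarrow> continuous_on S (\<lambda>t. \<Sum>b\<in>Basis. (y t \<bullet> b) *\<^sub>R M t b)"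
    by (rule continuous_on_cong[OF refl]) (rule linear_basis_expand[OF lin])
  ultimately show ?thesis by blast
qed

lemma linear_family_bounded:
  fixes M :: "real \<Rightarrow> 'e::euclidean_space \<Rightarrow> 'e"
  assumes lin: "\<And>t. t \<in> {a..b} \<Longrightarrow> linear (M t)" and M: "\<And>u. continuous_on {a..b} (\<lambda>t. M t u)"
  obtains K where "K > 0" "\<And>t u. t \<in> {a..b} \<Longrightarrow> norm (M t u) \<le> K * norm u"
proof -
  have "\<exists>B. \<forall>t\<in>{a..b}. norm (M t u) \<le> B" for u
    using compact_imp_bounded[OF compact_continuous_image[OF M[of u] compact_Icc]]
    unfolding bounded_iff by auto
  then obtain B where B: "\<And>u t. t \<in> {a..b} \<Longrightarrow> norm (M t u) \<le> B u" by metis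
  define K where "K = (\<Sum>b\<in>(Basis::'e set). \<bar>B b\<bar>) + 1"
  have "K > 0" unfolding K_def by (intro add_nonneg_pos sum_nonneg) auto
  moreover have "norm (M t u) \<le> K * norm u" if t: "t \<in> {a..b}" for t u
  proof -
    have "norm (M t u) \<le> (\<Sum>b\<in>Basis. norm u * \<bar>B b\<bar>)"
      unfolding linear_basis_expand[OF lin[OF t], of u]
    proof (intro order_trans[OF norm_sum] sum_mono)
      fix i :: 'e assume i: "i \<in> Basis"
      show "norm ((u \<bullet> i) *\<^sub>R M t i) \<le> norm u * \<bar>B i\<bar>"
        using B[OF t, of i] Basis_le_norm[OF i, of u] by (auto intro!: mult_mono)
    qed
    also have "\<dots> \<le> K * norm u" by (simp add: K_def sum_distrib_left[symmetric] algebra_simps)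
    finally show ?thesis .
  qed
  ultimately show ?thesis using that by blast
qed

lemma has_vector_derivative_glue:
  fixes f :: "real \<Rightarrow> 'b::real_normed_vector"
  assumes "s \<le> t" "t \<le> r" "\<tau> \<in> {s..r}"
    and l: "\<tau> \<le> t \<Longrightarrow> (f has_vector_derivative D) (at \<tau> within {s..t})"
    and u: "t \<le> \<tau> \<Longrightarrow> (f has_vector_derivative D) (at \<tau> within {t..r})"
  shows "(f has_vector_derivative D) (at \<tau> within {s..r})"
proof -
  consider "\<tau> < t" | "\<tau> > t" | "\<tau> = t" by linarith
  then show ?thesis
  proof cases
    case 1
    have "at \<tau> within {s..r} = at \<tau> within {s..t}"
      by (rule at_within_nhd[where S = "{..<t}"]) (use 1 assms in auto)
    then show ?thesis using l 1 by simp
  next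
    case 2
    have "at \<tau> within {s..r} = at \<tau> within {t..r}"
      by (rule at_within_nhd[where S = "{t<..}"]) (use 2 assms in auto)
    then show ?thesis using u 2 by simp
  next
    case 3
    have "(f has_vector_derivative D) (at \<tau> within {s..t} \<union> {t..r})"
      using l u 3 unfolding has_vector_derivative_def has_derivative_iff_norm by (simp add: Lim_Un)
    moreover have "{s..t} \<union> {t..r} = {s..r}" using assms by auto
    ultimately show ?thesis by simp
  qed
qed

lemma linear_ode_short:
  fixes M :: "real \<Rightarrow> 'e::euclidean_space \<Rightarrow> 'e"
  assumes ab: "a \<le> b" and lin: "\<And>t. t \<in> {a..b} \<Longrightarrow> linear (M t)"
    and M: "\<And>u. continuous_on {a..b} (\<lambda>t. M t u)"
    and K: "\<And>t u. t \<in> {a..b} \<Longrightarrow> norm (M t u) \<le> K * norm u" and short: "K * (b - a) \<le> 1 / 2"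
  obtains y where "y a = v" "\<And>t. t \<in> {a..b} \<Longrightarrow> (y has_vector_derivative M t (y t)) (at t within {a..b})"
proof -
  \<comment> \<open>Clamping the time extends functions on \<open>{a..b}\<close> to the whole line,
    so that the Picard operator acts on the complete space of bounded continuous functions.\<close>
  define c where "c t = max a (min b t)" for t
  have c: "c t \<in> {a..b}" for t using ab by (auto simp: c_def)
  have cid: "c t = t" if "t \<in> {a..b}" for t using that by (auto simp: c_def)
  have contM: "continuous_on {a..b} (\<lambda>t. M t (apply_bcontfun y t))" for y :: "real \<Rightarrow>\<^sub>C 'e"
    by (rule continuous_on_apply_linear[OF lin M continuous_on_apply_bcontfun])
  define \<Phi> where "\<Phi> y t = v + integral {a..c t} (\<lambda>\<tau>. M \<tau> (apply_bcontfun y \<tau>))" for y :: "real \<Rightarrow>\<^sub>C 'e" and t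
  have contI: "continuous_on {a..b} (\<lambda>t. integral {a..t} (\<lambda>\<tau>. M \<tau> (apply_bcontfun y \<tau>)))" for y :: "real \<Rightarrow>\<^sub>C 'e"
    by (intro indefinite_integral_continuous_1 integrable_continuous_real contM)
  have \<Phi>: "\<Phi> y \<in> bcontfun" for y :: "real \<Rightarrow>\<^sub>C 'e"
    unfolding bcontfun_def
  proof (intro CollectI conjI)
    have cc: "continuous_on UNIV c" unfolding c_def by (intro continuous_intros)
    have "continuous_on UNIV (\<lambda>t. integral {a..c t} (\<lambda>\<tau>. M \<tau> (apply_bcontfun y \<tau>)))"
      by (rule continuous_on_compose2[OF contI cc]) (use c in auto)
    then show "continuous_on UNIV (\<Phi> y)" unfolding \<Phi>_def by (intro continuous_intros)
    have "bounded ((\<lambda>t. v + integral {a..t} (\<lambda>\<tau>. M \<tau> (apply_bcontfun y \<tau>))) ` {a..b})"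
      by (intro compact_imp_bounded compact_continuous_image continuous_intros contI) auto
    then show "bounded (range (\<Phi> y))"
      by (rule bounded_subset) (use c in \<open>auto simp: \<Phi>_def\<close>)
  qed
  have "\<exists>!y. Bcontfun (\<Phi> y) = y"
  proof (rule banach_fix_type)
    show "\<forall>y z. dist (Bcontfun (\<Phi> y)) (Bcontfun (\<Phi> z)) \<le> (1/2) * dist y z"
    proof (intro allI dist_bound)
      fix y z :: "real \<Rightarrow>\<^sub>C 'e" and t
      let ?f = "\<lambda>\<tau>. M \<tau> (apply_bcontfun y \<tau>)" and ?g = "\<lambda>\<tau>. M \<tau> (apply_bcontfun z \<tau>)"
      have sub: "{a..c t} \<subseteq> {a..b}" using c[of t] by auto
      have cf: "continuous_on {a..c t} ?f" "continuous_on {a..c t} ?g"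
        using continuous_on_subset[OF contM sub] by auto
      have "dist (\<Phi> y t) (\<Phi> z t) = norm (integral {a..c t} (\<lambda>\<tau>. ?f \<tau> - ?g \<tau>))"
        by (simp add: \<Phi>_def dist_norm integral_diff integrable_continuous_real cf)
      also have "\<dots> \<le> (\<bar>K\<bar> * dist y z) * (c t - a)"
      proof (rule integral_bound)
        show "a \<le> c t" using c[of t] by simp
        show "continuous_on {a..c t} (\<lambda>\<tau>. ?f \<tau> - ?g \<tau>)" by (intro continuous_intros cf)
        fix \<tau> assume "\<tau> \<in> {a..c t}"
        then have \<tau>: "\<tau> \<in> {a..b}" using sub by blast
        have "norm (?f \<tau> - ?g \<tau>) \<le> K * norm (apply_bcontfun y \<tau> - apply_bcontfun z \<tau>)"
          using K[OF \<tau>] by (simp add: linear_diff[OF lin[OF \<tau>], symmetric])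
        also have "\<dots> \<le> \<bar>K\<bar> * dist y z"
          using dist_bounded[of y \<tau> z] by (intro mult_mono) (auto simp: dist_norm)
        finally show "norm (?f \<tau> - ?g \<tau>) \<le> \<bar>K\<bar> * dist y z" .
      qed
      also have "\<dots> \<le> (\<bar>K\<bar> * dist y z) * (b - a)"
        using c[of t] by (intro mult_left_mono) auto
      also have "\<dots> = (\<bar>K\<bar> * (b - a)) * dist y z" by simp
      also have "\<dots> \<le> (1/2) * dist y z"
      proof (intro mult_right_mono)
        show "\<bar>K\<bar> * (b - a) \<le> 1 / 2"
        \<comment> \<open>No sign is assumed for \<open>K\<close>; its defining bound at a basis
          vector rules out a negative value.\<close>
        proof (cases "K \<ge> 0")
          case False
          obtain i :: 'e where i: "i \<in> Basis" using nonempty_Basis by blast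
          have "0 \<le> K * norm i" using K[of a i] ab norm_ge_zero order_trans by (metis atLeastAtMost_iff order_refl)
          then show ?thesis using False i by (simp add: zero_le_mult_iff)
        qed (use short in simp)
      qed simp
      finally show "dist (apply_bcontfun (Bcontfun (\<Phi> y)) t) (apply_bcontfun (Bcontfun (\<Phi> z)) t) \<le> 1 / 2 * dist y z"
        by (simp add: Bcontfun_inverse \<Phi>)
    qed
  qed auto
  then obtain y :: "real \<Rightarrow>\<^sub>C 'e" where "Bcontfun (\<Phi> y) = y" by blast
  then have y: "apply_bcontfun y t = \<Phi> y t" for t by (metis Bcontfun_inverse \<Phi>)
  show ?thesis
  proof (rule that[of "apply_bcontfun y"])
    show "apply_bcontfun y a = v" using ab by (simp add: y[of a] \<Phi>_def cid)
    fix t assume t: "t \<in> {a..b}"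
    have D: "((\<lambda>t. v + integral {a..t} (\<lambda>\<tau>. M \<tau> (apply_bcontfun y \<tau>))) has_vector_derivative
       0 + M t (apply_bcontfun y t)) (at t within {a..b})"
      by (intro has_vector_derivative_add has_vector_derivative_const integral_has_vector_derivative contM t)
    have "apply_bcontfun y s = v + integral {a..s} (\<lambda>\<tau>. M \<tau> (apply_bcontfun y \<tau>))" if "s \<in> {a..b}" for s
      unfolding y[of s] \<Phi>_def cid[OF that] by (rule refl)
    from has_vector_derivative_transform[OF t this D]
    show "(apply_bcontfun y has_vector_derivative M t (apply_bcontfun y t)) (at t within {a..b})" by simp
  qed
qed

text \<open>The contraction argument reaches only intervals shorter than \<open>1 / (2 * K)\<close>,
  with one \<open>K\<close> for the whole interval; bisection (\<open>Bolzano\<close>) assembles the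
  pieces.\<close>

lemma linear_ode_exists:
  fixes M :: "real \<Rightarrow> 'e::euclidean_space \<Rightarrow> 'e"
  assumes ab: "a \<le> b" and lin: "\<And>t. t \<in> {a..b} \<Longrightarrow> linear (M t)"
    and M: "\<And>u. continuous_on {a..b} (\<lambda>t. M t u)"
  obtains y where "y a = v" "\<And>t. t \<in> {a..b} \<Longrightarrow> (y has_vector_derivative M t (y t)) (at t within {a..b})"
proof -
  obtain K where K: "K > 0" "\<And>t u. t \<in> {a..b} \<Longrightarrow> norm (M t u) \<le> K * norm u"
    using linear_family_bounded[OF lin M] by blast
  \<comment> \<open>The initial value is quantified inside \<open>P\<close>, because the right piece
    has to start at the end value of the left one.\<close>
  define P where "P s t \<longleftrightarrow> (a \<le> s \<and> s \<le> t \<and> t \<le> b \<longrightarrow> (\<forall>v. \<exists>y. y s = v \<and>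
     (\<forall>\<tau>\<in>{s..t}. (y has_vector_derivative M \<tau> (y \<tau>)) (at \<tau> within {s..t}))))" for s t
  have "P a b"
  proof (induction rule: Bolzano[OF ab])
    case (1 s t r)
    show ?case unfolding P_def
    proof (intro impI allI)
      fix v assume sr: "a \<le> s \<and> s \<le> r \<and> r \<le> b"
      obtain y where y: "y s = v" "\<And>\<tau>. \<tau> \<in> {s..t} \<Longrightarrow> (y has_vector_derivative M \<tau> (y \<tau>)) (at \<tau> within {s..t})"
        using 1 sr unfolding P_def by force
      obtain z where z: "z t = y t" "\<And>\<tau>. \<tau> \<in> {t..r} \<Longrightarrow> (z has_vector_derivative M \<tau> (z \<tau>)) (at \<tau> within {t..r})"
        using 1 sr unfolding P_def by force
      define w where "w \<tau> = (if \<tau> \<le> t then y \<tau> else z \<tau>)" for \<tau>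
      have w: "w \<tau> = y \<tau>" if "\<tau> \<in> {s..t}" for \<tau> using that by (simp add: w_def)
      have w': "w \<tau> = z \<tau>" if "\<tau> \<in> {t..r}" for \<tau> using that z(1) by (auto simp: w_def)
      have "(w has_vector_derivative M \<tau> (w \<tau>)) (at \<tau> within {s..r})" if \<tau>: "\<tau> \<in> {s..r}" for \<tau>
      proof (rule has_vector_derivative_glue[OF 1(3,4) \<tau>])
        assume "\<tau> \<le> t"
        then have t: "\<tau> \<in> {s..t}" using \<tau> by simp
        show "(w has_vector_derivative M \<tau> (w \<tau>)) (at \<tau> within {s..t})"
          unfolding w[OF t] by (rule has_vector_derivative_transform[OF t w y(2)[OF t]])
      next
        assume "t \<le> \<tau>"
        then have t: "\<tau> \<in> {t..r}" using \<tau> by simp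
        show "(w has_vector_derivative M \<tau> (w \<tau>)) (at \<tau> within {t..r})"
          unfolding w'[OF t] by (rule has_vector_derivative_transform[OF t w' z(2)[OF t]])
      qed
      moreover have "w s = v" using w[of s] y(1) 1 by simp
      ultimately show "\<exists>y. y s = v \<and> (\<forall>\<tau>\<in>{s..r}. (y has_vector_derivative M \<tau> (y \<tau>)) (at \<tau> within {s..r}))"
        by blast
    qed
  next
    case (2 x)
    show ?case
    proof (intro exI[of _ "1 / (2 * K)"] conjI allI impI)
      show "0 < 1 / (2 * K)" using K by simp
      fix s t assume st: "s \<le> x \<and> x \<le> t \<and> t - s < 1 / (2 * K)"
      show "P s t" unfolding P_def
      proof (intro impI allI)
        fix v assume ast: "a \<le> s \<and> s \<le> t \<and> t \<le> b"
        then have sub: "{s..t} \<subseteq> {a..b}" by auto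
        have "K * (t - s) \<le> 1 / 2" using st K(1) by (simp add: field_simps)
        then obtain y where "y s = v" "\<And>\<tau>. \<tau> \<in> {s..t} \<Longrightarrow> (y has_vector_derivative M \<tau> (y \<tau>)) (at \<tau> within {s..t})"
          using linear_ode_short[where a = s and b = t and M = M and K = K and v = v]
            lin K(2) continuous_on_subset[OF M sub] sub ast by blast
        then show "\<exists>y. y s = v \<and> (\<forall>\<tau>\<in>{s..t}. (y has_vector_derivative M \<tau> (y \<tau>)) (at \<tau> within {s..t}))" by blast
      qed
    qed
  qed
  then obtain y where "y a = v" "\<forall>t\<in>{a..b}. (y has_vector_derivative M t (y t)) (at t within {a..b})"
    using ab unfolding P_def by blast
  then show ?thesis using that by blast
qed

lemma linear_ode_unique:
  fixes M :: "real \<Rightarrow> 'e::euclidean_space \<Rightarrow> 'e"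
  assumes lin: "\<And>t. t \<in> {a..b} \<Longrightarrow> linear (M t)"
    and M: "\<And>u. continuous_on {a..b} (\<lambda>t. M t u)"
    and y: "\<And>t. t \<in> {a..b} \<Longrightarrow> (y has_vector_derivative M t (y t)) (at t within {a..b})"
    and y0: "y a = 0" and t: "t \<in> {a..b}"
  shows "y t = 0"
proof -
  obtain K where K: "K > 0" "\<And>t u. t \<in> {a..b} \<Longrightarrow> norm (M t u) \<le> K * norm u"
    using linear_family_bounded[OF lin M] by blast
  \<comment> \<open>Gronwall weight: the exponential compensates the growth rate
    \<open>2 * K\<close> of the squared norm, so \<phi> cannot increase from its initial value
    0.\<close>
  define \<phi> where "\<phi> s = exp (- 2 * K * s) * (y s \<bullet> y s)" for s
  have d\<phi>: "(\<phi> has_real_derivative exp (- 2 * K * s) * (2 * (M s (y s) \<bullet> y s) - 2 * K * (y s \<bullet> y s))) (at s within {a..b})"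
    if s: "s \<in> {a..b}" for s
  proof -
    have "((\<lambda>s. y s \<bullet> y s) has_vector_derivative y s \<bullet> M s (y s) + M s (y s) \<bullet> y s) (at s within {a..b})"
      by (rule bounded_bilinear.has_vector_derivative[OF bounded_bilinear_inner y[OF s] y[OF s]])
    then have "((\<lambda>s. y s \<bullet> y s) has_real_derivative 2 * (M s (y s) \<bullet> y s)) (at s within {a..b})"
      by (simp add: has_real_derivative_iff_has_vector_derivative inner_commute)
    then show ?thesis unfolding \<phi>_def
      by (auto intro!: derivative_eq_intros simp: algebra_simps)
  qed
  have cont: "continuous_on {a..b} \<phi>"
    using d\<phi> by (meson DERIV_continuous continuous_on_eq_continuous_within)
  have "\<phi> t \<le> \<phi> a"
  proof (rule DERIV_nonpos_imp_decreasing_open[where f = \<phi>])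
    show "a \<le> t" using t by simp
    show "continuous_on {a..t} \<phi>" using continuous_on_subset[OF cont] t by auto
    fix s assume s: "a < s" "s < t"
    then have sb: "s \<in> {a..b}" "at s within {a..b} = at s" using t by (auto intro!: at_within_interior)
    have "M s (y s) \<bullet> y s \<le> norm (M s (y s)) * norm (y s)" by (rule norm_cauchy_schwarz)
    also have "\<dots> \<le> K * norm (y s) * norm (y s)" by (intro mult_right_mono K(2)[OF sb(1)]) simp
    finally have "2 * (M s (y s) \<bullet> y s) - 2 * K * (y s \<bullet> y s) \<le> 0"
      by (simp add: dot_square_norm power2_eq_square)
    then have "exp (- 2 * K * s) * (2 * (M s (y s) \<bullet> y s) - 2 * K * (y s \<bullet> y s)) \<le> 0"
      by (intro mult_nonneg_nonpos) simp_all
    then show "\<exists>D. (\<phi> has_real_derivative D) (at s) \<and> D \<le> 0"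
      using d\<phi>[OF sb(1)] unfolding sb(2) by blast
  qed
  then have "y t \<bullet> y t \<le> 0" by (simp add: \<phi>_def y0 mult_le_0_iff)
  then have "y t \<bullet> y t = 0" using inner_ge_zero[of "y t"] by linarith
  then show ?thesis by simp
qed

text \<open>Regularity bootstraps: if \<open>y\<close> is \<open>C\<^sup>k\<close>, then so is \<open>y' = M y\<close>.\<close>

lemma Ck_on_linear_ode:
  fixes M :: "real \<Rightarrow> 'e::euclidean_space \<Rightarrow> 'e"
  assumes S: "unique_deriv_set S" and lin: "\<And>t. t \<in> S \<Longrightarrow> linear (M t)"
    and M: "\<And>u k. Ck_on k S (\<lambda>t. M t u)"
    and y: "\<And>t. t \<in> S \<Longrightarrow> (y has_vector_derivative M t (y t)) (at t within S)"
  shows "Ck_on k S y"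
proof (induction k)
  case 0
  show ?case unfolding Ck_on.simps
    using y has_vector_derivative_continuous continuous_on_eq_continuous_within by blast
next
  case (Suc k)
  have "Ck_on k S (\<lambda>t. M t (y t))" by (rule Ck_on_apply[OF S lin M Suc])
  then have "Ck_on k S (\<lambda>t. v *\<^sub>R M t (y t))" for v :: real
    by (rule Ck_on_scaleR[OF S Ck_on_const[OF S]])
  then show ?case by (intro Ck_on_SucI[OF S y[unfolded has_vector_derivative_def]])
qed

section \<open>Christoffel maps and curvature in charts\<close>

lemma has_derivative_apply_at:
  fixes L :: "'a::real_normed_vector \<Rightarrow> 'b::euclidean_space \<Rightarrow> 'c::real_normed_vector"
  assumes S: "open S" "x \<in> S" and lin: "\<And>y. y \<in> S \<Longrightarrow> linear (L y)"
    and L: "\<And>b. ((\<lambda>y. L y b) has_derivative L' b) (at x)"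
    and L': "\<And>d. linear (\<lambda>b. L' b d)"
    and U: "(U has_derivative U') (at x)"
  shows "((\<lambda>y. L y (U y)) has_derivative (\<lambda>d. L x (U' d) + L' (U x) d)) (at x)"
  using has_derivative_apply[where L = L and L' = L' and U = U and U' = U' and S = S, OF lin S(2)] L L' U
  unfolding at_within_open[OF S(2,1)] by blast

lemma linear_derivative_family:
  fixes L :: "'a::real_normed_vector \<Rightarrow> 'b::real_vector \<Rightarrow> 'c::real_normed_vector"
  assumes S: "open S" "x \<in> S" and lin: "\<And>y. y \<in> S \<Longrightarrow> linear (L y)"
    and L: "\<And>b. ((\<lambda>y. L y b) has_derivative L' b) (at x)"
  shows "linear (\<lambda>b. L' b d)"
proof (rule linearI)
  fix u v :: 'b and r :: real
  have "((\<lambda>y. L y u + L y v) has_derivative (\<lambda>d. L' u d + L' v d)) (at x)"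
    by (rule has_derivative_add[OF L L])
  then have "((\<lambda>y. L y (u + v)) has_derivative (\<lambda>d. L' u d + L' v d)) (at x)"
    by (rule has_derivative_transform_within_open[OF _ S]) (simp add: linear_add[OF lin])
  then show "L' (u + v) d = L' u d + L' v d" using has_derivative_unique[OF L] by metis
  have "((\<lambda>y. r *\<^sub>R L y u) has_derivative (\<lambda>d. r *\<^sub>R L' u d)) (at x)"
    by (rule has_derivative_scaleR_right[OF L])
  then have "((\<lambda>y. L y (r *\<^sub>R u)) has_derivative (\<lambda>d. r *\<^sub>R L' u d)) (at x)"
    by (rule has_derivative_transform_within_open[OF _ S]) (simp add: linear_cmul[OF lin])
  then show "L' (r *\<^sub>R u) d = r *\<^sub>R L' u d" using has_derivative_unique[OF L] by metis
qed

lemma bilinear_derivative_family: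
  fixes B :: "'a::real_normed_vector \<Rightarrow> 'b::real_vector \<Rightarrow> 'b2::real_vector \<Rightarrow> 'c::real_normed_vector"
  assumes S: "open S" "x \<in> S" and bil: "\<And>y. y \<in> S \<Longrightarrow> bilinear (B y)"
    and B: "\<And>u v. ((\<lambda>y. B y u v) has_derivative B' u v) (at x)"
  shows "bilinear (\<lambda>u v. B' u v d)"
  unfolding bilinear_def
proof (intro conjI allI)
  fix u
  show "linear (\<lambda>v. B' u v d)"
    by (rule linear_derivative_family[OF S _ B]) (use bil in \<open>simp add: bilinear_def\<close>)
next
  fix v
  show "linear (\<lambda>u. B' u v d)"
    by (rule linear_derivative_family[where L = "\<lambda>y u. B y u v" and L' = "\<lambda>u. B' u v", OF S _ B])
      (use bil in \<open>simp add: bilinear_def\<close>)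
qed

lemma has_derivative_apply2_at:
  fixes B :: "'a::real_normed_vector \<Rightarrow> 'b::euclidean_space \<Rightarrow> 'b2::euclidean_space \<Rightarrow> 'c::real_normed_vector"
  assumes S: "open S" "x \<in> S" and bil: "\<And>y. y \<in> S \<Longrightarrow> bilinear (B y)"
    and B: "\<And>u v. ((\<lambda>y. B y u v) has_derivative B' u v) (at x)"
    and U: "(U has_derivative U') (at x)" and V: "(V has_derivative V') (at x)"
  shows "((\<lambda>y. B y (U y) (V y)) has_derivative
      (\<lambda>d. B x (U x) (V' d) + (B x (U' d) (V x) + B' (U x) (V x) d))) (at x)"
proof -
  have lin: "linear (B y u)" "linear (\<lambda>u. B y u v)" if "y \<in> S" for y u v
    using bil[OF that] by (auto simp: bilinear_def)
  have bilB': "bilinear (\<lambda>u v. B' u v d)" for d by (rule bilinear_derivative_family[OF S bil B])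
  have 1: "((\<lambda>y. B y (U y) v) has_derivative (\<lambda>d. B x (U' d) v + B' (U x) v d)) (at x)" for v
    using bilB' by (intro has_derivative_apply_at[where L = "\<lambda>y u. B y u v" and L' = "\<lambda>u. B' u v",
        OF S lin(2) B _ U]) (auto simp: bilinear_def)
  show ?thesis
  proof (rule has_derivative_apply_at[where L = "\<lambda>y v. B y (U y) v" and L' = "\<lambda>v d. B x (U' d) v + B' (U x) v d",
        OF S lin(1) 1 _ V])
    show "linear (\<lambda>b. B x (U' d) b + B' (U x) b d)" for d
      using bilB' lin(1)[OF S(2)] by (intro linear_compose_add) (auto simp: bilinear_def)
  qed
qed

text \<open>Pointwise linear algebra: \<open>D u v w\<close> stands for the derivative in direction
  \<open>u\<close> of the metric coefficient at \<open>v, w\<close>. The Koszul expression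
  \<open>K\<close> is linear in \<open>w\<close>, hence represented by a vector, and the two
  required properties follow from the symmetry of \<open>D\<close> in its last arguments.\<close>

lemma levi_civita_exists:
  fixes G :: "'e::euclidean_space \<Rightarrow> 'e \<Rightarrow> real"
  assumes G: "bilinear G" "\<And>v w. G v w = G w v" "nondegenerate_on UNIV G"
    and D: "\<And>v w. linear (\<lambda>u. D u v w)" "\<And>u. bilinear (D u)" "\<And>u v w. D u v w = D u w v"
  obtains \<Gamma> where "bilinear \<Gamma>" "\<And>u v. \<Gamma> u v = \<Gamma> v u"
    "\<And>u v w. D u v w = G (\<Gamma> u v) w + G v (\<Gamma> u w)"
proof -
  note Gs = bilinear_ladd[OF G(1)] bilinear_radd[OF G(1)] bilinear_lmul[OF G(1)] bilinear_rmul[OF G(1)]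
    bilinear_lsub[OF G(1)] bilinear_rsub[OF G(1)] bilinear_lzero[OF G(1)] bilinear_rzero[OF G(1)]
  note Ds = bilinear_ladd[OF D(2)] bilinear_radd[OF D(2)] bilinear_lmul[OF D(2)] bilinear_rmul[OF D(2)]
    linear_add[OF D(1)] linear_cmul[OF D(1)]
  define K where "K u v w = (D u v w + D v u w - D w u v) / 2" for u v w
  have nd: "nondegenerate_on UNIV (\<lambda>v w. G w v)"
    using G by (simp add: nondegenerate_on_def)
  have "\<exists>z. \<forall>w. G w z = K u v w" for u v
  proof -
    have "linear (K u v)" by (rule linearI) (simp_all add: K_def Ds add_divide_distrib diff_divide_distrib algebra_simps)
    then show ?thesis using representation_on[OF subspace_UNIV G(1) nd] by (metis UNIV_I)
  qed
  then have "\<forall>p. \<exists>z. \<forall>w. G w z = K (fst p) (snd p) w" by blast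
  from choice[OF this] obtain f where "\<And>p w. G w (f p) = K (fst p) (snd p) w" by blast
  then have \<Gamma>: "G w (f (u, v)) = K u v w" for u v w by simp
  have eq: "y = z" if "\<And>w. G w y = G w z" for y z
  proof -
    have "\<forall>w. G (y - z) w = 0" using that G(2) by (simp add: Gs)
    then show ?thesis using G(3) by (auto simp: nondegenerate_on_def)
  qed
  show ?thesis
  proof (rule that[of "\<lambda>u v. f (u, v)"])
    show "bilinear (\<lambda>u v. f (u, v))" unfolding bilinear_def
      by (intro conjI allI linearI eq) (simp_all add: Gs \<Gamma> K_def Ds add_divide_distrib diff_divide_distrib algebra_simps)
    show "f (u, v) = f (v, u)" for u v by (rule eq) (use D(3) in \<open>simp add: \<Gamma> K_def\<close>)
    show "D u v w = G (f (u, v)) w + G v (f (u, w))" for u v w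
      unfolding G(2)[of "f (u, v)" w] \<Gamma> K_def using D(3)[of u w v] D(3)[of w u v] D(3)[of v u w] by (simp add: field_simps)
  qed
qed

text \<open>Three cyclic instances of metric compatibility combine so that symmetry isolates one
  pairing. It gives uniqueness of the Christoffel map and an explicit system for it.\<close>

lemma koszul:
  fixes G :: "'e::euclidean_space \<Rightarrow> 'e \<Rightarrow> real"
  assumes "\<And>v w. G v w = G w v" "\<And>u v. \<Gamma> u v = \<Gamma> v u"
    "\<And>u v w. D u v w = G (\<Gamma> u v) w + G v (\<Gamma> u w)"
  shows "G (\<Gamma> u v) w = (D u v w + D v u w - D w u v) / 2"
  using assms(3)[of u v w] assms(3)[of v u w] assms(3)[of w u v]
    assms(2)[of v u] assms(2)[of w u] assms(2)[of w v] assms(1)[of "\<Gamma> u w" v] assms(1)[of "\<Gamma> v w" u]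
  by simp

section \<open>Transition maps and the metric in charts\<close>

definition transition :: "('m, 'e) chart \<Rightarrow> ('m, 'e) chart \<Rightarrow> 'e \<Rightarrow> 'e" where
  "transition c d = chart_map d \<circ> chart_inv c"

definition overlap :: "('m, 'e) chart \<Rightarrow> ('m, 'e) chart \<Rightarrow> 'e set" where
  "overlap c d = chart_map c ` (chart_dom c \<inter> chart_dom d)"

definition dtrans :: "('m, 'e::euclidean_space) chart \<Rightarrow> ('m, 'e) chart \<Rightarrow> 'e \<Rightarrow> 'e \<Rightarrow> 'e" where
  "dtrans c d x v = frechet_derivative (transition c d) (at x) v"

text \<open>The second derivative of the transition map, which is the inhomogeneous term in the
  transformation law of the Christoffel maps.\<close>

definition htrans :: "('m, 'e::euclidean_space) chart \<Rightarrow> ('m, 'e) chart \<Rightarrow> 'e \<Rightarrow> 'e \<Rightarrow> 'e \<Rightarrow> 'e" where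
  "htrans c d x u v = frechet_derivative (\<lambda>y. dtrans c d y v) (at x) u"

lemma change_comp_dtrans: "change_comp p c d v = dtrans c d (chart_map c p) v"
  by (simp add: change_comp_def dtrans_def transition_def)

locale semi_riem =
  fixes A :: "('m::{t2_space,second_countable_topology}, 'e::euclidean_space) chart set"
    and g :: "('m, 'e) metric_field"
  assumes sr: "semi_riemannian A g"
begin

abbreviation "tc \<equiv> tchart A"
abbreviation "gm \<equiv> loc_metric A g"
abbreviation "chr \<equiv> christoffel A g"

lemma atlas: "smooth_atlas A" using sr by (simp add: semi_riemannian_def)

lemma g_bilinear: "bilinear (g p)" and g_sym: "g p v w = g p w v"
  and g_nondegenerate: "nondegenerate_on UNIV (g p)"
  using sr unfolding semi_riemannian_def by blast+

lemma metric_index_eq: "metric_index g = neg_index UNIV (g p)"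
  unfolding metric_index_def using sr unfolding semi_riemannian_def by (intro the_equality) metis+

lemma chart:
  assumes "c \<in> A"
  shows chart_open_dom: "open (chart_dom c)" and chart_open_img: "open (chart_img c)"
    and chart_homeo: "homeomorphism (chart_dom c) (chart_img c) (chart_map c) (chart_inv c)"
  using atlas assms by (auto simp: smooth_atlas_def is_chart_def)

lemma chart_inv_map: "c \<in> A \<Longrightarrow> p \<in> chart_dom c \<Longrightarrow> chart_inv c (chart_map c p) = p"
  using chart_homeo by (metis homeomorphism_apply1)

lemma tchart: "tc p \<in> A" "p \<in> chart_dom (tc p)"
proof -
  have "\<exists>c. c \<in> A \<and> p \<in> chart_dom c" using atlas unfolding smooth_atlas_def by blast
  from someI_ex[OF this] show "tc p \<in> A" "p \<in> chart_dom (tc p)" unfolding tchart_def by blast+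
qed

lemma overlapE:
  assumes "x \<in> overlap c d" "c \<in> A"
  obtains p where "x = chart_map c p" "p \<in> chart_dom c" "p \<in> chart_dom d" "chart_inv c x = p"
    "transition c d x = chart_map d p"
  using assms chart_inv_map[of c] unfolding overlap_def transition_def by auto

lemma overlapI: "p \<in> chart_dom c \<Longrightarrow> p \<in> chart_dom d \<Longrightarrow> chart_map c p \<in> overlap c d"
  by (auto simp: overlap_def)

lemma overlap_img: "overlap c d \<subseteq> chart_img c" by (auto simp: overlap_def)

lemma transition_map: "c \<in> A \<Longrightarrow> p \<in> chart_dom c \<Longrightarrow> transition c d (chart_map c p) = chart_map d p"
  by (simp add: transition_def chart_inv_map)

lemma transition_overlap: "c \<in> A \<Longrightarrow> x \<in> overlap c d \<Longrightarrow> transition c d x \<in> overlap d c"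
  by (elim overlapE) (auto simp: overlap_def)

lemma open_overlap: assumes c: "c \<in> A" and d: "d \<in> A" shows "open (overlap c d)"
proof -
  have "overlap c d = chart_img c \<inter> chart_inv c -` chart_dom d"
    using chart_inv_map[OF c] by (auto simp: overlap_def)
  moreover have "continuous_on (chart_img c) (chart_inv c)" using chart_homeo[OF c] by (simp add: homeomorphism_def)
  ultimately show ?thesis
    using continuous_open_preimage[OF _ chart_open_img[OF c] chart_open_dom[OF d]] by simp
qed

lemma Ck_transition: "c \<in> A \<Longrightarrow> d \<in> A \<Longrightarrow> Ck_on k (overlap c d) (transition c d)"
  using atlas unfolding smooth_atlas_def smooth_on_def overlap_def transition_def by blast

lemma Ck_dtrans: "c \<in> A \<Longrightarrow> d \<in> A \<Longrightarrow> Ck_on k (overlap c d) (\<lambda>x. dtrans c d x v)"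
  unfolding dtrans_def by (rule Ck_on_open_SucD(2)[OF open_overlap Ck_transition])

lemma Ck_htrans: "c \<in> A \<Longrightarrow> d \<in> A \<Longrightarrow> Ck_on k (overlap c d) (\<lambda>x. htrans c d x u v)"
  unfolding htrans_def by (rule Ck_on_open_SucD(2)[OF open_overlap Ck_dtrans])

lemma transition_derivative:
  "c \<in> A \<Longrightarrow> d \<in> A \<Longrightarrow> x \<in> overlap c d \<Longrightarrow> (transition c d has_derivative dtrans c d x) (at x)"
  using Ck_on_open_SucD(1)[OF open_overlap Ck_transition] unfolding dtrans_def by (simp add: eta_contract_eq)

lemma dtrans_derivative:
  "c \<in> A \<Longrightarrow> d \<in> A \<Longrightarrow> x \<in> overlap c d \<Longrightarrow>
    ((\<lambda>y. dtrans c d y v) has_derivative (\<lambda>u. htrans c d x u v)) (at x)"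
  using Ck_on_open_SucD(1)[OF open_overlap Ck_dtrans] unfolding htrans_def by (simp add: eta_contract_eq)

lemma linear_dtrans: "c \<in> A \<Longrightarrow> d \<in> A \<Longrightarrow> x \<in> overlap c d \<Longrightarrow> linear (dtrans c d x)"
  by (rule has_derivative_linear[OF transition_derivative])

lemma bilinear_htrans:
  assumes "c \<in> A" "d \<in> A" "x \<in> overlap c d" shows "bilinear (htrans c d x)"
  unfolding bilinear_def
proof (intro conjI allI)
  show "linear (\<lambda>u. htrans c d x u v)" for v
    by (rule has_derivative_linear[OF dtrans_derivative[OF assms]])
  show "linear (htrans c d x u)" for u
    using linear_derivative_family[OF open_overlap[OF assms(1,2)] assms(3) linear_dtrans[OF assms(1,2)]
        dtrans_derivative[OF assms], of u] by simp
qed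

lemma htrans_sym:
  assumes "c \<in> A" "d \<in> A" "x \<in> overlap c d" shows "htrans c d x u v = htrans c d x v u"
  unfolding htrans_def dtrans_def
  by (rule second_derivative_symmetric[OF open_overlap Ck_transition]) (use assms in auto)

text \<open>Chain rule for the cocycle identity of the transition maps; on
  \<open>overlap c d\<close> that identity holds in a whole neighbourhood of the point.\<close>

lemma dtrans_dtrans:
  assumes A: "c \<in> A" "d \<in> A" "e \<in> A" and p: "p \<in> chart_dom c" "p \<in> chart_dom d" "p \<in> chart_dom e"
  shows "dtrans d e (chart_map d p) (dtrans c d (chart_map c p) v) = dtrans c e (chart_map c p) v"
proof -
  let ?x = "chart_map c p"
  have x: "?x \<in> overlap c d" "?x \<in> overlap c e" "chart_map d p \<in> overlap d e" using p by (auto intro: overlapI)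
  have "((\<lambda>y. transition d e (transition c d y)) has_derivative (\<lambda>v. dtrans d e (transition c d ?x) (dtrans c d ?x v))) (at ?x)"
  proof (rule has_derivative_compose[OF transition_derivative[OF A(1,2) x(1)]])
    show "(transition d e has_derivative dtrans d e (transition c d ?x)) (at (transition c d ?x))"
      unfolding transition_map[OF A(1) p(1)] by (rule transition_derivative[OF A(2,3) x(3)])
  qed
  then have "(transition c e has_derivative (\<lambda>v. dtrans d e (transition c d ?x) (dtrans c d ?x v))) (at ?x)"
  proof (rule has_derivative_transform_within_open)
    show "open (overlap c d)" by (rule open_overlap[OF A(1,2)])
    show "transition d e (transition c d y) = transition c e y" if "y \<in> overlap c d" for y
      using that A by (elim overlapE) (auto simp: transition_def chart_inv_map)
  qed (rule x(1))
  from has_derivative_unique[OF this transition_derivative[OF A(1,3) x(2)]]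
  show ?thesis by (simp add: transition_map[OF A(1) p(1)] fun_eq_iff)
qed

lemma dtrans_id:
  assumes A: "c \<in> A" and p: "p \<in> chart_dom c"
  shows "dtrans c c (chart_map c p) v = v"
proof -
  let ?x = "chart_map c p"
  have x: "?x \<in> overlap c c" using p by (auto intro: overlapI)
  have "((\<lambda>x. x) has_derivative (\<lambda>v. v)) (at ?x)" by (rule has_derivative_ident)
  then have "(transition c c has_derivative (\<lambda>v. v)) (at ?x)"
  proof (rule has_derivative_transform_within_open)
    show "open (overlap c c)" by (rule open_overlap[OF A A])
    show "y = transition c c y" if "y \<in> overlap c c" for y
      using that A by (elim overlapE) (auto simp: transition_def chart_inv_map)
  qed (rule x)
  from has_derivative_unique[OF this transition_derivative[OF A A x]] show ?thesis by metis
qed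

lemma dtrans_inverse:
  assumes A: "c \<in> A" "d \<in> A" and x: "x \<in> overlap c d"
  shows "dtrans d c (transition c d x) (dtrans c d x v) = v"
proof -
  obtain p where p: "x = chart_map c p" "p \<in> chart_dom c" "p \<in> chart_dom d" "transition c d x = chart_map d p"
    using overlapE[OF x A(1)] by metis
  show ?thesis unfolding p(4) unfolding p(1) dtrans_dtrans[OF A A(1) p(2,3,2)] by (rule dtrans_id[OF A(1) p(2)])
qed

lemma transition_transition: "c \<in> A \<Longrightarrow> d \<in> A \<Longrightarrow> x \<in> overlap c d \<Longrightarrow> transition d c (transition c d x) = x"
  by (elim overlapE) (auto simp: transition_map)

lemma dtrans_inverse':
  assumes A: "c \<in> A" "d \<in> A" and x: "x \<in> overlap c d"
  shows "dtrans c d x (dtrans d c (transition c d x) v) = v"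
  using dtrans_inverse[OF A(2,1) transition_overlap[OF A(1) x], of v] transition_transition[OF A x] by simp

lemma gm_eq:
  assumes "c \<in> A" "p \<in> chart_dom c"
  shows "gm c (chart_map c p) v w = g p (dtrans c (tc p) (chart_map c p) v) (dtrans c (tc p) (chart_map c p) w)"
  by (simp add: loc_metric_def Let_def chart_inv_map[OF assms] change_comp_dtrans)

lemma gm_trans:
  assumes A: "c \<in> A" "d \<in> A" and x: "x \<in> overlap c d"
  shows "gm c x v w = gm d (transition c d x) (dtrans c d x v) (dtrans c d x w)"
proof -
  obtain p where p: "x = chart_map c p" "p \<in> chart_dom c" "p \<in> chart_dom d" "transition c d x = chart_map d p"
    using overlapE[OF x A(1)] by metis
  show ?thesis unfolding p(4) unfolding p(1) gm_eq[OF A(1) p(2)] gm_eq[OF A(2) p(3)]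
    by (simp add: dtrans_dtrans[OF A tchart(1) p(2,3) tchart(2)])
qed

lemma gm_props:
  assumes c: "c \<in> A" and x: "x \<in> chart_img c"
  shows gm_bilinear: "bilinear (gm c x)" and gm_sym: "gm c x v w = gm c x w v"
    and gm_nondegenerate: "nondegenerate_on UNIV (gm c x)"
proof -
  obtain p where p: "x = chart_map c p" "p \<in> chart_dom c" using x by auto
  let ?L = "dtrans c (tc p) x"
  have xo: "x \<in> overlap c (tc p)" unfolding p(1) by (rule overlapI[OF p(2) tchart(2)])
  have G: "gm c x v w = g p (?L v) (?L w)" for v w using gm_eq[OF c p(2)] p(1) by simp
  have lin: "linear ?L" by (rule linear_dtrans[OF c tchart(1) xo])
  note s = linear_add[OF lin] linear_cmul[OF lin] bilinear_ladd[OF g_bilinear] bilinear_radd[OF g_bilinear]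
    bilinear_lmul[OF g_bilinear] bilinear_rmul[OF g_bilinear]
  show "bilinear (gm c x)" unfolding bilinear_def linear_iff G by (simp add: s)
  show "gm c x v w = gm c x w v" unfolding G by (rule g_sym)
  show "nondegenerate_on UNIV (gm c x)" unfolding nondegenerate_on_def
  proof (intro ballI impI)
    fix v assume v: "\<forall>w\<in>UNIV. gm c x v w = 0"
    have "g p (?L v) w = 0" for w
      using v dtrans_inverse'[OF c tchart(1) xo, of w] unfolding G by (metis UNIV_I)
    then have "?L v = 0" using g_nondegenerate[of p] by (auto simp: nondegenerate_on_def)
    then show "v = 0" using dtrans_inverse[OF c tchart(1) xo, of v]
        linear_0[OF linear_dtrans[OF tchart(1) c transition_overlap[OF c xo]]] by simp
  qed
qed

lemma Ck_gm: "c \<in> A \<Longrightarrow> Ck_on k (chart_img c) (\<lambda>x. gm c x v w)"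
  using sr unfolding semi_riemannian_def smooth_on_def by blast

section \<open>Christoffel maps in a chart\<close>

definition dgm :: "('m, 'e) chart \<Rightarrow> 'e \<Rightarrow> 'e \<Rightarrow> 'e \<Rightarrow> 'e \<Rightarrow> real" where
  "dgm c x u v w = frechet_derivative (\<lambda>y. gm c y v w) (at x) u"

lemma Ck_dgm: "c \<in> A \<Longrightarrow> Ck_on k (chart_img c) (\<lambda>x. dgm c x u v w)"
  unfolding dgm_def by (rule Ck_on_open_SucD(2)[OF chart_open_img Ck_gm])

lemma gm_derivative:
  "c \<in> A \<Longrightarrow> x \<in> chart_img c \<Longrightarrow> ((\<lambda>y. gm c y v w) has_derivative (\<lambda>u. dgm c x u v w)) (at x)"
  using Ck_on_open_SucD(1)[OF chart_open_img Ck_gm] unfolding dgm_def by (simp add: eta_contract_eq)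

lemma dgm_props:
  assumes c: "c \<in> A" and x: "x \<in> chart_img c"
  shows "linear (\<lambda>u. dgm c x u v w)" "bilinear (dgm c x u)" "dgm c x u v w = dgm c x u w v"
proof -
  show "linear (\<lambda>u. dgm c x u v w)" by (rule has_derivative_linear[OF gm_derivative[OF assms]])
  show "bilinear (dgm c x u)"
    using bilinear_derivative_family[OF chart_open_img[OF c] x gm_bilinear[OF c] gm_derivative[OF assms], of u] by simp
  have "((\<lambda>y. gm c y v w) has_derivative (\<lambda>u. dgm c x u w v)) (at x)"
    by (rule has_derivative_transform_within_open[OF gm_derivative[OF assms] chart_open_img[OF c] x]) (rule gm_sym[OF c])
  from has_derivative_unique[OF gm_derivative[OF assms] this] show "dgm c x u v w = dgm c x u w v" by metis
qed

text \<open>The Koszul formula determines all pairings of a candidate with vectors, and the metric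
  is nondegenerate. Besides resolving the \<open>THE\<close>, this allows laws for
  \<open>chr\<close> to be proved by exhibiting a candidate.\<close>

lemma chr_unique:
  assumes c: "c \<in> A" and x: "x \<in> chart_img c"
    and "bilinear \<Gamma>" "\<And>u v. \<Gamma> u v = \<Gamma> v u"
    and "\<And>u v w. dgm c x u v w = gm c x (\<Gamma> u v) w + gm c x v (\<Gamma> u w)"
  shows "chr c x = \<Gamma>"
  unfolding christoffel_def dgm_def[symmetric]
proof (rule the_equality)
  fix \<Gamma>' assume G': "bilinear \<Gamma>' \<and> (\<forall>u v. \<Gamma>' u v = \<Gamma>' v u) \<and>
    (\<forall>u v w. dgm c x u v w = gm c x (\<Gamma>' u v) w + gm c x v (\<Gamma>' u w))"
  show "\<Gamma>' = \<Gamma>"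
  proof (intro ext)
    fix u v
    have "gm c x (\<Gamma>' u v) w = gm c x (\<Gamma> u v) w" for w
      using koszul[where G = "gm c x" and D = "dgm c x" and \<Gamma> = \<Gamma>', OF gm_sym[OF c x], of u v w] G'
        koszul[where G = "gm c x" and D = "dgm c x" and \<Gamma> = \<Gamma>, OF gm_sym[OF c x] assms(4,5), of u v w] by simp
    then have "gm c x (\<Gamma>' u v - \<Gamma> u v) w = 0" for w by (simp add: bilinear_lsub[OF gm_bilinear[OF c x]])
    then have "\<Gamma>' u v - \<Gamma> u v = 0" using gm_nondegenerate[OF c x] unfolding nondegenerate_on_def by blast
    then show "\<Gamma>' u v = \<Gamma> u v" by simp
  qed
qed (use assms in auto)

lemma chr_props:
  assumes c: "c \<in> A" and x: "x \<in> chart_img c"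
  shows chr_bilinear: "bilinear (chr c x)" and chr_sym: "chr c x u v = chr c x v u"
    and chr_compat: "dgm c x u v w = gm c x (chr c x u v) w + gm c x v (chr c x u w)"
proof -
  obtain \<Gamma> where \<Gamma>: "bilinear \<Gamma>" "\<And>u v. \<Gamma> u v = \<Gamma> v u"
    "\<And>u v w. dgm c x u v w = gm c x (\<Gamma> u v) w + gm c x v (\<Gamma> u w)"
    using levi_civita_exists[where G = "gm c x" and D = "dgm c x", OF gm_props[OF assms] dgm_props[OF assms]] by blast
  have "chr c x = \<Gamma>" by (rule chr_unique[OF assms \<Gamma>])
  then show "bilinear (chr c x)" "chr c x u v = chr c x v u"
    "dgm c x u v w = gm c x (chr c x u v) w + gm c x v (chr c x u w)" using \<Gamma> by simp_all
qed

lemma Ck_chr: assumes c: "c \<in> A" shows "Ck_on k (chart_img c) (\<lambda>x. chr c x u v)"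
proof -
  \<comment> \<open>\<open>L x z\<close> lists the pairings of \<open>z\<close> with the basis
    vectors. The Koszul formula then makes the Christoffel map the solution of an injective linear
    system with smooth coefficients.\<close>
  define L where "L x z = (\<Sum>b\<in>Basis. gm c x z b *\<^sub>R b)" for x z
  have S: "unique_deriv_set (chart_img c)" by (rule unique_deriv_set_open[OF chart_open_img[OF c]])
  have Lb: "L x z \<bullet> b = gm c x z b" if "b \<in> Basis" for x z b
    using that by (simp add: L_def inner_sum_left_Basis)
  have lin: "linear (L x)" if x: "x \<in> chart_img c" for x
    unfolding L_def by (rule linearI) (simp_all add: bilinear_ladd[OF gm_bilinear[OF c x]] scaleR_add_left
        sum.distrib bilinear_lmul[OF gm_bilinear[OF c x]] scaleR_sum_right)
  have inj: "inj (L x)" if x: "x \<in> chart_img c" for x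
  proof (rule linear_injective_0[OF lin[OF x], THEN iffD2], intro allI impI)
    fix v assume "L x v = 0"
    then have b: "gm c x v b = 0" if "b \<in> Basis" for b using Lb[OF that, of x v] by simp
    have lv: "linear (gm c x v)" using gm_bilinear[OF c x] by (simp add: bilinear_def)
    have "gm c x v w = 0" for w unfolding linear_basis_expand[OF lv, of w] by (simp add: b)
    then show "v = 0" using gm_nondegenerate[OF c x] by (auto simp: nondegenerate_on_def)
  qed
  have *: "Ck_on k (chart_img c) (\<lambda>x. \<Sum>b\<in>Basis. f x b *\<^sub>R b)" if "\<And>b. Ck_on k (chart_img c) (\<lambda>x. f x b)" for f :: "'e \<Rightarrow> 'e \<Rightarrow> real"
    by (intro Ck_on_sum[OF S] Ck_on_scaleR[OF S] Ck_on_const[OF S] that finite_Basis)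
  show ?thesis
  proof (rule Ck_on_solution[where L = L, OF S lin inj])
    show "Ck_on k (chart_img c) (\<lambda>y. L y b)" for b unfolding L_def by (rule *) (rule Ck_gm[OF c])
    show "Ck_on k (chart_img c) (\<lambda>x. \<Sum>b\<in>Basis. ((1/2) *\<^sub>R (dgm c x u v b + dgm c x v u b - dgm c x b u v)) *\<^sub>R b)"
      by (rule *) (intro Ck_on_scaleR[OF S] Ck_on_const[OF S] Ck_on_diff[OF S] Ck_on_add[OF S] Ck_dgm[OF c])
    show "L y (chr c y u v) = (\<Sum>b\<in>Basis. ((1/2) *\<^sub>R (dgm c y u v b + dgm c y v u b - dgm c y b u v)) *\<^sub>R b)"
      if y: "y \<in> chart_img c" for y
      unfolding L_def koszul[where \<Gamma> = "chr c y" and D = "dgm c y", OF gm_sym[OF c y] chr_sym[OF c y] chr_compat[OF c y]] by simp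
  qed
qed

text \<open>The law is solved for the Christoffel map in \<open>c\<close>, and the result is checked
  against its characterization: symmetry comes from that of \<open>htrans\<close>, compatibility
  from differentiating \<open>gm_trans\<close>.\<close>

lemma chr_trans:
  assumes A: "c \<in> A" "d \<in> A" and x: "x \<in> overlap c d"
  shows "dtrans c d x (chr c x u v) = htrans c d x u v + chr d (transition c d x) (dtrans c d x u) (dtrans c d x v)"
proof -
  let ?y = "transition c d x"
  have xc: "x \<in> chart_img c" by (rule subsetD[OF overlap_img x])
  have yo: "?y \<in> overlap d c" by (rule transition_overlap[OF A(1) x])
  have yd: "?y \<in> chart_img d" by (rule subsetD[OF overlap_img yo])
  have L: "linear (dtrans c d x)" by (rule linear_dtrans[OF A x])
  have Li: "linear (dtrans d c ?y)" by (rule linear_dtrans[OF A(2,1) yo])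
  define \<Gamma> where "\<Gamma> u v = dtrans d c ?y (htrans c d x u v + chr d ?y (dtrans c d x u) (dtrans c d x v))" for u v
  have L\<Gamma>: "dtrans c d x (\<Gamma> u v) = htrans c d x u v + chr d ?y (dtrans c d x u) (dtrans c d x v)" for u v
    unfolding \<Gamma>_def by (rule dtrans_inverse'[OF A x])
  have "chr c x = \<Gamma>"
  proof (rule chr_unique[OF A(1) xc])
    note s = linear_add[OF L] linear_cmul[OF L] linear_add[OF Li] linear_cmul[OF Li]
      bilinear_ladd[OF chr_bilinear[OF A(2) yd]] bilinear_radd[OF chr_bilinear[OF A(2) yd]]
      bilinear_lmul[OF chr_bilinear[OF A(2) yd]] bilinear_rmul[OF chr_bilinear[OF A(2) yd]]
      bilinear_ladd[OF bilinear_htrans[OF A x]] bilinear_radd[OF bilinear_htrans[OF A x]]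
      bilinear_lmul[OF bilinear_htrans[OF A x]] bilinear_rmul[OF bilinear_htrans[OF A x]]
    show "bilinear \<Gamma>" unfolding bilinear_def linear_iff \<Gamma>_def by (simp add: s scaleR_add_right)
    show "\<Gamma> u v = \<Gamma> v u" for u v
      unfolding \<Gamma>_def by (simp add: htrans_sym[OF A x, of u v] chr_sym[OF A(2) yd, of "dtrans c d x u"])
    fix u v w
    let ?L = "dtrans c d x"
    let ?D = "\<lambda>u. gm d ?y (?L v) (htrans c d x u w) + (gm d ?y (htrans c d x u v) (?L w) + dgm d ?y (?L u) (?L v) (?L w))"
    have dG: "((\<lambda>y. gm d (transition c d y) a b) has_derivative (\<lambda>u. dgm d ?y (?L u) a b)) (at x)" for a b
      by (rule has_derivative_compose[OF transition_derivative[OF A x] gm_derivative[OF A(2) yd]])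
    have bil: "bilinear (gm d (transition c d y))" if "y \<in> overlap c d" for y
      by (rule gm_bilinear[OF A(2) subsetD[OF overlap_img transition_overlap[OF A(1) that]]])
    have "((\<lambda>y. gm d (transition c d y) (dtrans c d y v) (dtrans c d y w)) has_derivative ?D) (at x)"
      by (rule has_derivative_apply2_at[where B = "\<lambda>y. gm d (transition c d y)", OF open_overlap[OF A] x bil dG
            dtrans_derivative[OF A x] dtrans_derivative[OF A x]])
    then have "((\<lambda>y. gm c y v w) has_derivative ?D) (at x)"
      by (rule has_derivative_transform_within_open[OF _ open_overlap[OF A] x]) (simp add: gm_trans[OF A])
    from has_derivative_unique[OF gm_derivative[OF A(1) xc] this]
    have "dgm c x u v w = ?D u" by metis
    also have "\<dots> = gm d ?y (?L (\<Gamma> u v)) (?L w) + gm d ?y (?L v) (?L (\<Gamma> u w))"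
      unfolding L\<Gamma> chr_compat[OF A(2) yd]
      by (simp add: bilinear_ladd[OF gm_bilinear[OF A(2) yd]] bilinear_radd[OF gm_bilinear[OF A(2) yd]])
    also have "\<dots> = gm c x (\<Gamma> u v) w + gm c x v (\<Gamma> u w)" by (simp add: gm_trans[OF A x])
    finally show "dgm c x u v w = gm c x (\<Gamma> u v) w + gm c x v (\<Gamma> u w)" .
  qed
  then show ?thesis using L\<Gamma> by simp
qed

section \<open>Curvature in a chart: transformation law and symmetries\<close>

definition dchr :: "('m, 'e) chart \<Rightarrow> 'e \<Rightarrow> 'e \<Rightarrow> 'e \<Rightarrow> 'e \<Rightarrow> 'e" where
  "dchr c x u v w = frechet_derivative (\<lambda>y. chr c y v w) (at x) u"

definition curv :: "('m, 'e) chart \<Rightarrow> 'e \<Rightarrow> 'e \<Rightarrow> 'e \<Rightarrow> 'e \<Rightarrow> 'e" where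
  "curv c x u v w = dchr c x u v w - dchr c x v u w + chr c x u (chr c x v w) - chr c x v (chr c x u w)"

lemma Ck_dchr: "c \<in> A \<Longrightarrow> Ck_on k (chart_img c) (\<lambda>x. dchr c x u v w)"
  unfolding dchr_def by (rule Ck_on_open_SucD(2)[OF chart_open_img Ck_chr])

lemma chr_derivative:
  "c \<in> A \<Longrightarrow> x \<in> chart_img c \<Longrightarrow> ((\<lambda>y. chr c y v w) has_derivative (\<lambda>u. dchr c x u v w)) (at x)"
  using Ck_on_open_SucD(1)[OF chart_open_img Ck_chr] unfolding dchr_def by (simp add: eta_contract_eq)

lemma linear_chr:
  assumes c: "c \<in> A" and x: "x \<in> chart_img c"
  shows "linear (chr c x u)" "linear (\<lambda>u. chr c x u v)"
  using chr_bilinear[OF c x] by (auto simp: bilinear_def)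

lemma dchr_props:
  assumes c: "c \<in> A" and x: "x \<in> chart_img c"
  shows "linear (\<lambda>u. dchr c x u v w)" "bilinear (dchr c x u)" "dchr c x u v w = dchr c x u w v"
proof -
  show "linear (\<lambda>u. dchr c x u v w)" by (rule has_derivative_linear[OF chr_derivative[OF assms]])
  show "bilinear (dchr c x u)"
    using bilinear_derivative_family[OF chart_open_img[OF c] x chr_bilinear[OF c] chr_derivative[OF assms], of u] by simp
  have "((\<lambda>y. chr c y v w) has_derivative (\<lambda>u. dchr c x u w v)) (at x)"
    by (rule has_derivative_transform_within_open[OF chr_derivative[OF assms] chart_open_img[OF c] x]) (rule chr_sym[OF c])
  from has_derivative_unique[OF chr_derivative[OF assms] this] show "dchr c x u v w = dchr c x u w v" by metis
qed

text \<open>Vector fields with constant components commute and have zero derivative, so only the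
  coordinate expression in the Christoffel maps survives.\<close>

lemma curvature_eq: "curvature A g p u v w = curv (tc p) (chart_map (tc p) p) u v w"
proof -
  let ?c = "tc p" and ?x = "chart_map (tc p) p"
  have x: "?x \<in> chart_img ?c" using tchart(2) by simp
  have n: "loc_nabla A g ?c (\<lambda>_. u) (\<lambda>_. w) = (\<lambda>y. chr ?c y u w)" for u w
    by (simp add: loc_nabla_def fun_eq_iff)
  have l: "lie_bracket (\<lambda>_. u) (\<lambda>_. v) = (\<lambda>_. 0 :: 'e)" for u v :: 'e
    by (simp add: lie_bracket_def fun_eq_iff)
  have z: "chr ?c ?x 0 w = 0" using bilinear_lzero[OF chr_bilinear[OF tchart(1) x]] by simp
  show ?thesis unfolding curvature_def loc_curvature_def n l
    by (simp add: loc_nabla_def dchr_def curv_def z)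
qed

lemma curv_linear:
  assumes c: "c \<in> A" and x: "x \<in> chart_img c"
  shows "linear (curv c x u v)" "linear (\<lambda>v. curv c x u v w)" "linear (\<lambda>u. curv c x u v w)"
proof -
  note s = bilinear_ladd[OF chr_bilinear[OF c x]] bilinear_radd[OF chr_bilinear[OF c x]]
    bilinear_lmul[OF chr_bilinear[OF c x]] bilinear_rmul[OF chr_bilinear[OF c x]]
    bilinear_ladd[OF dchr_props(2)[OF c x]] bilinear_radd[OF dchr_props(2)[OF c x]]
    bilinear_lmul[OF dchr_props(2)[OF c x]] bilinear_rmul[OF dchr_props(2)[OF c x]]
    linear_add[OF dchr_props(1)[OF c x]] linear_cmul[OF dchr_props(1)[OF c x]]
  show "linear (curv c x u v)" "linear (\<lambda>v. curv c x u v w)" "linear (\<lambda>u. curv c x u v w)"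
    by (rule linearI; simp add: curv_def s scaleR_add_right scaleR_diff_right)+
qed

lemma Ck_curv: assumes c: "c \<in> A" shows "Ck_on k (chart_img c) (\<lambda>x. curv c x u v w)"
proof -
  have S: "unique_deriv_set (chart_img c)" by (rule unique_deriv_set_open[OF chart_open_img[OF c]])
  have *: "Ck_on k (chart_img c) (\<lambda>x. chr c x u (chr c x v w))" for u v w
    by (rule Ck_on_apply[OF S linear_chr(1)[OF c] Ck_chr[OF c] Ck_chr[OF c]])
  show ?thesis unfolding curv_def by (intro Ck_on_diff[OF S] Ck_on_add[OF S] Ck_dchr[OF c] *)
qed

text \<open>Differentiate the transformation law of the Christoffel maps and antisymmetrize: the third
  derivative of the transition map drops out.\<close>

lemma curv_trans:
  assumes A: "c \<in> A" "d \<in> A" and x: "x \<in> overlap c d"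
  shows "dtrans c d x (curv c x u v w) = curv d (transition c d x) (dtrans c d x u) (dtrans c d x v) (dtrans c d x w)"
proof -
  let ?y = "transition c d x" and ?L = "dtrans c d x" and ?H = "htrans c d x"
  have xc: "x \<in> chart_img c" by (rule subsetD[OF overlap_img x])
  have yd: "?y \<in> chart_img d" by (rule subsetD[OF overlap_img transition_overlap[OF A(1) x]])
  define T where "T u v w = frechet_derivative (\<lambda>y. htrans c d y v w) (at x) u" for u v w
  have Tder: "((\<lambda>y. htrans c d y v w) has_derivative (\<lambda>u. T u v w)) (at x)" for v w
    using Ck_on_open_SucD(1)[OF open_overlap[OF A] Ck_htrans[OF A] x] unfolding T_def by (simp add: eta_contract_eq)
  have Tsym: "T u v w = T v u w" for u v w
    unfolding T_def htrans_def by (rule second_derivative_symmetric[OF open_overlap[OF A] Ck_dtrans[OF A] x])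
  have L: "linear ?L" by (rule linear_dtrans[OF A x])
  have key: "?H u (chr c x v w) + ?L (dchr c x u v w)
    = T u v w + (chr d ?y (?L v) (?H u w) + (chr d ?y (?H u v) (?L w) + dchr d ?y (?L u) (?L v) (?L w)))" for u v w
  proof -
    have Hl: "linear (\<lambda>b. ?H e b)" for e using bilinear_htrans[OF A x] by (simp add: bilinear_def)
    have 1: "((\<lambda>y. dtrans c d y (chr c y v w)) has_derivative (\<lambda>u. ?L (dchr c x u v w) + ?H u (chr c x v w))) (at x)"
      by (rule has_derivative_apply_at[where L = "dtrans c d" and L' = "\<lambda>b u. ?H u b", OF open_overlap[OF A] x
            linear_dtrans[OF A] dtrans_derivative[OF A x] Hl chr_derivative[OF A(1) xc]])
    have d\<Gamma>: "((\<lambda>y. chr d (transition c d y) a b) has_derivative (\<lambda>u. dchr d ?y (?L u) a b)) (at x)" for a b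
      by (rule has_derivative_compose[OF transition_derivative[OF A x] chr_derivative[OF A(2) yd]])
    have bil: "bilinear (chr d (transition c d y))" if "y \<in> overlap c d" for y
      by (rule chr_bilinear[OF A(2) subsetD[OF overlap_img transition_overlap[OF A(1) that]]])
    have "((\<lambda>y. chr d (transition c d y) (dtrans c d y v) (dtrans c d y w)) has_derivative
        (\<lambda>u. chr d ?y (?L v) (?H u w) + (chr d ?y (?H u v) (?L w) + dchr d ?y (?L u) (?L v) (?L w)))) (at x)"
      by (rule has_derivative_apply2_at[where B = "\<lambda>y. chr d (transition c d y)", OF open_overlap[OF A] x bil d\<Gamma>
            dtrans_derivative[OF A x] dtrans_derivative[OF A x]])
    from has_derivative_add[OF Tder[of v w] this]
    have 2: "((\<lambda>y. dtrans c d y (chr c y v w)) has_derivative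
        (\<lambda>u. T u v w + (chr d ?y (?L v) (?H u w) + (chr d ?y (?H u v) (?L w) + dchr d ?y (?L u) (?L v) (?L w))))) (at x)"
      by (rule has_derivative_transform_within_open[OF _ open_overlap[OF A] x]) (simp add: chr_trans[OF A])
    from has_derivative_unique[OF 1 2] show ?thesis by (simp add: fun_eq_iff add.commute)
  qed
  have chrL: "?L (chr c x a b) = ?H a b + chr d ?y (?L a) (?L b)" for a b by (rule chr_trans[OF A x])
  have Hs: "?H u v = ?H v u" by (rule htrans_sym[OF A x])
  note s = linear_add[OF L] linear_diff[OF L] bilinear_radd[OF chr_bilinear[OF A(2) yd]]
  have "?L (curv c x u v w) = ?L (dchr c x u v w) - ?L (dchr c x v u w)
      + (?H u (chr c x v w) + chr d ?y (?L u) (?H v w + chr d ?y (?L v) (?L w)))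
      - (?H v (chr c x u w) + chr d ?y (?L v) (?H u w + chr d ?y (?L u) (?L w)))"
    unfolding curv_def s(1,2) chrL ..
  also have "\<dots> = (?H u (chr c x v w) + ?L (dchr c x u v w)) - (?H v (chr c x u w) + ?L (dchr c x v u w))
      + chr d ?y (?L u) (?H v w) - chr d ?y (?L v) (?H u w)
      + chr d ?y (?L u) (chr d ?y (?L v) (?L w)) - chr d ?y (?L v) (chr d ?y (?L u) (?L w))"
    unfolding s(3) by (simp add: algebra_simps)
  also have "\<dots> = curv d ?y (?L u) (?L v) (?L w)"
    unfolding key curv_def Tsym[of v u] Hs by (simp add: algebra_simps)
  finally show ?thesis .
qed

lemma curv_antisym: "curv c x v u w = - curv c x u v w"
  by (simp add: curv_def)

text \<open>Symmetry of the Christoffel maps passes to their derivatives; the six derivative terms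
  and the six quadratic terms then cancel in pairs.\<close>

lemma curv_bianchi:
  assumes c: "c \<in> A" and x: "x \<in> chart_img c"
  shows "curv c x u v w + curv c x v w u + curv c x w u v = 0"
  unfolding curv_def
  using dchr_props(3)[OF c x, of u v w] dchr_props(3)[OF c x, of v w u] dchr_props(3)[OF c x, of w u v]
    chr_sym[OF c x, of u v] chr_sym[OF c x, of v w] chr_sym[OF c x, of w u]
  by simp

text \<open>Second derivatives of the metric coefficients commute. Expanded by metric compatibility,
  their antisymmetric part is exactly the sum of the two curvature pairings.\<close>

lemma curv_skew:
  assumes c: "c \<in> A" and x: "x \<in> chart_img c"
  shows "gm c x (curv c x u v w) z = - gm c x w (curv c x u v z)"
proof -
  note gs = bilinear_ladd[OF gm_bilinear[OF c x]] bilinear_radd[OF gm_bilinear[OF c x]]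
    bilinear_lsub[OF gm_bilinear[OF c x]] bilinear_rsub[OF gm_bilinear[OF c x]]
  let ?G = "gm c x" and ?\<Gamma> = "chr c x"
  define T where "T u v w z = frechet_derivative (\<lambda>y. dgm c y v w z) (at x) u" for u v w z
  have Tder: "((\<lambda>y. dgm c y v w z) has_derivative (\<lambda>u. T u v w z)) (at x)" for v w z
    using Ck_on_open_SucD(1)[OF chart_open_img[OF c] Ck_dgm[OF c] x] unfolding T_def by (simp add: eta_contract_eq)
  have Tsym: "T u v w z = T v u w z" for u v w z
    unfolding T_def dgm_def by (rule second_derivative_symmetric[OF chart_open_img[OF c] Ck_gm[OF c] x])
  have key: "T u v w z = ?G (?\<Gamma> v w) (?\<Gamma> u z) + ?G (?\<Gamma> u (?\<Gamma> v w)) z + ?G (dchr c x u v w) z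
     + (?G (?\<Gamma> u w) (?\<Gamma> v z) + ?G w (?\<Gamma> u (?\<Gamma> v z)) + ?G w (dchr c x u v z))" for u v
  proof -
    have zero: "?G a 0 = 0" "?G 0 a = 0" for a
      using bilinear_rzero[OF gm_bilinear[OF c x]] bilinear_lzero[OF gm_bilinear[OF c x]] by auto
    have 1: "((\<lambda>y. gm c y (chr c y v w) z) has_derivative
        (\<lambda>u. ?G (?\<Gamma> v w) 0 + (?G (dchr c x u v w) z + dgm c x u (?\<Gamma> v w) z))) (at x)"
      by (rule has_derivative_apply2_at[where B = "gm c", OF chart_open_img[OF c] x gm_bilinear[OF c] gm_derivative[OF c x]
            chr_derivative[OF c x] has_derivative_const])
    have 2: "((\<lambda>y. gm c y w (chr c y v z)) has_derivative
        (\<lambda>u. ?G w (dchr c x u v z) + (?G 0 (?\<Gamma> v z) + dgm c x u w (?\<Gamma> v z)))) (at x)"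
      by (rule has_derivative_apply2_at[where B = "gm c", OF chart_open_img[OF c] x gm_bilinear[OF c] gm_derivative[OF c x]
            has_derivative_const chr_derivative[OF c x]])
    have "((\<lambda>y. dgm c y v w z) has_derivative (\<lambda>u. (?G (?\<Gamma> v w) 0 + (?G (dchr c x u v w) z + dgm c x u (?\<Gamma> v w) z))
        + (?G w (dchr c x u v z) + (?G 0 (?\<Gamma> v z) + dgm c x u w (?\<Gamma> v z))))) (at x)"
      by (rule has_derivative_transform_within_open[OF has_derivative_add[OF 1 2] chart_open_img[OF c] x])
        (simp add: chr_compat[OF c])
    from has_derivative_unique[OF Tder this] show ?thesis
      by (simp add: fun_eq_iff zero chr_compat[OF c x])
  qed
  have "?G (curv c x u v w) z + ?G w (curv c x u v z) = T u v w z - T v u w z"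
    unfolding key curv_def gs by simp
  then show ?thesis using Tsym[of u v] by simp
qed

text \<open>The instance of pair symmetry behind self-adjointness of the operator in the Jacobi
  equation. It is a linear consequence of the two antisymmetries and the Bianchi identity.\<close>

lemma curv_selfadjoint:
  assumes c: "c \<in> A" and x: "x \<in> chart_img c"
  shows "gm c x (curv c x u v u) w = gm c x v (curv c x u w u)"
proof -
  define \<rho> where "\<rho> a b c' d = gm c x (curv c x a b c') d" for a b c' d
  note gs = bilinear_ladd[OF gm_bilinear[OF c x]] bilinear_lneg[OF gm_bilinear[OF c x]] bilinear_lzero[OF gm_bilinear[OF c x]]
  have a1: "\<rho> b a c' d = - \<rho> a b c' d" for a b c' d
    unfolding \<rho>_def curv_antisym[of c x b a] gs by (rule refl)
  have a2: "\<rho> a b c' d = - \<rho> a b d c'" for a b c' d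
    unfolding \<rho>_def using curv_skew[OF c x, of a b c' d] gm_sym[OF c x, of c' "curv c x a b d"] by simp
  have b: "\<rho> a b c' d + \<rho> b c' a d + \<rho> c' a b d = 0" for a b c' d
    unfolding \<rho>_def gs[symmetric] curv_bianchi[OF c x] by (rule gs)
  have "\<rho> u v u w = \<rho> u w u v"
    using b[of u v u w] b[of v u w u] b[of u w v u] b[of w u u v] b[of u u v w] b[of v w u u]
      a1[of u v u w] a1[of u w u v] a1[of v u w u] a1[of v w u u] a2[of v w u u] a1[of u u v w] a1[of u u w v]
      a2[of u v u w] a2[of u w u v] a2[of v u w u] a2[of u v w u] a2[of u w v u] a1[of v u u w] a1[of w u u v]
      a2[of v u u w] a2[of w u u v] a2[of w u v u]
    by linarith
  then show ?thesis unfolding \<rho>_def using gm_sym[OF c x, of v "curv c x u w u"] by simp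
qed

end

section \<open>Covariant derivatives along a curve\<close>

lemma has_vector_derivative_chain:
  assumes "(x has_vector_derivative x') (at t within T)" "(f has_derivative f') (at (x t))"
  shows "((\<lambda>s. f (x s)) has_vector_derivative f' x') (at t within T)"
  using has_derivative_compose[OF assms(1)[unfolded has_vector_derivative_def] assms(2)]
    linear_cmul[OF has_derivative_linear[OF assms(2)]]
  by (simp add: has_vector_derivative_def)

lemma has_vector_derivative_apply2:
  fixes B :: "real \<Rightarrow> 'b::euclidean_space \<Rightarrow> 'b2::euclidean_space \<Rightarrow> 'c::real_normed_vector"
  assumes bil: "\<And>y. y \<in> S \<Longrightarrow> bilinear (B y)" and x: "x \<in> S"
    and B: "\<And>u v. ((\<lambda>y. B y u v) has_vector_derivative B' u v) (at x within S)" and B': "bilinear B'"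
    and U: "(U has_vector_derivative U') (at x within S)" and V: "(V has_vector_derivative V') (at x within S)"
  shows "((\<lambda>y. B y (U y) (V y)) has_vector_derivative
      B x (U x) V' + (B x U' (V x) + B' (U x) (V x))) (at x within S)"
proof -
  have lin: "linear (B y u)" "linear (\<lambda>u. B y u v)" if "y \<in> S" for y u v
    using bil[OF that] by (auto simp: bilinear_def)
  have lin': "linear (B' u)" "linear (\<lambda>u. B' u v)" for u v using B' by (auto simp: bilinear_def)
  have 1: "((\<lambda>y. B y (U y) v) has_vector_derivative B x U' v + B' (U x) v) (at x within S)" for v
    by (rule has_vector_derivative_apply[where L = "\<lambda>y u. B y u v", OF lin(2) x B lin'(2) U])
  show ?thesis
    by (rule has_vector_derivative_apply[where L = "\<lambda>y v. B y (U y) v", OF lin(1) x 1 _ V])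
      (assumption, intro linear_compose_add lin(1)[OF x] lin'(1))
qed

text \<open>By continuity the two sets agree near \<open>t\<close>. Derivatives within the interval
  may thus be computed on the part of it that a chart covers, where the smoothness assumptions are
  stated.\<close>

lemma at_within_preimage:
  assumes "continuous_on T \<gamma>" "open U" "t \<in> T" "\<gamma> t \<in> U"
  shows "at t within {s\<in>T. \<gamma> s \<in> U} = at t within T"
proof -
  obtain W where W: "open W" "W \<inter> T = \<gamma> -` U \<inter> T"
    using assms(1,2) unfolding continuous_on_open_invariant by blast
  show ?thesis by (rule at_within_nhd[of t W]) (use W assms in auto)
qed

lemma Ck_on_Pair:
  assumes S: "unique_deriv_set S" and f: "Ck_on k S f" and g: "Ck_on k S g"
  shows "Ck_on k S (\<lambda>x. (f x, g x))"
proof -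
  have "Ck_on k S (\<lambda>x. (f x, 0) + (0, g x))"
    by (intro Ck_on_add[OF S] Ck_on_linear[OF _ S f] Ck_on_linear[OF _ S g] linearI) auto
  then show ?thesis by simp
qed

lemma Ck_on_vector_derivative:
  assumes S: "unique_deriv_set S" and f: "Ck_on (Suc k) S f"
    and f': "\<And>t. t \<in> S \<Longrightarrow> (f has_vector_derivative f' t) (at t within S)"
  shows "Ck_on k S f'"
proof -
  have "frechet_derivative f (at t within S) 1 = f' t" if "t \<in> S" for t
    using frechet_derivative_within_eq[OF S that f'[OF that, unfolded has_vector_derivative_def]] by simp
  then have "Ck_on k S (\<lambda>t. frechet_derivative f (at t within S) 1) \<longleftrightarrow> Ck_on k S f'" by (rule Ck_on_cong)
  then show ?thesis using Ck_on_SucD(2)[OF f] by blast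
qed

locale arc = semi_riem A g
  for A :: "('m::{t2_space,second_countable_topology}, 'e::euclidean_space) chart set"
    and g :: "('m, 'e) metric_field" +
  fixes \<gamma> :: "real \<Rightarrow> 'm" and a b :: real
  assumes ab: "a < b" and sc: "smooth_curve A \<gamma> {a..b}"
begin

definition crd :: "('m, 'e) chart \<Rightarrow> real \<Rightarrow> 'e" where "crd c t = chart_map c (\<gamma> t)"

definition vel :: "('m, 'e) chart \<Rightarrow> real \<Rightarrow> 'e" where
  "vel c t = vector_derivative (crd c) (at t within {a..b})"

abbreviation "loc \<equiv> loc_field A \<gamma>"
abbreviation "cov \<equiv> cov_deriv A g \<gamma> {a..b}"
abbreviation "smooth \<equiv> smooth_field A \<gamma> {a..b}"
abbreviation "jacobi \<equiv> jacobi_field A g \<gamma> {a..b}"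

definition pre :: "('m, 'e) chart \<Rightarrow> real set" where "pre c = {t\<in>{a..b}. \<gamma> t \<in> chart_dom c}"

lemma preD: "t \<in> pre c \<Longrightarrow> t \<in> {a..b}" "t \<in> pre c \<Longrightarrow> \<gamma> t \<in> chart_dom c"
  by (auto simp: pre_def)

lemma pre_tc: "t \<in> {a..b} \<Longrightarrow> t \<in> pre (tc (\<gamma> t))"
  by (simp add: pre_def tchart)

lemma cont_\<gamma>: "continuous_on {a..b} \<gamma>" using sc by (simp add: smooth_curve_def)

lemma udS: assumes "c \<in> A" shows "unique_deriv_set (pre c)"
proof -
  obtain W where W: "open W" "W \<inter> {a..b} = \<gamma> -` chart_dom c \<inter> {a..b}"
    using cont_\<gamma> chart_open_dom[OF assms] unfolding continuous_on_open_invariant by blast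
  have "pre c = \<gamma> -` chart_dom c \<inter> {a..b}" unfolding pre_def by blast
  also have "\<dots> = {a..b} \<inter> W" unfolding W(2)[symmetric] by (rule Int_commute)
  finally have "pre c = {a..b} \<inter> W" .
  then show ?thesis using unique_deriv_set_interval[OF ab W(1)] by simp
qed

lemma at_pre: "c \<in> A \<Longrightarrow> t \<in> pre c \<Longrightarrow> at t within pre c = at t within {a..b}"
  unfolding pre_def by (rule at_within_preimage[OF cont_\<gamma> chart_open_dom]) auto

lemma Ck_crd: "c \<in> A \<Longrightarrow> Ck_on k (pre c) (crd c)"
  using sc unfolding smooth_curve_def smooth_on_def pre_def crd_def by simp

lemma crd_img: "t \<in> pre c \<Longrightarrow> crd c t \<in> chart_img c"
  by (auto simp: pre_def crd_def)

lemma crd_overlap: "t \<in> pre c \<Longrightarrow> t \<in> pre d \<Longrightarrow> crd c t \<in> overlap c d"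
  by (auto simp: pre_def crd_def intro: overlapI)

lemma crd_trans: "c \<in> A \<Longrightarrow> t \<in> pre c \<Longrightarrow> transition c d (crd c t) = crd d t"
  by (simp add: pre_def crd_def transition_map)

lemma vel_unique:
  "t \<in> {a..b} \<Longrightarrow> (crd c has_vector_derivative v) (at t within {a..b}) \<Longrightarrow> vel c t = v"
  unfolding vel_def by (rule vector_derivative_within_closed_interval[OF ab])

lemma crd_derivative:
  assumes "c \<in> A" "t \<in> pre c"
  shows "(crd c has_vector_derivative vel c t) (at t within {a..b})"
proof -
  have "(crd c has_derivative frechet_derivative (crd c) (at t within pre c)) (at t within pre c)"
    by (rule Ck_on_SucD(1)[OF Ck_crd[OF assms(1)] assms(2)])
  then have "crd c differentiable (at t within {a..b})"
    unfolding at_pre[OF assms] by (rule differentiableI)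
  then show ?thesis unfolding vel_def by (simp add: vector_derivative_works)
qed

lemma Ck_vel: "c \<in> A \<Longrightarrow> Ck_on k (pre c) (vel c)"
  by (rule Ck_on_vector_derivative[OF udS Ck_crd]) (simp_all add: at_pre crd_derivative)

lemma vel_trans:
  assumes A: "c \<in> A" "d \<in> A" and t: "t \<in> pre c" "t \<in> pre d"
  shows "vel d t = dtrans c d (crd c t) (vel c t)"
proof (rule vel_unique[OF preD(1)[OF t(1)]])
  have "((\<lambda>s. transition c d (crd c s)) has_vector_derivative dtrans c d (crd c t) (vel c t)) (at t within {a..b})"
    by (rule has_vector_derivative_chain[OF crd_derivative[OF A(1) t(1)] transition_derivative[OF A crd_overlap[OF t]]])
  then have "((\<lambda>s. transition c d (crd c s)) has_vector_derivative dtrans c d (crd c t) (vel c t)) (at t within pre c)"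
    by (simp only: at_pre[OF A(1) t(1)])
  then have "(crd d has_vector_derivative dtrans c d (crd c t) (vel c t)) (at t within pre c)"
    by (rule has_vector_derivative_transform[OF t(1), rotated]) (simp add: crd_trans[OF A(1)])
  then show "(crd d has_vector_derivative dtrans c d (crd c t) (vel c t)) (at t within {a..b})"
    by (simp only: at_pre[OF A(1) t(1)])
qed

lemma velocity_eq: "velocity A \<gamma> {a..b} t = vel (tc (\<gamma> t)) t"
  by (simp add: velocity_def vel_def crd_def[abs_def])

lemma loc_eq: "loc c J t = dtrans (tc (\<gamma> t)) c (crd (tc (\<gamma> t)) t) (J t)"
  by (simp add: loc_field_def change_comp_dtrans crd_def)

lemma loc_tc: "t \<in> {a..b} \<Longrightarrow> loc (tc (\<gamma> t)) J t = J t"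
  by (simp add: loc_eq crd_def dtrans_id tchart)

lemma loc_trans:
  assumes A: "c \<in> A" "d \<in> A" and t: "t \<in> pre c" "t \<in> pre d"
  shows "loc d J t = dtrans c d (crd c t) (loc c J t)"
  unfolding loc_eq crd_def
  by (rule dtrans_dtrans[symmetric]) (use assms tchart in \<open>auto simp: pre_def\<close>)

lemma linear_loc: "c \<in> A \<Longrightarrow> t \<in> pre c \<Longrightarrow> linear (dtrans (tc (\<gamma> t)) c (crd (tc (\<gamma> t)) t))"
  by (rule linear_dtrans[OF tchart(1) _ crd_overlap[OF pre_tc[OF preD(1)]]])

lemma loc_inj:
  assumes "c \<in> A" "t \<in> pre c" "loc c J t = loc c K t"
  shows "J t = K t"
proof -
  have t: "t \<in> {a..b}" using assms(2) by (rule preD)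
  have "loc (tc (\<gamma> t)) J t = loc (tc (\<gamma> t)) K t"
    unfolding loc_trans[OF assms(1) tchart(1) assms(2) pre_tc[OF t], of J]
      loc_trans[OF assms(1) tchart(1) assms(2) pre_tc[OF t], of K] assms(3) ..
  then show ?thesis by (simp add: loc_tc[OF t])
qed

lemma g_loc:
  assumes "c \<in> A" "t \<in> pre c"
  shows "g (\<gamma> t) (J t) (K t) = gm c (crd c t) (loc c J t) (loc c K t)"
proof -
  have t: "t \<in> {a..b}" using assms(2) by (rule preD)
  have "gm c (crd c t) (loc c J t) (loc c K t) = g (\<gamma> t) (loc (tc (\<gamma> t)) J t) (loc (tc (\<gamma> t)) K t)"
    unfolding loc_trans[OF assms(1) tchart(1) assms(2) pre_tc[OF t]]
    unfolding crd_def by (rule gm_eq[OF assms(1) preD(2)[OF assms(2)]])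
  then show ?thesis by (simp add: loc_tc[OF t])
qed

text \<open>In the chart \<open>c\<close>, the covariant derivative of \<open>J\<close> at \<open>t\<close>, taken within \<open>T\<close>, has components \<open>D\<close>.\<close>

definition covd :: "('m, 'e) chart \<Rightarrow> real set \<Rightarrow> (real \<Rightarrow> 'e) \<Rightarrow> real \<Rightarrow> 'e \<Rightarrow> bool" where
  "covd c T J t D \<longleftrightarrow>
     (loc c J has_vector_derivative D - chr c (crd c t) (vel c t) (loc c J t)) (at t within T)"

text \<open>The product rule produces a second derivative of the transition map, and the
  inhomogeneous term of \<open>chr_trans\<close> cancels it. A general \<open>T\<close> is allowed
  because parallel fields will be glued from pieces of the interval.\<close>

lemma covd_trans:
  assumes A: "c \<in> A" "d \<in> A" and t: "t \<in> pre c" "t \<in> pre d" and T: "t \<in> T" "T \<subseteq> {a..b}"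
    and D: "covd c T J t D"
  shows "covd d T J t (dtrans c d (crd c t) D)"
proof -
  let ?x = "crd c t" and ?v = "vel c t" and ?j = "loc c J t"
  let ?S = "{s\<in>T. \<gamma> s \<in> chart_dom c \<inter> chart_dom d}"
  have S: "at t within ?S = at t within T"
    by (rule at_within_preimage[OF continuous_on_subset[OF cont_\<gamma> T(2)]
          open_Int[OF chart_open_dom[OF A(1)] chart_open_dom[OF A(2)]] T(1)]) (use t in \<open>auto simp: pre_def\<close>)
  have tS: "t \<in> ?S" using t T by (auto simp: pre_def)
  have Sp: "s \<in> pre c" "s \<in> pre d" if "s \<in> ?S" for s using that T by (auto simp: pre_def)
  have x: "?x \<in> overlap c d" by (rule crd_overlap[OF t])
  have L: "linear (dtrans c d ?x)" by (rule linear_dtrans[OF A x])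
  have dL: "((\<lambda>s. dtrans c d (crd c s) e) has_vector_derivative htrans c d ?x ?v e) (at t within ?S)" for e
    by (rule has_vector_derivative_chain[OF has_vector_derivative_within_subset[OF crd_derivative[OF A(1) t(1)]]
          dtrans_derivative[OF A x]]) (use T in auto)
  have dJ: "(loc c J has_vector_derivative D - chr c ?x ?v ?j) (at t within ?S)"
    using D unfolding covd_def S .
  have "((\<lambda>s. dtrans c d (crd c s) (loc c J s)) has_vector_derivative
      dtrans c d ?x (D - chr c ?x ?v ?j) + htrans c d ?x ?v ?j) (at t within ?S)"
  proof (rule has_vector_derivative_apply[where L = "\<lambda>s. dtrans c d (crd c s)", OF _ tS dL _ dJ])
    show "linear (dtrans c d (crd c s))" if "s \<in> ?S" for s
      by (rule linear_dtrans[OF A crd_overlap[OF Sp[OF that]]])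
    show "linear (htrans c d ?x ?v)" using bilinear_htrans[OF A x] by (simp add: bilinear_def)
  qed
  then have "(loc d J has_vector_derivative
      dtrans c d ?x (D - chr c ?x ?v ?j) + htrans c d ?x ?v ?j) (at t within ?S)"
    by (rule has_vector_derivative_transform[OF tS, rotated]) (rule loc_trans[OF A Sp])
  moreover have "dtrans c d ?x (D - chr c ?x ?v ?j) + htrans c d ?x ?v ?j
      = dtrans c d ?x D - chr d (crd d t) (vel d t) (loc d J t)"
    unfolding linear_diff[OF L] chr_trans[OF A x] vel_trans[OF A t] loc_trans[OF A t] crd_trans[OF A(1) t(1)]
    by simp
  ultimately show ?thesis unfolding covd_def S by simp
qed

text \<open>Relational counterpart of \<open>cov_deriv\<close>: it includes differentiability, which
  the total function \<open>cov_deriv\<close> does not, and it speaks about all charts around the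
  point at once.\<close>

definition hcd_on :: "real set \<Rightarrow> (real \<Rightarrow> 'e) \<Rightarrow> (real \<Rightarrow> 'e) \<Rightarrow> real \<Rightarrow> bool" where
  "hcd_on T J K t \<longleftrightarrow> (\<forall>c\<in>A. t \<in> pre c \<longrightarrow> covd c T J t (loc c K t))"

abbreviation "hcd \<equiv> hcd_on {a..b}"

lemma hcd_onI:
  assumes c: "c \<in> A" "t \<in> pre c" and T: "t \<in> T" "T \<subseteq> {a..b}" and "covd c T J t (loc c K t)"
  shows "hcd_on T J K t"
  unfolding hcd_on_def
proof (intro ballI impI)
  fix d assume d: "d \<in> A" "t \<in> pre d"
  show "covd d T J t (loc d K t)"
    unfolding loc_trans[OF c(1) d(1) c(2) d(2)] by (rule covd_trans) (use assms d in auto)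
qed

lemma hcdD: "hcd J K t \<Longrightarrow> c \<in> A \<Longrightarrow> t \<in> pre c \<Longrightarrow>
    (loc c J has_vector_derivative loc c K t - chr c (crd c t) (vel c t) (loc c J t)) (at t within {a..b})"
  unfolding hcd_on_def covd_def by blast

lemma hcd_cov_deriv:
  assumes t: "t \<in> {a..b}" and J: "hcd J K t"
  shows "cov J t = K t"
proof -
  let ?c = "tc (\<gamma> t)"
  have "vector_derivative (loc ?c J) (at t within {a..b}) = loc ?c K t - chr ?c (crd ?c t) (vel ?c t) (loc ?c J t)"
    by (rule vector_derivative_within_closed_interval[OF ab t hcdD[OF J tchart(1) pre_tc[OF t]]])
  then show ?thesis
    by (simp add: cov_deriv_def Let_def velocity_eq loc_tc[OF t] crd_def)
qed

lemma smooth_fieldD: "smooth J \<Longrightarrow> c \<in> A \<Longrightarrow> Ck_on k (pre c) (loc c J)"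
  unfolding smooth_field_def smooth_on_def pre_def by blast

lemma smooth_fieldI: "(\<And>c k. c \<in> A \<Longrightarrow> Ck_on k (pre c) (loc c J)) \<Longrightarrow> smooth J"
  unfolding smooth_field_def smooth_on_def pre_def by blast

lemma smooth_field_hcd:
  assumes J: "smooth J" and t: "t \<in> {a..b}"
  shows "hcd J (cov J) t"
proof -
  let ?c = "tc (\<gamma> t)"
  have p: "t \<in> pre ?c" by (rule pre_tc[OF t])
  have "(loc ?c J has_derivative frechet_derivative (loc ?c J) (at t within pre ?c)) (at t within pre ?c)"
    by (rule Ck_on_SucD(1)[OF smooth_fieldD[OF J tchart(1)] p])
  then have "loc ?c J differentiable (at t within {a..b})"
    unfolding at_pre[OF tchart(1) p] by (rule differentiableI)
  then have "(loc ?c J has_vector_derivative vector_derivative (loc ?c J) (at t within {a..b})) (at t within {a..b})"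
    by (simp add: vector_derivative_works)
  then have "covd ?c {a..b} J t (loc ?c (cov J) t)"
    unfolding covd_def loc_tc[OF t] by (simp add: cov_deriv_def Let_def velocity_eq crd_def)
  then show ?thesis by (rule hcd_onI[OF tchart(1) p t order_refl])
qed

lemma linear_chr_vel: "c \<in> A \<Longrightarrow> t \<in> pre c \<Longrightarrow> linear (chr c (crd c t) (vel c t))"
  by (rule linear_chr(1)[OF _ crd_img])

lemma Ck_chr_vel: assumes c: "c \<in> A" shows "Ck_on k (pre c) (\<lambda>t. chr c (crd c t) (vel c t) u)"
proof (rule Ck_on_apply[where L = "\<lambda>t v. chr c (crd c t) v u", OF udS[OF c] _ _ Ck_vel[OF c]])
  show "linear (\<lambda>v. chr c (crd c t) v u)" if "t \<in> pre c" for t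
    by (rule linear_chr(2)[OF c crd_img[OF that]])
  show "Ck_on k (pre c) (\<lambda>t. chr c (crd c t) e u)" for e
    by (rule Ck_on_compose[OF udS[OF c] _ Ck_chr[OF c] Ck_crd[OF c]]) (rule image_subsetI, rule crd_img)
qed

lemma smooth_field_cov_deriv:
  assumes J: "smooth J"
  shows "smooth (cov J)"
proof (rule smooth_fieldI)
  fix c k assume c: "c \<in> A"
  let ?K = "cov J"
  let ?d = "\<lambda>t. loc c ?K t - chr c (crd c t) (vel c t) (loc c J t)"
  have "Ck_on k (pre c) ?d"
  proof (rule Ck_on_vector_derivative[OF udS[OF c] smooth_fieldD[OF J c]])
    show "(loc c J has_vector_derivative ?d t) (at t within pre c)" if "t \<in> pre c" for t
      unfolding at_pre[OF c that] by (rule hcdD[OF smooth_field_hcd[OF J preD(1)[OF that]] c that])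
  qed
  from Ck_on_add[OF udS[OF c] this Ck_on_apply[where L = "\<lambda>t. chr c (crd c t) (vel c t)", OF udS[OF c] linear_chr_vel[OF c] Ck_chr_vel[OF c] smooth_fieldD[OF J c]]]
  show "Ck_on k (pre c) (loc c ?K)" by simp
qed

text \<open>Product rule in one chart; the Christoffel corrections cancel the derivative of the
  metric coefficients by \<open>chr_compat\<close>.\<close>

lemma hcd_metric:
  assumes t: "t \<in> {a..b}" and J: "hcd J J' t" and K: "hcd K K' t"
  shows "((\<lambda>s. g (\<gamma> s) (J s) (K s)) has_vector_derivative
     g (\<gamma> t) (J' t) (K t) + g (\<gamma> t) (J t) (K' t)) (at t within {a..b})"
proof -
  let ?c = "tc (\<gamma> t)"
  note c = tchart(1)[of "\<gamma> t"] and p = pre_tc[OF t]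
  let ?x = "crd ?c t" and ?v = "vel ?c t"
  let ?D = "gm ?c ?x (loc ?c J t) (loc ?c K' t - chr ?c ?x ?v (loc ?c K t))
     + (gm ?c ?x (loc ?c J' t - chr ?c ?x ?v (loc ?c J t)) (loc ?c K t) + dgm ?c ?x ?v (loc ?c J t) (loc ?c K t))"
  note ci = crd_img[OF p]
  note D = hcdD[OF J c p] hcdD[OF K c p]
  have "((\<lambda>s. gm ?c (crd ?c s) (loc ?c J s) (loc ?c K s)) has_vector_derivative
 ?D) (at t within pre ?c)"
  proof (rule has_vector_derivative_apply2[where B = "\<lambda>s. gm ?c (crd ?c s)" and B' = "dgm ?c ?x ?v"
        and U = "loc ?c J" and V = "loc ?c K", OF _ p _ dgm_props(2)[OF c ci] D[folded at_pre[OF c p]]])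
    show "bilinear (gm ?c (crd ?c s))" if "s \<in> pre ?c" for s by (rule gm_bilinear[OF c crd_img[OF that]])
    show "((\<lambda>s. gm ?c (crd ?c s) u v) has_vector_derivative dgm ?c ?x ?v u v) (at t within pre ?c)" for u v
      unfolding at_pre[OF c p]
      by (rule has_vector_derivative_chain[OF crd_derivative[OF c p] gm_derivative[OF c ci]])
  qed
  then have "((\<lambda>s. g (\<gamma> s) (J s) (K s)) has_vector_derivative
 ?D) (at t within pre ?c)"
    by (rule has_vector_derivative_transform[OF p, rotated]) (rule g_loc[OF c])
  moreover have "?D = g (\<gamma> t) (J' t) (K t) + g (\<gamma> t) (J t) (K' t)"
    unfolding g_loc[OF c p] chr_compat[OF c ci]
    by (simp add: bilinear_lsub[OF gm_bilinear[OF c ci]] bilinear_rsub[OF gm_bilinear[OF c ci]])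
  ultimately show ?thesis by (simp only: at_pre[OF c p])
qed

definition Rj :: "real \<Rightarrow> 'e \<Rightarrow> 'e" where
  "Rj t u = curvature A g (\<gamma> t) (velocity A \<gamma> {a..b} t) u (velocity A \<gamma> {a..b} t)"

lemma jacobi_field_iff:
  "jacobi J \<longleftrightarrow> smooth J \<and>
     (\<forall>t\<in>{a..b}. cov (cov J) t = Rj t (J t))"
  by (simp add: jacobi_field_def Rj_def)

lemma Rj_eq: "Rj t u = curv (tc (\<gamma> t)) (crd (tc (\<gamma> t)) t) (vel (tc (\<gamma> t)) t) u (vel (tc (\<gamma> t)) t)"
  by (simp add: Rj_def curvature_eq velocity_eq crd_def)

lemma Rj_linear: "t \<in> {a..b} \<Longrightarrow> linear (Rj t)"
  unfolding Rj_eq[abs_def] by (rule curv_linear(2)[OF tchart(1) crd_img[OF pre_tc]])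

lemma Rj_selfadjoint: "t \<in> {a..b} \<Longrightarrow> g (\<gamma> t) (Rj t u) w = g (\<gamma> t) u (Rj t w)"
  using g_loc[OF tchart(1) pre_tc, of t "\<lambda>t. Rj t u" "\<lambda>_. w"] g_loc[OF tchart(1) pre_tc, of t "\<lambda>_. u" "\<lambda>t. Rj t w"]
  by (simp add: loc_tc Rj_eq curv_selfadjoint[OF tchart(1) crd_img[OF pre_tc]])

text \<open>\<open>Rj\<close> is computed in a chart that may jump with \<open>t\<close>;
  tensoriality moves it to a fixed chart, where it has smooth coefficients.\<close>

lemma loc_Rj:
  assumes c: "c \<in> A" and t: "t \<in> pre c"
  shows "loc c (\<lambda>s. Rj s (J s)) t = curv c (crd c t) (vel c t) (loc c J t) (vel c t)"
proof -
  let ?d = "tc (\<gamma> t)"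
  have d: "?d \<in> A" "t \<in> pre ?d" using tchart(1) pre_tc[OF preD(1)[OF t]] by auto
  have "loc c (\<lambda>s. Rj s (J s)) t = dtrans ?d c (crd ?d t) (curv ?d (crd ?d t) (vel ?d t) (J t) (vel ?d t))"
    unfolding loc_eq Rj_eq ..
  also have "\<dots> = curv c (crd c t) (vel c t) (loc c J t) (vel c t)"
    unfolding curv_trans[OF d(1) c crd_overlap[OF d(2) t]] crd_trans[OF d] vel_trans[OF d(1) c d(2) t] loc_eq ..
  finally show ?thesis .
qed

lemma linear_curv_vel:
  assumes c: "c \<in> A" and t: "t \<in> pre c" shows "linear (\<lambda>u. curv c (crd c t) (vel c t) u (vel c t))"
  by (rule curv_linear(2)[OF c crd_img[OF t]])

lemma Ck_curv_vel: assumes c: "c \<in> A" shows "Ck_on k (pre c) (\<lambda>t. curv c (crd c t) (vel c t) u (vel c t))"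
proof (rule Ck_on_apply[where L = "\<lambda>t w. curv c (crd c t) (vel c t) u w", OF udS[OF c] _ _ Ck_vel[OF c]])
  show "linear (curv c (crd c t) (vel c t) u)" if "t \<in> pre c" for t
    by (rule curv_linear(1)[OF c crd_img[OF that]])
  show "Ck_on k (pre c) (\<lambda>t. curv c (crd c t) (vel c t) u e)" for e
  proof (rule Ck_on_apply[where L = "\<lambda>t v. curv c (crd c t) v u e", OF udS[OF c] _ _ Ck_vel[OF c]])
    show "linear (\<lambda>v. curv c (crd c t) v u e)" if "t \<in> pre c" for t
      by (rule curv_linear(3)[OF c crd_img[OF that]])
    show "Ck_on k (pre c) (\<lambda>t. curv c (crd c t) e' u e)" for e'
      by (rule Ck_on_compose[OF udS[OF c] _ Ck_curv[OF c] Ck_crd[OF c]]) (rule image_subsetI, rule crd_img)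
  qed
qed

text \<open>\<open>jacobi_field\<close> demands smoothness of every order. In each chart the pair of
  \<open>J\<close> and \<open>P\<close> solves a first-order linear system with smooth coefficients,
  so once differentiable it is smooth.\<close>

lemma jacobi_fieldI:
  assumes JP: "\<And>t. t \<in> {a..b} \<Longrightarrow> hcd J P t" and PJ: "\<And>t. t \<in> {a..b} \<Longrightarrow> hcd P (\<lambda>s. Rj s (J s)) t"
  shows "jacobi J"
proof -
  have "smooth J"
  proof (rule smooth_fieldI)
    fix c k assume c: "c \<in> A"
    note S = udS[OF c]
    define M where "M t q = (snd q - chr c (crd c t) (vel c t) (fst q),
       curv c (crd c t) (vel c t) (fst q) (vel c t) - chr c (crd c t) (vel c t) (snd q))" for t and q :: "'e \<times> 'e"
    have "Ck_on k (pre c) (\<lambda>t. (loc c J t, loc c P t))"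
    proof (rule Ck_on_linear_ode[where M = M, OF S])
      fix t assume t: "t \<in> pre c"
      show "linear (M t)"
        by (rule linearI) (simp_all add: M_def linear_add[OF linear_chr_vel[OF c t]] linear_cmul[OF linear_chr_vel[OF c t]]
            linear_add[OF linear_curv_vel[OF c t]] linear_cmul[OF linear_curv_vel[OF c t]] scaleR_diff_right)
      have "((\<lambda>t. (loc c J t, loc c P t)) has_vector_derivative (loc c P t - chr c (crd c t) (vel c t) (loc c J t),
         loc c (\<lambda>s. Rj s (J s)) t - chr c (crd c t) (vel c t) (loc c P t))) (at t within {a..b})"
        by (rule has_vector_derivative_Pair[OF hcdD[OF JP c t] hcdD[OF PJ c t]]) (rule preD[OF t])+
      then show "((\<lambda>t. (loc c J t, loc c P t)) has_vector_derivative M t (loc c J t, loc c P t)) (at t within pre c)"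
        by (simp add: M_def loc_Rj[OF c t] at_pre[OF c t])
    next
      show "Ck_on k (pre c) (\<lambda>t. M t q)" for q k unfolding M_def
        by (intro Ck_on_Pair[OF S] Ck_on_diff[OF S] Ck_on_const[OF S] Ck_chr_vel[OF c] Ck_curv_vel[OF c])
    qed
    from Ck_on_linear[OF linear_fst S this] show "Ck_on k (pre c) (loc c J)" by simp
  qed
  moreover have "cov (cov J) t = Rj t (J t)" if t: "t \<in> {a..b}" for t
  proof -
    have e: "cov J s = P s" if "s \<in> {a..b}" for s by (rule hcd_cov_deriv[OF that JP[OF that]])
    have "hcd (cov J) (\<lambda>s. Rj s (J s)) t"
    proof (rule hcd_onI[OF tchart(1) pre_tc[OF t] t order_refl])
      let ?c = "tc (\<gamma> t)"
      have le: "loc ?c (cov J) s = loc ?c P s" if "s \<in> {a..b}" for s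
        by (simp add: loc_eq e[OF that])
      have "(loc ?c P has_vector_derivative loc ?c (\<lambda>s. Rj s (J s)) t - chr ?c (crd ?c t) (vel ?c t) (loc ?c P t)) (at t within {a..b})"
        by (rule hcdD[OF PJ[OF t] tchart(1) pre_tc[OF t]])
      then show "covd ?c {a..b} (cov J) t (loc ?c (\<lambda>s. Rj s (J s)) t)"
        unfolding covd_def le[OF t] by (rule has_vector_derivative_transform[OF t, rotated]) (rule le)
    qed
    from hcd_cov_deriv[OF t this] show ?thesis .
  qed
  ultimately show ?thesis by (simp add: jacobi_field_iff)
qed

lemma covd_transform:
  assumes "t \<in> T" "\<And>s. s \<in> T \<Longrightarrow> J s = K s" "covd c T J t D"
  shows "covd c T K t D"
proof -
  have e: "loc c K s = loc c J s" if "s \<in> T" for s using assms(2)[OF that] by (simp add: loc_eq)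
  show ?thesis unfolding covd_def e[OF assms(1)]
    by (rule has_vector_derivative_transform[where f = "loc c J" and g = "loc c K",
          OF assms(1) e assms(3)[unfolded covd_def]])
qed

lemma loc_zero: "c \<in> A \<Longrightarrow> t \<in> pre c \<Longrightarrow> loc c (\<lambda>_. 0) t = 0"
  unfolding loc_eq by (rule linear_0[OF linear_loc])

text \<open>The parallel equation is an ordinary differential equation only inside a chart, so the
  interval is bisected until each piece lies in a single chart domain.\<close>

lemma parallel_transport:
  obtains Z where "Z a = v" "\<forall>t\<in>{a..b}. hcd Z (\<lambda>_. 0) t"
proof -
  \<comment> \<open>The covariant derivative is taken within the piece itself, so that two adjacent
    pieces can be joined through their one-sided derivatives.\<close>
  define P where "P s t \<longleftrightarrow> (a \<le> s \<and> s \<le> t \<and> t \<le> b \<longrightarrow> (\<forall>v. \<exists>Z. Z s = v \<and>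
     (\<forall>\<tau>\<in>{s..t}. \<forall>c\<in>A. \<tau> \<in> pre c \<longrightarrow> covd c {s..t} Z \<tau> 0)))" for s t
  have "P a b"
  proof (induction rule: Bolzano[OF less_imp_le[OF ab]])
    case (1 s t r)
    show ?case unfolding P_def
    proof (intro impI allI)
      fix v assume sr: "a \<le> s \<and> s \<le> r \<and> r \<le> b"
      obtain Y where Y: "Y s = v" "\<And>\<tau> c. \<tau> \<in> {s..t} \<Longrightarrow> c \<in> A \<Longrightarrow> \<tau> \<in> pre c \<Longrightarrow> covd c {s..t} Y \<tau> 0"
        using 1 sr unfolding P_def by force
      obtain Z where Z: "Z t = Y t" "\<And>\<tau> c. \<tau> \<in> {t..r} \<Longrightarrow> c \<in> A \<Longrightarrow> \<tau> \<in> pre c \<Longrightarrow> covd c {t..r} Z \<tau> 0"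
        using 1 sr unfolding P_def by force
      define W where "W \<tau> = (if \<tau> \<le> t then Y \<tau> else Z \<tau>)" for \<tau>
      have W: "Y \<tau> = W \<tau>" if "\<tau> \<in> {s..t}" for \<tau> using that by (simp add: W_def)
      have W': "Z \<tau> = W \<tau>" if "\<tau> \<in> {t..r}" for \<tau> using that Z(1) by (auto simp: W_def)
      have "covd c {s..r} W \<tau> 0" if \<tau>: "\<tau> \<in> {s..r}" and c: "c \<in> A" "\<tau> \<in> pre c" for \<tau> c
        unfolding covd_def
      proof (rule has_vector_derivative_glue[OF 1(3,4) \<tau>])
        assume "\<tau> \<le> t"
        then have t: "\<tau> \<in> {s..t}" using \<tau> by simp
        show "(loc c W has_vector_derivative 0 - chr c (crd c \<tau>) (vel c \<tau>) (loc c W \<tau>)) (at \<tau> within {s..t})"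
          using covd_transform[OF t W Y(2)[OF t c]] unfolding covd_def .
      next
        assume "t \<le> \<tau>"
        then have t: "\<tau> \<in> {t..r}" using \<tau> by simp
        show "(loc c W has_vector_derivative 0 - chr c (crd c \<tau>) (vel c \<tau>) (loc c W \<tau>)) (at \<tau> within {t..r})"
          using covd_transform[OF t W' Z(2)[OF t c]] unfolding covd_def .
      qed
      moreover have "W s = v" using W[of s] Y(1) 1 by simp
      ultimately show "\<exists>Z. Z s = v \<and> (\<forall>\<tau>\<in>{s..r}. \<forall>c\<in>A. \<tau> \<in> pre c \<longrightarrow> covd c {s..r} Z \<tau> 0)" by blast
    qed
  next
    case (2 x)
    let ?c = "tc (\<gamma> x)"
    note c = tchart(1)[of "\<gamma> x"]
    obtain W where W: "open W" "W \<inter> {a..b} = \<gamma> -` chart_dom ?c \<inter> {a..b}"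
      using cont_\<gamma> chart_open_dom[OF c] unfolding continuous_on_open_invariant by blast
    have "x \<in> W" using W(2) 2 tchart(2)[of "\<gamma> x"] by (metis IntD1 IntI atLeastAtMost_iff vimageI)
    then obtain d where d: "d > 0" "ball x d \<subseteq> W" using W(1) open_contains_ball by blast
    show ?case
    proof (intro exI[of _ d] conjI allI impI)
      fix s t assume st: "s \<le> x \<and> x \<le> t \<and> t - s < d"
      show "P s t" unfolding P_def
      proof (intro impI allI)
        fix v assume ast: "a \<le> s \<and> s \<le> t \<and> t \<le> b"
        have sub: "\<tau> \<in> pre ?c" "\<tau> \<in> {a..b}" if "\<tau> \<in> {s..t}" for \<tau>
        proof -
          show ab: "\<tau> \<in> {a..b}" using that ast by simp
          have "dist x \<tau> < d" using st that by (auto simp: dist_real_def abs_if)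
          then have "\<tau> \<in> W \<inter> {a..b}" using d(2) ab by auto
          then show "\<tau> \<in> pre ?c" unfolding W(2) pre_def by blast
        qed
        define M where "M \<tau> u = - chr ?c (crd ?c \<tau>) (vel ?c \<tau>) u" for \<tau> u
        have linM: "linear (M \<tau>)" if "\<tau> \<in> {s..t}" for \<tau>
          unfolding M_def by (rule linear_compose_neg[OF linear_chr_vel[OF c sub(1)[OF that]]])
        have contM: "continuous_on {s..t} (\<lambda>\<tau>. M \<tau> u)" for u
          unfolding M_def
          by (intro continuous_on_minus continuous_on_subset[OF Ck_on_continuous[OF Ck_chr_vel[OF c]]] subsetI sub(1))
        have st': "s \<le> t" using ast by simp
        obtain y where y: "y s = loc ?c (\<lambda>_. v) s"
          "\<And>\<tau>. \<tau> \<in> {s..t} \<Longrightarrow> (y has_vector_derivative M \<tau> (y \<tau>)) (at \<tau> within {s..t})"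
          using linear_ode_exists[OF st' linM contM, of "loc ?c (\<lambda>_. v) s"] by blast
        \<comment> \<open>\<open>y\<close> holds components in \<open>?c\<close>; \<open>Z\<close>
          returns them to the chart that represents tangent vectors at
          \<open>\<gamma> \<tau>\<close>.\<close>
        define Z where "Z \<tau> = dtrans ?c (tc (\<gamma> \<tau>)) (crd ?c \<tau>) (y \<tau>)" for \<tau>
        have locZ: "loc ?c Z \<tau> = y \<tau>" if "\<tau> \<in> {s..t}" for \<tau>
          unfolding loc_eq Z_def
          unfolding crd_trans[OF c sub(1)[OF that], where d = "tc (\<gamma> \<tau>)", symmetric]
          by (rule dtrans_inverse[OF c tchart(1) crd_overlap[OF sub(1)[OF that] pre_tc[OF sub(2)[OF that]]]])
        have "Z s = v"
        proof (rule loc_inj[OF c, where K = "\<lambda>_. v"])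
          show "s \<in> pre ?c" using sub(1) st' by simp
          show "loc ?c Z s = loc ?c (\<lambda>_. v) s" using locZ[of s] y(1) st' by simp
        qed
        moreover have "covd d {s..t} Z \<tau> 0" if \<tau>: "\<tau> \<in> {s..t}" and d: "d \<in> A" "\<tau> \<in> pre d" for \<tau> d
        proof -
          have "(loc ?c Z has_vector_derivative M \<tau> (y \<tau>)) (at \<tau> within {s..t})"
            by (rule has_vector_derivative_transform[OF \<tau> locZ y(2)[OF \<tau>]])
          then have "covd ?c {s..t} Z \<tau> 0" by (simp add: covd_def locZ[OF \<tau>] M_def)
          from covd_trans[OF c d(1) sub(1)[OF \<tau>] d(2) \<tau> _ this] ast
          have "covd d {s..t} Z \<tau> (dtrans ?c d (crd ?c \<tau>) 0)" by auto
          then show ?thesis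
            using linear_0[OF linear_dtrans[OF c d(1) crd_overlap[OF sub(1)[OF \<tau>] d(2)]]] by simp
        qed
        ultimately show "\<exists>Z. Z s = v \<and> (\<forall>\<tau>\<in>{s..t}. \<forall>c\<in>A. \<tau> \<in> pre c \<longrightarrow> covd c {s..t} Z \<tau> 0)" by blast
      qed
    qed (rule d(1))
  qed
  then obtain Z where Z: "Z a = v" "\<And>\<tau> c. \<tau> \<in> {a..b} \<Longrightarrow> c \<in> A \<Longrightarrow> \<tau> \<in> pre c \<Longrightarrow> covd c {a..b} Z \<tau> 0"
    using ab unfolding P_def by force
  show ?thesis
  proof (rule that[of Z], rule Z(1), intro ballI)
    fix t assume t: "t \<in> {a..b}"
    show "hcd Z (\<lambda>_. 0) t" unfolding hcd_on_def using Z(2)[OF t] by (simp add: loc_zero)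
  qed
qed

lemma hcd_combination:
  fixes E :: "'i \<Rightarrow> real \<Rightarrow> 'e"
  assumes t: "t \<in> {a..b}" and E: "\<And>i. i \<in> I \<Longrightarrow> hcd (E i) (\<lambda>_. 0) t"
    and f: "\<And>i. i \<in> I \<Longrightarrow> (f i has_vector_derivative f' i t) (at t within {a..b})"
  shows "hcd (\<lambda>s. \<Sum>i\<in>I. f i s *\<^sub>R E i s) (\<lambda>s. \<Sum>i\<in>I. f' i s *\<^sub>R E i s) t"
proof (rule hcd_onI[OF tchart(1) pre_tc[OF t] t order_refl])
  let ?c = "tc (\<gamma> t)"
  note c = tchart(1)[of "\<gamma> t"] and p = pre_tc[OF t]
  have lsum: "loc ?c (\<lambda>s. \<Sum>i\<in>I. h i s *\<^sub>R E i s) s = (\<Sum>i\<in>I. h i s *\<^sub>R loc ?c (E i) s)" if "s \<in> pre ?c" for s and h :: "'i \<Rightarrow> real \<Rightarrow> real"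
    unfolding loc_eq by (simp add: linear_sum[OF linear_loc[OF c that]] linear_cmul[OF linear_loc[OF c that]])
  let ?d = "\<lambda>i. f i t *\<^sub>R (0 - chr ?c (crd ?c t) (vel ?c t) (loc ?c (E i) t)) + f' i t *\<^sub>R loc ?c (E i) t"
  let ?D = "\<Sum>i\<in>I. ?d i"
  note lG = linear_chr_vel[OF c p]
  have "((\<lambda>s. \<Sum>i\<in>I. f i s *\<^sub>R loc ?c (E i) s) has_vector_derivative ?D) (at t within pre ?c)"
  proof (rule has_vector_derivative_sum)
    fix i assume i: "i \<in> I"
    have 1: "(loc ?c (E i) has_vector_derivative 0 - chr ?c (crd ?c t) (vel ?c t) (loc ?c (E i) t)) (at t within pre ?c)"
      using hcdD[OF E[OF i] c p] by (simp add: loc_zero[OF c p] at_pre[OF c p])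
    have 2: "(f i has_vector_derivative f' i t) (at t within pre ?c)" using f[OF i] by (simp add: at_pre[OF c p])
    show "((\<lambda>s. f i s *\<^sub>R loc ?c (E i) s) has_vector_derivative ?d i) (at t within pre ?c)"
      by (rule bounded_bilinear.has_vector_derivative[OF bounded_bilinear_scaleR 2 1])
  qed
  then have "(loc ?c (\<lambda>s. \<Sum>i\<in>I. f i s *\<^sub>R E i s) has_vector_derivative ?D) (at t within pre ?c)"
    by (rule has_vector_derivative_transform[OF p, rotated]) (rule lsum)
  moreover have "?D
      = (\<Sum>i\<in>I. f' i t *\<^sub>R loc ?c (E i) t) - chr ?c (crd ?c t) (vel ?c t) (\<Sum>i\<in>I. f i t *\<^sub>R loc ?c (E i) t)"
    by (simp add: linear_sum[OF lG] linear_cmul[OF lG] sum.distrib sum_negf sum_subtractf)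
  ultimately show "covd ?c {a..b} (\<lambda>s. \<Sum>i\<in>I. f i s *\<^sub>R E i s) t (loc ?c (\<lambda>s. \<Sum>i\<in>I. f' i s *\<^sub>R E i s) t)"
    unfolding covd_def lsum[OF p] at_pre[OF c p] by simp
qed

definition parallel_frame :: "(real \<Rightarrow> 'e \<Rightarrow> 'e) \<Rightarrow> bool" where
  "parallel_frame E \<longleftrightarrow> (\<forall>t\<in>{a..b}. linear (E t) \<and> (\<forall>v. hcd (\<lambda>s. E s v) (\<lambda>_. 0) t))"

lemma parallel_frame_exists:
  obtains E where "parallel_frame E" "\<And>v. E a v = v"
proof -
  have "\<forall>v. \<exists>Z. Z a = v \<and> (\<forall>t\<in>{a..b}. hcd Z (\<lambda>_. 0) t)"
  proof
    fix v
    obtain Z where "Z a = v" "\<forall>t\<in>{a..b}. hcd Z (\<lambda>_. 0) t" by (rule parallel_transport)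
    then show "\<exists>Z. Z a = v \<and> (\<forall>t\<in>{a..b}. hcd Z (\<lambda>_. 0) t)" by blast
  qed
  from choice[OF this] obtain Z where Z: "\<And>v. Z v a = v" "\<And>v t. t \<in> {a..b} \<Longrightarrow> hcd (Z v) (\<lambda>_. 0) t" by blast
  define E where "E t v = (\<Sum>i\<in>Basis. (v \<bullet> i) *\<^sub>R Z i t)" for t v
  show ?thesis
  proof (rule that[of E])
    show "E a v = v" for v by (simp add: E_def Z(1) euclidean_representation)
    show "parallel_frame E" unfolding parallel_frame_def
    proof (intro ballI conjI allI)
      show "linear (E t)" for t unfolding E_def
        by (rule linearI) (simp_all add: inner_add_left scaleR_add_left sum.distrib scaleR_sum_right)
      show "hcd (\<lambda>s. E s v) (\<lambda>_. 0) t" if t: "t \<in> {a..b}" for t v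
        using hcd_combination[where f = "\<lambda>i s. v \<bullet> i" and f' = "\<lambda>i s. 0" and E = Z, OF t Z(2)[OF t] has_vector_derivative_const]
        by (simp add: E_def[abs_def])
    qed
  qed
qed

end

section \<open>Jacobi fields in a parallel frame\<close>

locale framed_arc = arc A g \<gamma> a b
  for A :: "('m::{t2_space,second_countable_topology}, 'e::euclidean_space) chart set"
    and g :: "('m, 'e) metric_field" and \<gamma> a b +
  fixes E :: "real \<Rightarrow> 'e \<Rightarrow> 'e" and h :: "'e \<Rightarrow> 'e \<Rightarrow> real"
  assumes frame: "parallel_frame E" and gE: "t \<in> {a..b} \<Longrightarrow> g (\<gamma> t) (E t u) (E t v) = h u v"
    and h: "bilinear h" and hsym: "h u v = h v u" and hnd: "nondegenerate_on UNIV h"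
begin

lemma linear_E: "t \<in> {a..b} \<Longrightarrow> linear (E t)" and hcd_E: "t \<in> {a..b} \<Longrightarrow> hcd (\<lambda>s. E s v) (\<lambda>_. 0) t"
  using frame unfolding parallel_frame_def by blast+

lemma inj_E: assumes t: "t \<in> {a..b}" shows "inj (E t)"
proof (rule linear_injective_0[OF linear_E[OF t], THEN iffD2], intro allI impI)
  fix v assume v: "E t v = 0"
  have "h v w = 0" for w using gE[OF t, of v w] v bilinear_lzero[OF g_bilinear] by simp
  then show "v = 0" using hnd by (auto simp: nondegenerate_on_def)
qed

lemma surj_E: "t \<in> {a..b} \<Longrightarrow> surj (E t)"
  using linear_injective_imp_surjective[OF linear_E inj_E] by simp

definition Ei :: "real \<Rightarrow> 'e \<Rightarrow> 'e" where "Ei t = inv (E t)"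

lemma E_Ei: "t \<in> {a..b} \<Longrightarrow> E t (Ei t v) = v"
  unfolding Ei_def by (simp add: surj_f_inv_f[OF surj_E])

definition RE :: "real \<Rightarrow> 'e \<Rightarrow> 'e" where "RE t u = Ei t (Rj t (E t u))"

lemma E_RE: "t \<in> {a..b} \<Longrightarrow> E t (RE t u) = Rj t (E t u)"
  by (simp add: RE_def E_Ei)

lemma RE_linear: assumes t: "t \<in> {a..b}" shows "linear (RE t)"
proof (rule linearI)
  note s = linear_add[OF linear_E[OF t]] linear_cmul[OF linear_E[OF t]] linear_add[OF Rj_linear[OF t]] linear_cmul[OF Rj_linear[OF t]]
  show "RE t (u + v) = RE t u + RE t v" for u v
    by (rule injD[OF inj_E[OF t]]) (simp add: s E_RE[OF t])
  show "RE t (r *\<^sub>R u) = r *\<^sub>R RE t u" for r u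
    by (rule injD[OF inj_E[OF t]]) (simp add: s E_RE[OF t])
qed

lemma RE_selfadjoint: "t \<in> {a..b} \<Longrightarrow> h (RE t u) w = h u (RE t w)"
  using Rj_selfadjoint[of t "E t u" "E t w"] by (simp add: gE[symmetric] E_RE)

lemma dual_exists:
  obtains d where "\<forall>v. (\<Sum>i\<in>Basis. h v (d i) *\<^sub>R i) = v"
proof -
  have "nondegenerate_on UNIV (\<lambda>v w. h w v)" using hnd hsym by (simp add: nondegenerate_on_def)
  then obtain d where d: "\<And>i w. i \<in> Basis \<Longrightarrow> h w (d i) = w \<bullet> i" using dual_basis[OF h] by blast
  have "(\<Sum>i\<in>Basis. h v (d i) *\<^sub>R i) = v" for v by (simp add: d euclidean_representation)
  then show ?thesis using that by blast
qed

text \<open>\<open>E\<close> and its inverse need not be continuous in \<open>t\<close>, since the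
  representing chart may jump. The scalar \<open>h (RE t u) w\<close> is a metric pairing of vectors
  along the curve, so its continuity can be checked in one chart; a dual basis recovers the
  vector.\<close>

lemma RE_continuous: "continuous_on {a..b} (\<lambda>t. RE t u)"
proof -
  have loccont: "((loc c (\<lambda>s. E s v)) \<longlongrightarrow> loc c (\<lambda>s. E s v) t) (at t within {a..b})"
    if "c \<in> A" "t \<in> pre c" for c v t
    using has_vector_derivative_continuous[OF hcdD[OF hcd_E[OF preD(1)[OF that(2)]] that]]
    by (simp add: continuous_within)
  have hcont: "continuous_on {a..b} (\<lambda>t. h (RE t u) w)" for w
    unfolding continuous_on_eq_continuous_within
  proof
    fix t assume t: "t \<in> {a..b}"
    let ?c = "tc (\<gamma> t)"
    note c = tchart(1)[of "\<gamma> t"] and p = pre_tc[OF t]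
    have locE: "continuous_on (pre ?c) (loc ?c (\<lambda>s. E s v))" for v
      unfolding continuous_on_def using loccont[OF c] by (simp add: at_pre[OF c])
    have 1: "continuous_on (pre ?c) (\<lambda>s. curv ?c (crd ?c s) (vel ?c s) (loc ?c (\<lambda>s. E s u) s) (vel ?c s))"
      by (rule continuous_on_apply_linear[OF linear_curv_vel[OF c] Ck_on_continuous[OF Ck_curv_vel[OF c]] locE])
    have 2: "continuous_on (pre ?c) (\<lambda>s. gm ?c (crd ?c s) e e')" for e e'
      by (rule Ck_on_continuous[OF Ck_on_compose[OF udS[OF c] _ Ck_gm[OF c] Ck_crd[OF c], of 0]])
        (rule image_subsetI, rule crd_img)
    have lin: "linear (gm ?c (crd ?c s) e)" "linear (\<lambda>e. gm ?c (crd ?c s) e e')" if "s \<in> pre ?c" for s e e'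
      using gm_bilinear[OF c crd_img[OF that]] by (auto simp: bilinear_def)
    have 3: "continuous_on (pre ?c) (\<lambda>s. gm ?c (crd ?c s) e (loc ?c (\<lambda>s. E s w) s))" for e
      by (rule continuous_on_apply_linear[where M = "\<lambda>s. gm ?c (crd ?c s) e", OF lin(1) 2 locE])
    have "continuous_on (pre ?c) (\<lambda>s. gm ?c (crd ?c s) (curv ?c (crd ?c s) (vel ?c s) (loc ?c (\<lambda>s. E s u) s) (vel ?c s)) (loc ?c (\<lambda>s. E s w) s))"
      by (rule continuous_on_apply_linear[where M = "\<lambda>s e. gm ?c (crd ?c s) e (loc ?c (\<lambda>s. E s w) s)", OF lin(2) 3 1])
    moreover have "gm ?c (crd ?c s) (curv ?c (crd ?c s) (vel ?c s) (loc ?c (\<lambda>s. E s u) s) (vel ?c s)) (loc ?c (\<lambda>s. E s w) s)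
        = h (RE s u) w" if s: "s \<in> pre ?c" for s
      using g_loc[OF c s, of "\<lambda>s. Rj s (E s u)" "\<lambda>s. E s w"] gE[OF preD(1)[OF s], of "RE s u" w]
      by (simp add: loc_Rj[OF c s] E_RE[OF preD(1)[OF s]])
    ultimately have "continuous_on (pre ?c) (\<lambda>s. h (RE s u) w)" by (simp cong: continuous_on_cong)
    then have "continuous (at t within pre ?c) (\<lambda>s. h (RE s u) w)"
      using p by (simp add: continuous_on_eq_continuous_within)
    then show "continuous (at t within {a..b}) (\<lambda>s. h (RE s u) w)" by (simp only: at_pre[OF c p])
  qed
  obtain d where d: "\<forall>v. (\<Sum>i\<in>Basis. h v (d i) *\<^sub>R i) = v" by (rule dual_exists)
  have "continuous_on {a..b} (\<lambda>t. \<Sum>i\<in>Basis. h (RE t u) (d i) *\<^sub>R i)"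
    by (intro continuous_intros hcont)
  then show ?thesis by (simp only: d[rule_format])
qed

text \<open>Pairing with the parallel field of \<open>u\<close> gives the chart-independent function
  \<open>h (j s) u\<close>, whose derivative is known from \<open>hcd_metric\<close>; these
  functions determine \<open>j\<close> through a dual basis.\<close>

lemma frame_derivative:
  assumes t: "t \<in> {a..b}" and J: "hcd J K t" and j: "\<And>s. s \<in> {a..b} \<Longrightarrow> J s = E s (j s)" and k: "K t = E t k"
  shows "(j has_vector_derivative k) (at t within {a..b})"
proof -
  have hj: "((\<lambda>s. h (j s) u) has_vector_derivative h k u) (at t within {a..b})" for u
  proof -
    have "((\<lambda>s. g (\<gamma> s) (J s) (E s u)) has_vector_derivative g (\<gamma> t) (K t) (E t u) + g (\<gamma> t) (J t) 0) (at t within {a..b})"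
      by (rule hcd_metric[OF t J hcd_E[OF t]])
    moreover have "g (\<gamma> t) (K t) (E t u) + g (\<gamma> t) (J t) 0 = h k u"
      by (simp add: k gE[OF t] bilinear_rzero[OF g_bilinear])
    ultimately have "((\<lambda>s. g (\<gamma> s) (J s) (E s u)) has_vector_derivative h k u) (at t within {a..b})" by simp
    then show ?thesis by (rule has_vector_derivative_transform[OF t, rotated]) (simp add: j gE)
  qed
  obtain d where d: "\<forall>v. (\<Sum>i\<in>Basis. h v (d i) *\<^sub>R i) = v" by (rule dual_exists)
  have "((\<lambda>s. \<Sum>i\<in>Basis. h (j s) (d i) *\<^sub>R i) has_vector_derivative (\<Sum>i\<in>Basis. h k (d i) *\<^sub>R i)) (at t within {a..b})"
    by (intro has_vector_derivative_sum bounded_linear.has_vector_derivative[OF bounded_linear_scaleR_left] hj)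
  then show ?thesis by (simp only: d[rule_format])
qed

definition solution :: "(real \<Rightarrow> 'e) \<Rightarrow> (real \<Rightarrow> 'e) \<Rightarrow> bool" where
  "solution j j' \<longleftrightarrow> (\<forall>t\<in>{a..b}. (j has_vector_derivative j' t) (at t within {a..b}) \<and>
      (j' has_vector_derivative RE t (j t)) (at t within {a..b}))"

lemma jacobi_field_solution:
  assumes J: "jacobi J"
  obtains j j' where "solution j j'" "\<And>t. t \<in> {a..b} \<Longrightarrow> J t = E t (j t)"
    "\<And>t. t \<in> {a..b} \<Longrightarrow> cov J t = E t (j' t)"
proof -
  let ?K = "cov J"
  have sJ: "smooth J" and JJ: "\<And>t. t \<in> {a..b} \<Longrightarrow> cov ?K t = Rj t (J t)"
    using J by (auto simp: jacobi_field_iff)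
  define j where "j t = Ei t (J t)" for t
  define j' where "j' t = Ei t (?K t)" for t
  have e: "J t = E t (j t)" "?K t = E t (j' t)" if "t \<in> {a..b}" for t
    using that by (simp_all add: j_def j'_def E_Ei)
  have "solution j j'" unfolding solution_def
  proof (intro ballI conjI)
    fix t assume t: "t \<in> {a..b}"
    show "(j has_vector_derivative j' t) (at t within {a..b})"
      by (rule frame_derivative[OF t smooth_field_hcd[OF sJ t] e(1) e(2)[OF t]])
    show "(j' has_vector_derivative RE t (j t)) (at t within {a..b})"
    proof (rule frame_derivative[OF t smooth_field_hcd[OF smooth_field_cov_deriv[OF sJ] t] e(2)])
      show "cov ?K t = E t (RE t (j t))" unfolding JJ[OF t] e(1)[OF t] E_RE[OF t] ..
    qed
  qed
  then show ?thesis using that e by blast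
qed

lemma hcd_frame:
  assumes t: "t \<in> {a..b}" and j: "\<And>t. t \<in> {a..b} \<Longrightarrow> (j has_vector_derivative j' t) (at t within {a..b})"
  shows "hcd (\<lambda>s. E s (j s)) (\<lambda>s. E s (j' s)) t"
proof -
  have e: "E s v = (\<Sum>i\<in>Basis. (v \<bullet> i) *\<^sub>R E s i)" if "s \<in> {a..b}" for s v
    by (rule linear_basis_expand[OF linear_E[OF that]])
  have "hcd (\<lambda>s. \<Sum>i\<in>Basis. (j s \<bullet> i) *\<^sub>R E s i) (\<lambda>s. \<Sum>i\<in>Basis. (j' s \<bullet> i) *\<^sub>R E s i) t"
    by (rule hcd_combination[where f = "\<lambda>i s. j s \<bullet> i" and f' = "\<lambda>i s. j' s \<bullet> i" and E = "\<lambda>i s. E s i", OF t hcd_E[OF t]])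
      (rule bounded_linear.has_vector_derivative[OF bounded_linear_inner_left j[OF t]])
  then have 1: "covd (tc (\<gamma> t)) {a..b} (\<lambda>s. \<Sum>i\<in>Basis. (j s \<bullet> i) *\<^sub>R E s i) t (loc (tc (\<gamma> t)) (\<lambda>s. \<Sum>i\<in>Basis. (j' s \<bullet> i) *\<^sub>R E s i) t)"
    unfolding hcd_on_def using tchart(1) pre_tc[OF t] by blast
  have "covd (tc (\<gamma> t)) {a..b} (\<lambda>s. E s (j s)) t (loc (tc (\<gamma> t)) (\<lambda>s. \<Sum>i\<in>Basis. (j' s \<bullet> i) *\<^sub>R E s i) t)"
    by (rule covd_transform[OF t _ 1]) (rule e[symmetric])
  then have "covd (tc (\<gamma> t)) {a..b} (\<lambda>s. E s (j s)) t (loc (tc (\<gamma> t)) (\<lambda>s. E s (j' s)) t)"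
    by (simp only: loc_tc[OF t] e[OF t, symmetric])
  then show ?thesis by (rule hcd_onI[OF tchart(1) pre_tc[OF t] t order_refl])
qed

lemma solution_jacobi_field:
  assumes j: "solution j j'"
  shows "jacobi (\<lambda>t. E t (j t))"
    "t \<in> {a..b} \<Longrightarrow> cov (\<lambda>t. E t (j t)) t = E t (j' t)"
proof -
  have 1: "hcd (\<lambda>s. E s (j s)) (\<lambda>s. E s (j' s)) t" if "t \<in> {a..b}" for t
    by (rule hcd_frame[OF that]) (use j in \<open>simp add: solution_def\<close>)
  have 2: "hcd (\<lambda>s. E s (j' s)) (\<lambda>s. Rj s (E s (j s))) t" if t: "t \<in> {a..b}" for t
  proof -
    have "hcd (\<lambda>s. E s (j' s)) (\<lambda>s. E s (RE s (j s))) t"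
      by (rule hcd_frame[OF t]) (use j in \<open>simp add: solution_def\<close>)
    moreover have "loc c (\<lambda>s. E s (RE s (j s))) t = loc c (\<lambda>s. Rj s (E s (j s))) t" for c
      by (simp add: loc_eq E_RE[OF t])
    ultimately show ?thesis by (simp add: hcd_on_def)
  qed
  show "jacobi (\<lambda>t. E t (j t))" by (rule jacobi_fieldI[OF 1 2])
  show "cov (\<lambda>t. E t (j t)) t = E t (j' t)" if t: "t \<in> {a..b}"
    by (rule hcd_cov_deriv[OF t 1[OF t]])
qed

definition first_order :: "real \<Rightarrow> 'e \<times> 'e \<Rightarrow> 'e \<times> 'e" where
  "first_order t q = (snd q, RE t (fst q))"

lemma linear_first_order: "t \<in> {a..b} \<Longrightarrow> linear (first_order t)"
  by (rule linearI) (simp_all add: first_order_def linear_add[OF RE_linear] linear_cmul[OF RE_linear])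

lemma continuous_first_order: "continuous_on {a..b} (\<lambda>t. first_order t q)"
  unfolding first_order_def by (intro continuous_intros RE_continuous)

lemma solution_exists:
  obtains j j' where "solution j j'" "j a = v" "j' a = w"
proof -
  obtain y where y: "y a = (v, w)" "\<And>t. t \<in> {a..b} \<Longrightarrow> (y has_vector_derivative first_order t (y t)) (at t within {a..b})"
    using linear_ode_exists[OF less_imp_le[OF ab] linear_first_order continuous_first_order, of "(v, w)"] by blast
  have "solution (\<lambda>t. fst (y t)) (\<lambda>t. snd (y t))" unfolding solution_def
  proof (intro ballI conjI)
    fix t assume t: "t \<in> {a..b}"
    show "((\<lambda>t. fst (y t)) has_vector_derivative snd (y t)) (at t within {a..b})"
      using bounded_linear.has_vector_derivative[OF bounded_linear_fst y(2)[OF t]] by (simp add: first_order_def)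
    show "((\<lambda>t. snd (y t)) has_vector_derivative RE t (fst (y t))) (at t within {a..b})"
      using bounded_linear.has_vector_derivative[OF bounded_linear_snd y(2)[OF t]] by (simp add: first_order_def)
  qed
  then show ?thesis using that y(1) by simp
qed

lemma solution_unique:
  assumes "solution j j'" "j a = 0" "j' a = 0" "t \<in> {a..b}"
  shows "j t = 0" "j' t = 0"
proof -
  have "(j t, j' t) = 0"
  proof (rule linear_ode_unique[where y = "\<lambda>t. (j t, j' t)", OF linear_first_order continuous_first_order _ _ assms(4)])
    fix t assume t: "t \<in> {a..b}"
    show "((\<lambda>t. (j t, j' t)) has_vector_derivative first_order t (j t, j' t)) (at t within {a..b})"
      using assms(1) t unfolding solution_def first_order_def by (auto intro!: has_vector_derivative_Pair)
  qed (use assms in \<open>simp_all add: zero_prod_def\<close>)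
  then show "j t = 0" "j' t = 0" by (simp_all add: zero_prod_def)
qed

lemma solution_combination:
  assumes "\<And>i. i \<in> I \<Longrightarrow> solution (j i) (j' i)"
  shows "solution (\<lambda>t. \<Sum>i\<in>I. r i *\<^sub>R j i t) (\<lambda>t. \<Sum>i\<in>I. r i *\<^sub>R j' i t)"
  unfolding solution_def
proof (intro ballI conjI)
  fix t assume t: "t \<in> {a..b}"
  show "((\<lambda>t. \<Sum>i\<in>I. r i *\<^sub>R j i t) has_vector_derivative (\<Sum>i\<in>I. r i *\<^sub>R j' i t)) (at t within {a..b})"
    by (intro has_vector_derivative_sum bounded_linear.has_vector_derivative[OF bounded_linear_scaleR_right])
      (use assms t in \<open>simp add: solution_def\<close>)
  show "((\<lambda>t. \<Sum>i\<in>I. r i *\<^sub>R j' i t) has_vector_derivative RE t (\<Sum>i\<in>I. r i *\<^sub>R j i t)) (at t within {a..b})"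
    unfolding linear_sum[OF RE_linear[OF t]] linear_cmul[OF RE_linear[OF t]]
    by (intro has_vector_derivative_sum bounded_linear.has_vector_derivative[OF bounded_linear_scaleR_right])
      (use assms t in \<open>simp add: solution_def\<close>)
qed

lemma solution_diff:
  assumes "solution j j'" "solution k k'"
  shows "solution (\<lambda>t. j t - k t) (\<lambda>t. j' t - k' t)"
  using assms unfolding solution_def
  by (auto intro!: has_vector_derivative_diff simp: linear_diff[OF RE_linear])

text \<open>The derivative vanishes: the terms in \<open>j'\<close> and \<open>k'\<close> cancel
  directly, the remaining two by self-adjointness of \<open>RE\<close>.\<close>

lemma wronskian:
  assumes j: "solution j j'" and k: "solution k k'" and t: "t \<in> {a..b}" "s \<in> {a..b}"
  shows "h (j t) (k' t) - h (j' t) (k t) = h (j s) (k' s) - h (j' s) (k s)"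
proof -
  have bh: "bounded_bilinear h" using h by (simp add: bilinear_conv_bounded_bilinear)
  have "((\<lambda>t. h (j t) (k' t) - h (j' t) (k t)) has_vector_derivative 0) (at t within {a..b})" if t: "t \<in> {a..b}" for t
  proof -
    have "((\<lambda>t. h (j t) (k' t) - h (j' t) (k t)) has_vector_derivative
       (h (j t) (RE t (k t)) + h (j' t) (k' t)) - (h (j' t) (k' t) + h (RE t (j t)) (k t))) (at t within {a..b})"
      by (intro has_vector_derivative_diff bounded_bilinear.has_vector_derivative[OF bh])
        (use j k t in \<open>simp_all add: solution_def\<close>)
    then show ?thesis by (simp add: RE_selfadjoint[OF t])
  qed
  then obtain C where "\<And>t. t \<in> {a..b} \<Longrightarrow> h (j t) (k' t) - h (j' t) (k t) = C"
    using has_vector_derivative_zero_constant[OF convex_closed_interval[of a b]] by (metis (no_types, lifting) cbox_interval convex_real_interval(5))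
  then show ?thesis using t by simp
qed

end

context arc
begin

lemma parallel_frame_isometric:
  assumes E: "parallel_frame E" and t: "t \<in> {a..b}"
  shows "g (\<gamma> t) (E t u) (E t v) = g (\<gamma> a) (E a u) (E a v)"
proof -
  have "((\<lambda>t. g (\<gamma> t) (E t u) (E t v)) has_vector_derivative 0) (at t within {a..b})" if t: "t \<in> {a..b}" for t
  proof -
    have "hcd (\<lambda>s. E s u) (\<lambda>_. 0) t" "hcd (\<lambda>s. E s v) (\<lambda>_. 0) t"
      using E t unfolding parallel_frame_def by blast+
    from hcd_metric[OF t this] show ?thesis
      by (simp add: bilinear_lzero[OF g_bilinear] bilinear_rzero[OF g_bilinear])
  qed
  then obtain C where C: "\<And>t. t \<in> {a..b} \<Longrightarrow> g (\<gamma> t) (E t u) (E t v) = C"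
    using has_vector_derivative_zero_constant[of "{a..b}" "\<lambda>t. g (\<gamma> t) (E t u) (E t v)"] by auto
  show ?thesis using C[OF t] C[of a] ab by simp
qed

end

context framed_arc
begin

lemma fundamental_solution:
  obtains Y Y' where "\<forall>v. solution (\<lambda>t. Y t v) (\<lambda>t. Y' t v)" "\<forall>v. Y a v = 0" "\<forall>v. Y' a v = v"
    "\<forall>t. linear (Y t)" "\<forall>t. linear (Y' t)"
proof -
  have "\<forall>i. \<exists>p. solution (fst p) (snd p) \<and> fst p a = 0 \<and> snd p a = i"
  proof
    fix i
    obtain j j' where "solution j j'" "j a = 0" "j' a = i" by (rule solution_exists)
    then show "\<exists>p. solution (fst p) (snd p) \<and> fst p a = 0 \<and> snd p a = i"
      by (intro exI[of _ "(j, j')"]) simp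
  qed
  from choice[OF this] obtain p where p: "\<And>i. solution (fst (p i)) (snd (p i))" "\<And>i. fst (p i) a = 0" "\<And>i. snd (p i) a = i"
    by blast
  define Y where "Y t v = (\<Sum>i\<in>Basis. (v \<bullet> i) *\<^sub>R fst (p i) t)" for t v
  define Y' where "Y' t v = (\<Sum>i\<in>Basis. (v \<bullet> i) *\<^sub>R snd (p i) t)" for t v
  show ?thesis
  proof (rule that[of Y Y']; intro allI)
    show "solution (\<lambda>t. Y t v) (\<lambda>t. Y' t v)" for v
      unfolding Y_def Y'_def by (rule solution_combination[where j = "\<lambda>i. fst (p i)" and j' = "\<lambda>i. snd (p i)"]) (rule p(1))
    show "Y a v = 0" "Y' a v = v" for v by (simp_all add: Y_def Y'_def p euclidean_representation)
    show "linear (Y t)" "linear (Y' t)" for t unfolding Y_def Y'_def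
      by (rule linearI; simp add: inner_add_left scaleR_add_left sum.distrib scaleR_sum_right)+
  qed
qed

text \<open>A Jacobi field vanishing at \<open>a\<close> is determined by its initial velocity
  \<open>u\<close> in the frame; \<open>Y t u\<close> and \<open>Y' t u\<close> are then the
  coordinates of its value and velocity at \<open>t\<close>.\<close>

lemma A0_eq:
  assumes Y: "\<And>v. solution (\<lambda>t. Y t v) (\<lambda>t. Y' t v)" "\<And>v. Y a v = 0" "\<And>v. Y' a v = v" and t: "t \<in> {a..b}"
  shows "A0 A g \<gamma> a b t = E t ` Y' t ` {u. Y t u = 0}"
proof (rule set_eqI, rule iffI)
  have a: "a \<in> {a..b}" using ab by simp
  have E0: "v = 0" if "s \<in> {a..b}" "E s v = 0" for s v
    using injD[OF inj_E[OF that(1)], of v 0] that(2) linear_0[OF linear_E[OF that(1)]] by simp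
  fix w
  show "w \<in> E t ` Y' t ` {u. Y t u = 0}" if w: "w \<in> A0 A g \<gamma> a b t"
  proof -
    obtain J where J: "w = cov J t" "jacobi J" "J a = 0" "J t = 0"
      using w unfolding A0_def by blast
    obtain j j' where j: "solution j j'" "\<And>t. t \<in> {a..b} \<Longrightarrow> J t = E t (j t)"
      "\<And>t. t \<in> {a..b} \<Longrightarrow> cov J t = E t (j' t)"
      using jacobi_field_solution[OF J(2)] by blast
    have 0: "j a = 0" "j t = 0" using E0[OF a, of "j a"] E0[OF t, of "j t"] j(2)[OF a] j(2)[OF t] J(3,4) by auto
    \<comment> \<open>The difference of \<open>j\<close> and the member of \<open>Y\<close> with the
      same initial velocity has zero initial data.\<close>
    note d = solution_unique[OF solution_diff[OF j(1) Y(1)[of "j' a"]], OF _ _ t]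
    have y: "Y t (j' a) = 0" "Y' t (j' a) = j' t" using d 0 by (simp_all add: Y(2,3))
    show ?thesis unfolding J(1) j(3)[OF t] y(2)[symmetric] by (intro imageI CollectI y(1))
  qed
  show "w \<in> A0 A g \<gamma> a b t" if w: "w \<in> E t ` Y' t ` {u. Y t u = 0}"
  proof -
    obtain u where u: "w = E t (Y' t u)" "Y t u = 0" using w by blast
    show ?thesis unfolding A0_def
    proof (intro CollectI exI[of _ "\<lambda>s. E s (Y s u)"] conjI)
      show "w = cov (\<lambda>s. E s (Y s u)) t" using solution_jacobi_field(2)[OF Y(1) t] u(1) by simp
      show "jacobi (\<lambda>s. E s (Y s u))" by (rule solution_jacobi_field(1)[OF Y(1)])
      show "E a (Y a u) = 0" "E t (Y t u) = 0"
        using linear_0[OF linear_E[OF a]] linear_0[OF linear_E[OF t]] by (simp_all add: Y(2) u(2))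
    qed
  qed
qed

text \<open>For \<open>v \<noteq> 0\<close> the field with initial velocity \<open>v\<close> would
  witness conjugacy. \<open>conjugate_along\<close> also asks for a nonzero value; a field vanishing
  on the interval would have both \<open>v\<close> and 0 as derivative at \<open>a\<close>.\<close>

lemma not_conjugate_inj:
  assumes X: "\<And>v. solution (\<lambda>t. X t v) (\<lambda>t. X' t v)" "\<And>v. X a v = 0" "\<And>v. X' a v = v"
    and t: "t \<in> {a..b}" and nc: "\<not> conjugate_along A g \<gamma> {a..b} a t" and v: "X t v = 0"
  shows "v = 0"
proof (rule ccontr)
  assume "v \<noteq> 0"
  have a: "a \<in> {a..b}" using ab by simp
  let ?J = "\<lambda>s. E s (X s v)"
  have J: "jacobi ?J" by (rule solution_jacobi_field(1)[OF X(1)])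
  have E0: "E s 0 = 0" if "s \<in> {a..b}" for s using linear_0[OF linear_E[OF that]] .
  have "?J a = 0" "?J t = 0" by (simp_all add: X(2) v E0 a t del: atLeastAtMost_iff)
  then have all0: "?J r = 0" if "r \<in> {a..b}" for r using J nc that unfolding conjugate_along_def by blast
  have X0: "X r v = 0" if r: "r \<in> {a..b}" for r
    using injD[OF inj_E[OF r], of "X r v" 0] all0[OF r] E0[OF r] by simp
  have 1: "((\<lambda>t. X t v) has_vector_derivative v) (at a within {a..b})"
    using X(1)[of v] a unfolding solution_def X(3) by (metis X(3))
  have 2: "((\<lambda>t. X t v) has_vector_derivative 0) (at a within {a..b})"
    by (rule has_vector_derivative_transform[OF a X0 has_vector_derivative_const])
  have "v = 0"
    using vector_derivative_within_closed_interval[OF ab a 1] vector_derivative_within_closed_interval[OF ab a 2] by simp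
  with \<open>v \<noteq> 0\<close> show False by simp
qed

end

section \<open>Passage between the geodesic and its extension, and the theorem\<close>

lemma arc_restrict:
  assumes P: "arc A g \<gamma>' a' b" and Q: "arc A g \<gamma> a b" and a: "a' \<le> a" and eq: "\<And>t. t \<in> {a..b} \<Longrightarrow> \<gamma>' t = \<gamma> t"
    and t: "t \<in> {a..b}"
  shows arc_restrict_hcd: "arc.hcd_on A g \<gamma>' a' b {a'..b} J K t \<Longrightarrow> arc.hcd_on A g \<gamma> a b {a..b} J K t"
    and arc_restrict_Rj: "arc.Rj A g \<gamma>' a' b t u = arc.Rj A g \<gamma> a b t u"
proof -
  interpret P: arc A g \<gamma>' a' b by (rule P)
  interpret Q: arc A g \<gamma> a b by (rule Q)
  have sub: "{a..b} \<subseteq> {a'..b}" using a by auto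
  have crd: "Q.crd c s = P.crd c s" if "s \<in> {a..b}" for c s by (simp add: P.crd_def Q.crd_def eq[OF that])
  have pre: "t \<in> P.pre c" if "t \<in> Q.pre c" for c using that sub eq[OF t] by (auto simp: P.pre_def Q.pre_def)
  \<comment> \<open>Derivatives within the longer interval restrict to the shorter one, and
    uniqueness there identifies the velocities, also at \<open>a\<close>, where the velocity of
    \<gamma> is one-sided.\<close>
  have vel: "Q.vel c t = P.vel c t" if c: "c \<in> A" "t \<in> Q.pre c" for c
    by (rule Q.vel_unique[OF t has_vector_derivative_transform[OF t crd
          has_vector_derivative_within_subset[OF P.crd_derivative[OF c(1) pre[OF c(2)]] sub]]])
  have loc: "loc_field A \<gamma> c L s = loc_field A \<gamma>' c L s" if "s \<in> {a..b}" for c L s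
    by (simp add: loc_field_def eq[OF that])
  show "Q.hcd_on {a..b} J K t" if "P.hcd_on {a'..b} J K t"
    unfolding Q.hcd_on_def Q.covd_def
  proof (intro ballI impI)
    fix c assume c: "c \<in> A" "t \<in> Q.pre c"
    have "(loc_field A \<gamma> c J has_vector_derivative
        loc_field A \<gamma>' c K t - christoffel A g c (P.crd c t) (P.vel c t) (loc_field A \<gamma>' c J t)) (at t within {a..b})"
      by (rule has_vector_derivative_transform[OF t loc
            has_vector_derivative_within_subset[OF P.hcdD[OF that c(1) pre[OF c(2)]] sub]])
    then show "(loc_field A \<gamma> c J has_vector_derivative
        loc_field A \<gamma> c K t - christoffel A g c (Q.crd c t) (Q.vel c t) (loc_field A \<gamma> c J t)) (at t within {a..b})"
      by (simp only: loc[OF t] crd[OF t] vel[OF c])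
  qed
  show "P.Rj t u = Q.Rj t u"
    unfolding P.Rj_eq Q.Rj_eq eq[OF t] crd[OF t] vel[OF P.tchart(1) Q.pre_tc[OF t]] ..
qed

theorem corollary4p11:
  fixes A :: "('m::{t2_space,second_countable_topology}, 'e::euclidean_space) chart set"
    and g :: "('m, 'e) metric_field"
    and \<gamma> :: "real \<Rightarrow> 'm"
    and a b t0 :: real
  assumes "semi_riemannian A g"
    and "a < b"
    and "geodesic A g \<gamma> {a..b}"
    and "first_conjugate_instant A g \<gamma> a b t0"
    and "nondegenerate_instant A g \<gamma> a b t0"
    and "mul A g \<gamma> a b t0 > metric_index g + conj_index A g \<gamma> a b t0"
  shows "\<forall>a' < a. \<forall>\<gamma>' :: real \<Rightarrow> 'm.
           geodesic A g \<gamma>' {a'..b} \<and> (\<forall>t\<in>{a..b}. \<gamma>' t = \<gamma> t) \<longrightarrow>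
             (\<exists>t'\<in>{a..t0}. conjugate_along A g \<gamma>' {a'..b} a' t')"
proof (intro allI impI, elim conjE)
  fix a' :: real and \<gamma>' :: "real \<Rightarrow> 'm"
  assume a': "a' < a" and geo: "geodesic A g \<gamma>' {a'..b}" and "\<forall>t\<in>{a..b}. \<gamma>' t = \<gamma> t"
  then have eq: "\<And>t. t \<in> {a..b} \<Longrightarrow> \<gamma>' t = \<gamma> t" by blast
  have t0: "a < t0" "t0 \<le> b"
    using assms(4) by (auto simp: first_conjugate_instant_def conjugate_instant_def)
  have arcP: "arc A g \<gamma>' a' b" and arcQ: "arc A g \<gamma> a b"
    using assms(1-3) a' geo by (auto intro!: arc.intro semi_riem.intro arc_axioms.intro simp: geodesic_def)
  interpret P: arc A g \<gamma>' a' b by (rule arcP)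
  interpret Q: arc A g \<gamma> a b by (rule arcQ)
  have sub: "{a..b} \<subseteq> {a'..b}" "{a..t0} \<subseteq> {a..b}" using a' t0 by auto
  show "\<exists>t'\<in>{a..t0}. conjugate_along A g \<gamma>' {a'..b} a' t'"
  proof (rule ccontr)
    assume "\<not> (\<exists>t'\<in>{a..t0}. conjugate_along A g \<gamma>' {a'..b} a' t')"
    then have nc: "\<not> conjugate_along A g \<gamma>' {a'..b} a' t" if "t \<in> {a..t0}" for t using that by blast
    \<comment> \<open>The frame is built along the extension and normalized at \<open>a'\<close>.
      Its restriction serves \<gamma> as well, so both families are expressed in the same
      coordinates and with the same \<open>h\<close>.\<close>
    obtain E where E: "P.parallel_frame E" "\<And>v. E a' v = v" using P.parallel_frame_exists by blast
    define h where "h = g (\<gamma>' a')"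
    have gE: "g (\<gamma>' t) (E t u) (E t v) = h u v" if "t \<in> {a'..b}" for t u v
      using P.parallel_frame_isometric[OF E(1) that] by (simp add: h_def E(2))
    have hp: "bilinear h" "\<And>u v. h u v = h v u" "nondegenerate_on UNIV h"
      unfolding h_def by (rule P.g_bilinear P.g_sym P.g_nondegenerate)+
    interpret P: framed_arc A g \<gamma>' a' b E h
      by unfold_locales (use E(1) gE hp in auto)
    have gEQ: "g (\<gamma> t) (E t u) (E t v) = h u v" if "t \<in> {a..b}" for t u v
      using gE[of t u v] subsetD[OF sub(1) that] unfolding eq[OF that] by blast
    have EQ: "Q.parallel_frame E" unfolding Q.parallel_frame_def
    proof (intro ballI conjI allI)
      fix t v assume t: "t \<in> {a..b}"
      note tP = subsetD[OF sub(1) t]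
      show "linear (E t)" by (rule P.linear_E[OF tP])
      show "Q.hcd_on {a..b} (\<lambda>s. E s v) (\<lambda>_. 0) t"
        by (rule arc_restrict_hcd[OF arcP arcQ less_imp_le[OF a'] eq t P.hcd_E[OF tP]])
    qed
    interpret Q: framed_arc A g \<gamma> a b E h
      by unfold_locales (rule EQ, erule gEQ, (rule hp)+)
    have RE: "P.RE t u = Q.RE t u" if "t \<in> {a..b}" for t u
    proof -
      have "P.Rj t v = Q.Rj t v" for v
        by (rule arc_restrict_Rj[OF arcP arcQ less_imp_le[OF a'] eq that])
      then show ?thesis by (simp add: P.RE_def Q.RE_def P.Ei_def Q.Ei_def)
    qed
    have PQ: "Q.solution j j'" if "P.solution j j'" for j j'
      unfolding Q.solution_def
    proof (intro ballI)
      fix t assume t: "t \<in> {a..b}"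
      then have "t \<in> {a'..b}" using sub(1) by blast
      then have "(j has_vector_derivative j' t) (at t within {a'..b})"
        "(j' has_vector_derivative P.RE t (j t)) (at t within {a'..b})" using that unfolding P.solution_def by blast+
      then show "(j has_vector_derivative j' t) (at t within {a..b}) \<and>
          (j' has_vector_derivative Q.RE t (j t)) (at t within {a..b})"
        unfolding RE[OF t] using has_vector_derivative_within_subset sub(1) by blast
    qed
    obtain Z Z' where "\<forall>v. P.solution (\<lambda>t. Z t v) (\<lambda>t. Z' t v)" "\<forall>v. Z a' v = 0" "\<forall>v. Z' a' v = v"
      "\<forall>t. linear (Z t)" "\<forall>t. linear (Z' t)" by (rule P.fundamental_solution)
    note Z = this[rule_format]
    obtain Y Y' where "\<forall>v. Q.solution (\<lambda>t. Y t v) (\<lambda>t. Y' t v)" "\<forall>v. Y a v = 0" "\<forall>v. Y' a v = v"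
      "\<forall>t. linear (Y t)" "\<forall>t. linear (Y' t)" by (rule Q.fundamental_solution)
    note Y = this[rule_format]
    have injZ: "v = 0" if "t \<in> {a..t0}" "Z t v = 0" for t v
      by (rule P.not_conjugate_inj[OF Z(1-3) _ nc[OF that(1)] that(2)]) (use that(1) sub in auto)
    \<comment> \<open>The case \<open>t' = a\<close>: since \<open>a\<close> is not conjugate to
      \<open>a'\<close>, the family can be normalized to be the identity at
      \<open>a\<close>.\<close>
    have "inj (Z a)" unfolding linear_injective_0[OF Z(4)] using injZ[of a] t0 by auto
    then obtain F where F: "linear F" "\<And>v. Z a (F v) = v" "\<And>v. F (Z a v) = v"
      using linear_injective_isomorphism[OF Z(4)] by blast
    define X where "X t v = Z t (F v)" for t v
    define X' where "X' t v = Z' t (F v)" for t v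
    have Xs: "Q.solution (\<lambda>t. X t v) (\<lambda>t. X' t v)" for v unfolding X_def X'_def by (rule PQ[OF Z(1)])
    have Xa: "X a v = v" for v by (simp add: X_def F(2))
    have hz: "h 0 w = 0" "h w 0 = 0" for w using bilinear_lzero[OF hp(1)] bilinear_rzero[OF hp(1)] by auto
    have aQ: "a \<in> {a..b}" and aP: "a' \<in> {a'..b}" and t0Q: "t0 \<in> {a..b}" using t0 a' by auto
    have XY: "h (X t v) (Y' t u) - h (X' t v) (Y t u) = h v u" if "t \<in> {a..b}" for t u v
      using Q.wronskian[OF Xs Y(1) that aQ, of v u] by (simp add: Y(2,3) Xa hz)
    \<comment> \<open>This Wronskian is evaluated at \<open>a'\<close>, where the family vanishes;
      hence the family is solved on the extended interval.\<close>
    have XX: "h (X t v) (X' t u) = h (X' t v) (X t u)" if "t \<in> {a'..b}" for t u v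
      using P.wronskian[OF Z(1) Z(1) that aP, of "F v" "F u"] by (simp add: X_def X'_def Z(2) hz)
    have YY: "h (Y t v) (Y' t u) = h (Y' t v) (Y t u)" if "t \<in> {a..b}" for t u v
      using Q.wronskian[OF Y(1) Y(1) that aQ, of v u] by (simp add: Y(2) hz)
    have hzero: "v = 0" if "\<And>w. h w v = 0" for v
      using hp(3) that hp(2) unfolding nondegenerate_on_def by (metis UNIV_I)
    have injY: "v = 0" if t: "t \<in> {a<..<t0}" and v: "Y t v = 0" for t v
    proof -
      have tQ: "t \<in> {a..b}" using t t0 by auto
      have "\<not> conjugate_instant A g \<gamma> a b t" using assms(4) t by (auto simp: first_conjugate_instant_def)
      then have "A0 A g \<gamma> a b t = {0}" using t t0 by (simp add: conjugate_instant_def)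
      moreover have "E t (Y' t v) \<in> A0 A g \<gamma> a b t" unfolding Q.A0_eq[OF Y(1-3) tQ] using v by blast
      ultimately have "E t (Y' t v) = E t 0" using linear_0[OF Q.linear_E[OF tQ]] by simp
      then have "Y' t v = 0" by (rule injD[OF Q.inj_E[OF tQ]])
      \<comment> \<open>Triviality of \<open>A0\<close> yields only a vanishing velocity at
        \<open>t\<close>. Together with \<open>Y t v = 0\<close>, the pairing \<open>XY\<close> then
        gives \<open>h w v = 0\<close> for every \<open>w\<close>.\<close>
      then show ?thesis using XY[OF tQ, of _ v] v by (intro hzero) (simp add: hz)
    qed
    interpret J: jacobi_pair h X X' Y Y' a t0
    proof (rule jacobi_pair.intro)
      show "linear (X t)" "linear (X' t)" for t
        unfolding X_def X'_def using linear_compose[OF F(1) Z(4)] linear_compose[OF F(1) Z(5)] by (simp_all add: o_def)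
      show "((\<lambda>t. X t v) has_vector_derivative X' t v) (at t within {a..t0})" if "t \<in> {a..t0}" for t v
        using Xs[of v] that sub(2) has_vector_derivative_within_subset unfolding Q.solution_def by blast
      show "((\<lambda>t. Y t v) has_vector_derivative Y' t v) (at t within {a..t0})" if "t \<in> {a..t0}" for t v
        using Y(1)[of v] that sub(2) has_vector_derivative_within_subset unfolding Q.solution_def by blast
      show "v = 0" if "t \<in> {a..t0}" "X t v = 0" for t v
        using injZ[OF that(1), of "F v"] that(2) F(2)[of v] linear_0[OF Z(4)] by (simp add: X_def)
      show "h (X t v) (X' t u) = h (X' t v) (X t u)" if "t \<in> {a..t0}" for t u v
        by (rule XX) (use that sub in auto)
    qed (use t0 hp Y XY YY sub Xa injY in auto)
    let ?W = "A0 A g \<gamma> a b t0"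
    have W: "?W = E t0 ` Y' t0 ` {u. Y t0 u = 0}" by (rule Q.A0_eq[OF Y(1-3) t0Q])
    have "subspace ?W" unfolding W
      by (intro linear_subspace_image Q.linear_E[OF t0Q] Y(5) linear_subspace_kernel Y(4))
    moreover have "nondegenerate_on ?W (g (\<gamma> t0))" using assms(5) by (simp add: nondegenerate_instant_def)
    ultimately obtain P0 where P0: "subspace P0" "P0 \<subseteq> ?W" "\<And>v. v \<in> P0 \<Longrightarrow> v \<noteq> 0 \<Longrightarrow> g (\<gamma> t0) v v > 0"
      "neg_index ?W (g (\<gamma> t0)) + dim P0 = dim ?W"
      using neg_pos_split[OF _ P.g_bilinear P.g_sym] by metis
    \<comment> \<open>\<open>P0\<close> consists of tangent vectors at \<open>t0\<close>;
      \<open>P1\<close> is the same space in frame coordinates, where \<open>h\<close> takes the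
      place of \<open>g\<close>.\<close>
    define P1 where "P1 = {v. E t0 v \<in> P0}"
    have lE: "linear (E t0)" and iE: "inj (E t0)" using Q.linear_E[OF t0Q] Q.inj_E[OF t0Q] by auto
    have P1: "subspace P1" using linear_subspace_vimage[OF lE P0(1)] by (simp add: P1_def vimage_def)
    have "E t0 ` P1 = P0" unfolding P1_def using image_vimage_eq[of "E t0" P0] Q.surj_E[OF t0Q] by (simp add: vimage_def)
    then have dimP: "dim P1 = dim P0" using dim_image_eq[OF lE inj_on_subset[OF iE subset_UNIV], of P1] by simp
    have "dim P1 \<le> neg_index UNIV h"
    proof (rule J.pos_def_dim_le[OF P1])
      fix y assume y: "y \<in> P1"
      then have "E t0 y \<in> E t0 ` Y' t0 ` {u. Y t0 u = 0}" using P0(2) unfolding P1_def W by blast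
      then show "\<exists>u. y = Y' t0 u \<and> Y t0 u = 0" using injD[OF iE] by blast
      assume "y \<noteq> 0"
      then have "E t0 y \<noteq> 0" using injD[OF iE, of y 0] linear_0[OF lE] by auto
      then show "h y y > 0" using P0(3)[of "E t0 y"] y Q.gE[OF t0Q, of y y] by (simp add: P1_def)
    qed
    also have "\<dots> = metric_index g" unfolding h_def by (rule P.metric_index_eq[symmetric])
    \<comment> \<open>By \<open>P0(4)\<close> this dimension is \<open>mul\<close> minus
      \<open>conj_index\<close> at \<open>t0\<close>, which the last hypothesis places strictly
      above \<open>metric_index g\<close>.\<close>
    finally show False using assms(6) P0(4) dimP by (simp add: mul_def conj_index_def)
  qed
qed

end
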